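(* If $X$ is a reflexive r.i. space on $(0,\infty)$ such that $X\ne L_p(0,\infty)$ for every $1<p<\infty$, then at least one of the spaces $X$ or $X^*$ is not DH.
   Context: Let $m$ be Lebesgue measure on $I=(0,\infty)$. A Banach function lattice on $I$ is a (nonzero) Banach space $X$ of (a.e. equivalence classes of) real-valued measurable functions on $I$ such that if $f$ is measurable, $|f|\le|g|$ a.e. and $g\in X$, then $f\in X$ and $\|f\|_X\le\|g\|_X$. It is a rearrangement invariant (r.i.) space if, whenever $y\in X$ and $x$ is equimeasurable with $y$ (i.e. $m\{|x|>\tau\}=m\{|y|>\tau\}$ for all $\tau>0$), then $x\in X$ and $\|x\|_X=\|y\|_X$. By convention every r.i. space is assumed to be either separable or maximal, i.e. $X=X''$, where $X'$ is the Köthe dual: all measurable $f$ with $\|f\|_{X'}=\sup_{\|g\|_X\le1}\int|fg|<\infty$. For separable $X$, $X^*$ coincides with $X'$. Equality of function spaces such as $X=L_p$ means equality as sets, with equivalent norms. Sequences $\{x_n\}\subset A$, $\{y_n\}\subset B$ in Banach spaces are equivalent if there are $c,C>0$ such that $c\|\sum a_nx_n\|_A\le\|\sum a_ny_n\|_B\le C\|\sum a_nx_n\|_A$ for all finitely supported real sequences $(a_n)$. A Banach lattice is disjointly homogeneous (DH) if any two normalized disjoint sequences contain equivalent subsequences (i.e. the first has a subsequence that is equivalent to some subsequence of the second). *)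

theory Defs
  imports "HOL-Analysis.Analysis"
begin

abbreviation \<mu> :: "real measure" where
  "\<mu> \<equiv> lebesgue_on {0<..}"

text \<open>
  Both the function spaces on the half-line and their Banach duals consist of real-valued
  functions (of a real number, respectively of an element of the space), so one record covers
  both; the vector operations are always the pointwise ones.  The relation \<open>leq\<close> is only a
  preorder and \<open>nrm\<close> only a seminorm on the functions: for function spaces, elements that
  agree almost everywhere are not identified by HOL equality.
\<close>

record 'a normed_lattice =
  elts :: "('a \<Rightarrow> real) set"
  nrm :: "('a \<Rightarrow> real) \<Rightarrow> real"
  leq :: "('a \<Rightarrow> real) \<Rightarrow> ('a \<Rightarrow> real) \<Rightarrow> bool"

definition ae_le :: "(real \<Rightarrow> real) \<Rightarrow> (real \<Rightarrow> real) \<Rightarrow> bool" where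
  "ae_le f g \<longleftrightarrow> (AE t in \<mu>. f t \<le> g t)"

definition banach_function_lattice :: "real normed_lattice \<Rightarrow> bool" where
  "banach_function_lattice X \<longleftrightarrow>
     leq X = ae_le \<and>
     elts X \<subseteq> borel_measurable \<mu> \<and>
     (\<lambda>_. 0) \<in> elts X \<and>
     (\<forall>f\<in>elts X. \<forall>g\<in>elts X. (\<lambda>t. f t + g t) \<in> elts X) \<and>
     (\<forall>f\<in>elts X. \<forall>c. (\<lambda>t. c * f t) \<in> elts X) \<and>
     (\<forall>f\<in>elts X. 0 \<le> nrm X f) \<and>
     (\<forall>f\<in>elts X. nrm X f = 0 \<longleftrightarrow> (AE t in \<mu>. f t = 0)) \<and>
     (\<forall>f\<in>elts X. \<forall>c. nrm X (\<lambda>t. c * f t) = \<bar>c\<bar> * nrm X f) \<and>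
     (\<forall>f\<in>elts X. \<forall>g\<in>elts X. nrm X (\<lambda>t. f t + g t) \<le> nrm X f + nrm X g) \<and>
     (\<forall>u. (\<forall>n. u n \<in> elts X) \<and>
          (\<forall>\<epsilon>>0. \<exists>K. \<forall>i\<ge>K. \<forall>j\<ge>K. nrm X (\<lambda>t. u i t - u j t) < \<epsilon>) \<longrightarrow>
          (\<exists>f\<in>elts X. (\<lambda>n::nat. nrm X (\<lambda>t. u n t - f t)) \<longlonglongrightarrow> 0)) \<and>
     (\<forall>f\<in>borel_measurable \<mu>. \<forall>g\<in>elts X. (AE t in \<mu>. \<bar>f t\<bar> \<le> \<bar>g t\<bar>) \<longrightarrow>
          f \<in> elts X \<and> nrm X f \<le> nrm X g) \<and>
     (\<exists>f\<in>elts X. \<not> (AE t in \<mu>. f t = 0))"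

definition equimeasurable :: "(real \<Rightarrow> real) \<Rightarrow> (real \<Rightarrow> real) \<Rightarrow> bool" where
  "equimeasurable x y \<longleftrightarrow>
     (\<forall>\<tau>>0. emeasure \<mu> {t\<in>space \<mu>. \<bar>x t\<bar> > \<tau>} = emeasure \<mu> {t\<in>space \<mu>. \<bar>y t\<bar> > \<tau>})"

definition separable :: "'a normed_lattice \<Rightarrow> bool" where
  "separable X \<longleftrightarrow> (\<exists>D. countable D \<and> D \<subseteq> elts X \<and>
     (\<forall>f\<in>elts X. \<forall>\<epsilon>>0. \<exists>d\<in>D. nrm X (\<lambda>t. f t - d t) < \<epsilon>))"

definition koethe_enorm :: "real normed_lattice \<Rightarrow> (real \<Rightarrow> real) \<Rightarrow> ennreal" where
  "koethe_enorm X f =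
     (SUP g\<in>{g\<in>elts X. nrm X g \<le> 1}. \<integral>\<^sup>+ t. ennreal \<bar>f t * g t\<bar> \<partial>\<mu>)"

definition koethe_dual :: "real normed_lattice \<Rightarrow> real normed_lattice" where
  "koethe_dual X = \<lparr> elts = {f \<in> borel_measurable \<mu>. koethe_enorm X f < \<infinity>},
                     nrm = (\<lambda>f. enn2real (koethe_enorm X f)),
                     leq = ae_le \<rparr>"

definition same_space :: "real normed_lattice \<Rightarrow> real normed_lattice \<Rightarrow> bool" where
  "same_space X Y \<longleftrightarrow> elts X = elts Y \<and>
     (\<exists>c>0. \<exists>C>0. \<forall>f\<in>elts X. c * nrm X f \<le> nrm Y f \<and> nrm Y f \<le> C * nrm X f)"

definition maximal :: "real normed_lattice \<Rightarrow> bool" where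
  "maximal X \<longleftrightarrow> same_space X (koethe_dual (koethe_dual X))"

definition ri_space :: "real normed_lattice \<Rightarrow> bool" where
  "ri_space X \<longleftrightarrow> banach_function_lattice X \<and>
     (\<forall>y\<in>elts X. \<forall>x\<in>borel_measurable \<mu>. equimeasurable x y \<longrightarrow>
        x \<in> elts X \<and> nrm X x = nrm X y) \<and>
     (separable X \<or> maximal X)"

definition Lp_space :: "real \<Rightarrow> real normed_lattice" where
  "Lp_space p = \<lparr> elts = {f \<in> borel_measurable \<mu>. integrable \<mu> (\<lambda>t. \<bar>f t\<bar> powr p)},
                  nrm = (\<lambda>f. (\<integral>t. \<bar>f t\<bar> powr p \<partial>\<mu>) powr (1 / p)),
                  leq = ae_le \<rparr>"

text \<open>
  Functionals are total HOL functions; making them vanish off the space gives each bounded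
  linear functional exactly one representative.
\<close>

definition dual_space :: "'a normed_lattice \<Rightarrow> ('a \<Rightarrow> real) normed_lattice" where
  "dual_space X =
     \<lparr> elts = {\<phi>. (\<forall>f. f \<notin> elts X \<longrightarrow> \<phi> f = 0) \<and>
                 (\<forall>f\<in>elts X. \<forall>g\<in>elts X. \<phi> (\<lambda>t. f t + g t) = \<phi> f + \<phi> g) \<and>
                 (\<forall>f\<in>elts X. \<forall>c. \<phi> (\<lambda>t. c * f t) = c * \<phi> f) \<and>
                 (\<exists>C. \<forall>f\<in>elts X. \<bar>\<phi> f\<bar> \<le> C * nrm X f)},
       nrm = (\<lambda>\<phi>. SUP f\<in>{f\<in>elts X. nrm X f \<le> 1}. \<bar>\<phi> f\<bar>),
       leq = (\<lambda>\<phi> \<psi>. \<forall>f\<in>elts X. leq X (\<lambda>_. 0) f \<longrightarrow> \<phi> f \<le> \<psi> f) \<rparr>"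

definition reflexive :: "'a normed_lattice \<Rightarrow> bool" where
  "reflexive X \<longleftrightarrow> (\<forall>\<Phi>\<in>elts (dual_space (dual_space X)).
     \<exists>f\<in>elts X. \<forall>\<phi>\<in>elts (dual_space X). \<Phi> \<phi> = \<phi> f)"

definition is_modulus :: "'a normed_lattice \<Rightarrow> ('a \<Rightarrow> real) \<Rightarrow> ('a \<Rightarrow> real) \<Rightarrow> bool" where
  "is_modulus X x u \<longleftrightarrow> u \<in> elts X \<and> leq X x u \<and> leq X (\<lambda>t. - x t) u \<and>
     (\<forall>w\<in>elts X. leq X x w \<and> leq X (\<lambda>t. - x t) w \<longrightarrow> leq X u w)"

text \<open>
  Disjointness is the Banach lattice notion \<open>\<bar>x\<bar> \<and> \<bar>y\<bar> = 0\<close>, with modulus and infimum taken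
  in the order of the space.
\<close>

definition lattice_disjoint :: "'a normed_lattice \<Rightarrow> ('a \<Rightarrow> real) \<Rightarrow> ('a \<Rightarrow> real) \<Rightarrow> bool" where
  "lattice_disjoint X x y \<longleftrightarrow> (\<exists>u v. is_modulus X x u \<and> is_modulus X y v \<and>
     leq X (\<lambda>_. 0) u \<and> leq X (\<lambda>_. 0) v \<and>
     (\<forall>w\<in>elts X. leq X w u \<and> leq X w v \<longrightarrow> leq X w (\<lambda>_. 0)))"

definition normalized_disjoint_seq :: "'a normed_lattice \<Rightarrow> (nat \<Rightarrow> 'a \<Rightarrow> real) \<Rightarrow> bool" where
  "normalized_disjoint_seq X x \<longleftrightarrow> (\<forall>n. x n \<in> elts X \<and> nrm X (x n) = 1) \<and>
     (\<forall>i j. i \<noteq> j \<longrightarrow> lattice_disjoint X (x i) (x j))"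

definition equivalent_seqs ::
  "'a normed_lattice \<Rightarrow> (nat \<Rightarrow> 'a \<Rightarrow> real) \<Rightarrow> 'b normed_lattice \<Rightarrow> (nat \<Rightarrow> 'b \<Rightarrow> real) \<Rightarrow> bool"
where
  "equivalent_seqs A x B y \<longleftrightarrow> (\<exists>c>0. \<exists>C>0. \<forall>a::nat \<Rightarrow> real. finite {n. a n \<noteq> 0} \<longrightarrow>
     c * nrm A (\<lambda>t. \<Sum>n | a n \<noteq> 0. a n * x n t) \<le> nrm B (\<lambda>t. \<Sum>n | a n \<noteq> 0. a n * y n t) \<and>
     nrm B (\<lambda>t. \<Sum>n | a n \<noteq> 0. a n * y n t) \<le> C * nrm A (\<lambda>t. \<Sum>n | a n \<noteq> 0. a n * x n t))"

definition disjointly_homogeneous :: "'a normed_lattice \<Rightarrow> bool" where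
  "disjointly_homogeneous X \<longleftrightarrow>
     (\<forall>x y. normalized_disjoint_seq X x \<and> normalized_disjoint_seq X y \<longrightarrow>
        (\<exists>r s. strict_mono r \<and> strict_mono s \<and> equivalent_seqs X (x \<circ> r) X (y \<circ> s)))"

lemma lattice_disjoint_function_lattice:
  assumes X: "banach_function_lattice X" and f: "f \<in> elts X" and g: "g \<in> elts X"
  shows "lattice_disjoint X f g \<longleftrightarrow> (AE t in \<mu>. f t * g t = 0)"
proof -
  have le: "leq X = ae_le" and meas: "\<And>h. h \<in> elts X \<Longrightarrow> h \<in> borel_measurable \<mu>"
    and ideal: "\<And>h k. h \<in> borel_measurable \<mu> \<Longrightarrow> k \<in> elts X \<Longrightarrow>
      AE t in \<mu>. \<bar>h t\<bar> \<le> \<bar>k t\<bar> \<Longrightarrow> h \<in> elts X"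
    using X unfolding banach_function_lattice_def by blast+
  have [measurable]: "f \<in> borel_measurable \<mu>" "g \<in> borel_measurable \<mu>"
    using meas f g by auto
  have absX: "(\<lambda>t. \<bar>h t\<bar>) \<in> elts X" if "h \<in> elts X" for h
    using meas[OF that] by (intro ideal[OF _ that]) auto
  have minX: "(\<lambda>t. min \<bar>f t\<bar> \<bar>g t\<bar>) \<in> elts X"
    by (intro ideal[OF _ f]) auto
  have mod: "is_modulus X h (\<lambda>t. \<bar>h t\<bar>)" if "h \<in> elts X" for h
    using absX[OF that] unfolding is_modulus_def le ae_le_def by auto
  show ?thesis
  proof
    assume "lattice_disjoint X f g"
    then obtain u v where u: "is_modulus X f u" and v: "is_modulus X g v"
      and inf: "\<And>w. w \<in> elts X \<Longrightarrow> leq X w u \<Longrightarrow> leq X w v \<Longrightarrow> leq X w (\<lambda>_. 0)"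
      unfolding lattice_disjoint_def by blast
    have "AE t in \<mu>. f t \<le> u t" "AE t in \<mu>. - f t \<le> u t"
      "AE t in \<mu>. g t \<le> v t" "AE t in \<mu>. - g t \<le> v t"
      using u v unfolding is_modulus_def le ae_le_def by auto
    then have "AE t in \<mu>. min \<bar>f t\<bar> \<bar>g t\<bar> \<le> u t" "AE t in \<mu>. min \<bar>f t\<bar> \<bar>g t\<bar> \<le> v t"
      by (eventually_elim, linarith)+
    then have "AE t in \<mu>. min \<bar>f t\<bar> \<bar>g t\<bar> \<le> 0"
      using inf[OF minX] unfolding le ae_le_def by auto
    then show "AE t in \<mu>. f t * g t = 0"
      by eventually_elim (auto simp: min_def split: if_splits)
  next
    assume fg: "AE t in \<mu>. f t * g t = 0"
    have "AE t in \<mu>. w t \<le> 0"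
      if "AE t in \<mu>. w t \<le> \<bar>f t\<bar>" "AE t in \<mu>. w t \<le> \<bar>g t\<bar>" for w
      using fg that by eventually_elim auto
    then show "lattice_disjoint X f g"
      unfolding lattice_disjoint_def using mod[OF f] mod[OF g]
      by (intro exI[of _ "\<lambda>t. \<bar>f t\<bar>"] exI[of _ "\<lambda>t. \<bar>g t\<bar>"]) (auto simp: le ae_le_def)
  qed
qed

end

theory Submission
  imports Defs
begin

text \<open>
  Suppose that \<open>X\<close> and its dual are both disjointly homogeneous; the aim is to show that \<open>X\<close> is an
  \<open>L\<^sub>p\<close> space with \<open>1 < p < \<infinity>\<close>.
  
  The half-line is isomorphic, as a measure space, to countably many copies of itself.  For \<open>f\<close> in \<open>X\<close> and a
  finitely supported sequence \<open>a\<close>, let \<open>a \<otimes> f\<close> be the function that equals \<open>a n\<close> times \<open>f\<close> on the \<open>n\<close>-th copy,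
  and let \<open>\<chi>\<close> be the indicator of a set of measure one.  The copies of a fixed \<open>f\<close> form a disjoint sequence that
  is isometrically equivalent to each of its subsequences, so disjoint homogeneity makes it equivalent to
  the sequence of copies of \<open>\<chi>\<close>: the norm of \<open>a \<otimes> f\<close> is at most a constant times the norm of \<open>a \<otimes> \<chi>\<close>.
  The constant depends on \<open>f\<close>, but a gliding hump shows that it can be taken to be \<open>C \<parallel>f\<parallel>\<close> with a
  fixed \<open>C\<close> (\<open>uniform_copies\<close>).  The Koethe dual embeds into the Banach dual isometrically and with
  preservation of disjointness, so it satisfies the same estimate.
  
  Every step function has a norming functional that is a step function with the same steps
  (\<open>norming\<close>): the Hahn-Banach theorem in finite dimension gives its heights, and averaging over
  rearrangements shows that it is still bounded on all of \<open>X\<close>.  Pairing \<open>a \<otimes> f\<close> with the tensor product of two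
  such functionals turns the upper estimate in the Koethe dual into a lower estimate in \<open>X\<close>.  Hence,
  on step functions, the norm of a tensor product is the product of the norms up to constants
  (\<open>steps_tensor_bounds\<close>).
  
  For constant sequences this says that the fundamental function \<open>n \<mapsto> \<parallel>\<chi>\<^bsub>(0,n]\<^esub>\<parallel>\<close> is multiplicative up to
  constants, hence comparable to a power \<open>n\<^sup>\<alpha>\<close>; reflexivity forces \<open>0 < \<alpha> < 1\<close>.  Put \<open>p = 1/\<alpha>\<close>.  Grouping the
  heights of a step function dyadically compares its norm to its \<open>L\<^sub>p\<close> norm with a loss
  that is linear in the number \<open>L\<close> of groups.  Applied to the \<open>k\<close>-th tensor power, this loss is of order \<open>k L\<close>,
  and it disappears after taking \<open>k\<close>-th roots (\<open>equivalent_to_power_sum\<close>).  So the norm of \<open>X\<close> is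
  equivalent to the \<open>L\<^sub>p\<close> norm on step functions, then on simple functions, and finally, by
  monotone approximation and completeness, on the whole space (\<open>same_space_Lp\<close>).
\<close>

section \<open>Countably many copies of the half-line\<close>

text \<open>
  The cells \<open>(k, k + 1]\<close> are closed on the right because \<open>0\<close> is not a point of the half-line.
\<close>

definition cell :: "real \<Rightarrow> nat" where
  "cell x = nat (\<lceil>x\<rceil> - 1)"

text \<open>
  Cantor pairing of the cell numbers splits the half-line into countably many copies of itself: cell
  number \<open>prod_encode (n, k)\<close> is the cell \<open>(k, k + 1]\<close> of copy \<open>n\<close>.  The point at position \<open>y\<close> of copy \<open>n\<close>
  is \<open>place n y\<close>, and \<open>copy_no\<close>, \<open>copy_pos\<close> are the two coordinates of a point.
\<close>

definition copy_no :: "real \<Rightarrow> nat" where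
  "copy_no x = fst (prod_decode (cell x))"

definition copy_pos :: "real \<Rightarrow> real" where
  "copy_pos x = x + (real (snd (prod_decode (cell x))) - real (cell x))"

definition place :: "nat \<Rightarrow> real \<Rightarrow> real" where
  "place n y = y + (real (prod_encode (n, cell y)) - real (cell y))"

lemma cell_add: "0 < r \<Longrightarrow> r \<le> 1 \<Longrightarrow> cell (real k + r) = k"
proof -
  assume "0 < r" "r \<le> 1"
  then have "\<lceil>real k + r\<rceil> = int k + 1" by (intro ceiling_unique) auto
  then show ?thesis by (simp add: cell_def)
qed

lemma cell_decompose:
  assumes "0 < x" obtains r where "0 < r" "r \<le> 1" "x = real (cell x) + r"
proof
  show "x = real (cell x) + (x - real (cell x))" by simp
  have "real (cell x) = \<lceil>x\<rceil> - 1" using assms by (simp add: cell_def)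
  then show "0 < x - real (cell x)" "x - real (cell x) \<le> 1"
    using ceiling_correct[of x] by auto
qed

lemma place_add: "0 < r \<Longrightarrow> r \<le> 1 \<Longrightarrow> place n (real k + r) = real (prod_encode (n, k)) + r"
  by (simp add: place_def cell_add)

lemma copy_no_place: "0 < y \<Longrightarrow> copy_no (place n y) = n"
proof (erule cell_decompose)
  fix r assume r: "0 < r" "r \<le> 1" "y = real (cell y) + r"
  then have "place n y = real (prod_encode (n, cell y)) + r" using place_add[OF r(1,2), of n "cell y"] by simp
  then show ?thesis using r by (simp add: copy_no_def cell_add)
qed

lemma copy_pos_place: "0 < y \<Longrightarrow> copy_pos (place n y) = y"
proof (erule cell_decompose)
  fix r assume r: "0 < r" "r \<le> 1" "y = real (cell y) + r"
  then have "place n y = real (prod_encode (n, cell y)) + r"  using place_add[OF r(1,2), of n "cell y"] by simp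
  then show ?thesis using r by (simp add: copy_pos_def cell_add)
qed

lemma place_copy: "0 < x \<Longrightarrow> place (copy_no x) (copy_pos x) = x"
proof (erule cell_decompose)
  fix r assume r: "0 < r" "r \<le> 1" "x = real (cell x) + r"
  have "copy_pos x = real (snd (prod_decode (cell x))) + r"
    using r(3) by (simp add: copy_pos_def)
  then have "place (copy_no x) (copy_pos x) = real (cell x) + r"
    using place_add[OF r(1,2)] by (simp add: copy_no_def)
  then show ?thesis using r(3) by simp
qed

lemma place_pos [simp]: "0 < y \<Longrightarrow> 0 < place n y"
proof (erule cell_decompose)
  fix r assume r: "0 < r" "r \<le> 1" "y = real (cell y) + r"
  then have "place n y = real (prod_encode (n, cell y)) + r" using place_add[OF r(1,2), of n "cell y"] by simp
  then show ?thesis using r by (simp add: add_nonneg_pos)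
qed

lemma copy_pos_pos [simp]: "0 < x \<Longrightarrow> 0 < copy_pos x"
proof (erule cell_decompose)
  fix r assume r: "0 < r" "r \<le> 1" "x = real (cell x) + r"
  then have "copy_pos x = real (snd (prod_decode (cell x))) + r" by (simp add: copy_pos_def)
  then show ?thesis using r by (simp add: add_nonneg_pos)
qed

lemma space_mu [simp]: "space \<mu> = {0<..}"
  by (simp add: space_restrict_space)

lemma sets_mu: "sets \<mu> = {A. A \<in> sets lebesgue \<and> A \<subseteq> {0<..}}"
  by (auto simp: sets_restrict_space)

lemma emeasure_mu: "A \<in> sets \<mu> \<Longrightarrow> emeasure \<mu> A = emeasure lebesgue A"
  by (auto simp: sets_mu emeasure_restrict_space)

lemma measurable_cell [measurable]: "cell \<in> measurable \<mu> (count_space UNIV)"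
proof -
  have "cell \<in> measurable borel (count_space UNIV)" unfolding cell_def by measurable
  then show ?thesis 
    by (intro measurable_restrict_space1 measurable_completion) simp
qed

lemma measurable_cellwise_translation:
  assumes "\<And>x. 0 < x \<Longrightarrow> 0 < x + c (cell x)"
  shows "(\<lambda>x. x + c (cell x)) \<in> measurable \<mu> \<mu>"
proof (rule measurable_restrict_space2)
  show "(\<lambda>x. x + c (cell x)) \<in> space \<mu> \<rightarrow> {0<..}" using assms by auto
  have "(\<lambda>x. x + c j) \<in> measurable \<mu> lebesgue" for j
    using lebesgue_affine_measurable[of "\<lambda>_. 1::real" "c j"]
    by (intro measurable_restrict_space1) (simp add: add.commute)
  then show "(\<lambda>x. x + c (cell x)) \<in> measurable \<mu> lebesgue"
    by (rule measurable_compose_countable[where f="\<lambda>j x. x + c j" and g=cell, OF _ measurable_cell])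
qed

lemma measurable_copy_pos [measurable]: "copy_pos \<in> measurable \<mu> \<mu>"
proof -
  have "\<And>x. 0 < x \<Longrightarrow> 0 < x + (real (snd (prod_decode (cell x))) - real (cell x))"
    using copy_pos_pos by (simp add: copy_pos_def)
  then show ?thesis
    using measurable_cellwise_translation[of "\<lambda>j. real (snd (prod_decode j)) - real j"]
    by (simp add: copy_pos_def[abs_def])
qed

lemma measurable_place [measurable]: "place n \<in> measurable \<mu> \<mu>"
proof -
  have "\<And>x. 0 < x \<Longrightarrow> 0 < x + (real (prod_encode (n, cell x)) - real (cell x))"
    using place_pos by (simp add: place_def)
  then show ?thesis
    using measurable_cellwise_translation[of "\<lambda>j. real (prod_encode (n, j)) - real j"]
    by (simp add: place_def[abs_def])
qed

lemma measurable_copy_no [measurable]: "copy_no \<in> measurable \<mu> (count_space UNIV)"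
  unfolding copy_no_def by (rule measurable_compose[OF measurable_cell]) simp

lemma nn_integral_cells:
  fixes F :: "real \<Rightarrow> ennreal"
  assumes F: "F \<in> borel_measurable \<mu>"
  shows "(\<integral>\<^sup>+x. F x \<partial>\<mu>) = (\<Sum>k. \<integral>\<^sup>+r. F (real k + r) * indicator {0<..1} r \<partial>lebesgue)"
proof -
  define G where "G x = F x * indicator {0<..} x" for x
  have G[measurable]: "G \<in> borel_measurable lebesgue"
    using F unfolding G_def by (subst (asm) borel_measurable_restrict_space_iff_ennreal) auto
  have "(\<integral>\<^sup>+x. F x \<partial>\<mu>) = (\<integral>\<^sup>+x. G x \<partial>lebesgue)"
    by (simp add: G_def nn_integral_restrict_space)
  also have "\<dots> = (\<integral>\<^sup>+x. (\<Sum>k. G x * indicator {real k<..real k + 1} x) \<partial>lebesgue)"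
  proof (rule nn_integral_cong)
    fix x
    show "G x = (\<Sum>k. G x * indicator {real k<..real k + 1} x)"
    proof (cases "0 < x")
      case True
      then obtain r where r: "0 < r" "r \<le> 1" "x = real (cell x) + r" by (rule cell_decompose)
      have "x \<in> {real k<..real k + 1} \<longleftrightarrow> k = cell x" for k
      proof
        assume "x \<in> {real k<..real k + 1}"
        then show "k = cell x" using cell_add[of "x - real k" k] by auto
      next
        assume "k = cell x" then show "x \<in> {real k<..real k + 1}" using r by auto
      qed
      then have "(\<lambda>k. G x * indicator {real k<..real k + 1} x) = (\<lambda>k. if k = cell x then G x else 0)"
        by (auto simp: indicator_def fun_eq_iff)
      moreover have "(\<lambda>k. if k = cell x then G x else 0) sums G x"
        using sums_single[of "cell x" "\<lambda>_. G x"] by simp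
      ultimately show ?thesis by (simp add: sums_unique[symmetric])
    qed (simp add: G_def)
  qed
  also have "\<dots> = (\<Sum>k. \<integral>\<^sup>+x. G x * indicator {real k<..real k + 1} x \<partial>lebesgue)"
    by (rule nn_integral_suminf) (intro borel_measurable_times_ennreal G borel_measurable_indicator, simp)
  also have "\<dots> = (\<Sum>k. \<integral>\<^sup>+r. F (real k + r) * indicator {0<..1} r \<partial>lebesgue)"
  proof (intro suminf_cong)
    fix k
    have "(\<integral>\<^sup>+x. G x * indicator {real k<..real k + 1} x \<partial>lebesgue) =
      (\<integral>\<^sup>+r. G (real k + 1 * r) * indicator {real k<..real k + 1} (real k + 1 * r) \<partial>lebesgue)"
      by (subst nn_integral_real_affine_lebesgue[where c=1 and t="real k"])
        (auto intro!: borel_measurable_times_ennreal borel_measurable_indicator)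
    also have "\<dots> = (\<integral>\<^sup>+r. F (real k + r) * indicator {0<..1} r \<partial>lebesgue)"
      by (intro nn_integral_cong) (auto simp: G_def indicator_def)
    finally show "(\<integral>\<^sup>+x. G x * indicator {real k<..real k + 1} x \<partial>lebesgue) = \<dots>" .
  qed
  finally show ?thesis .
qed

text \<open>
  This is the statement that \<open>(copy_no, copy_pos)\<close> is measure preserving onto the product with
  counting measure: a sum over all cells is a double sum over copies and their cells.
\<close>

lemma nn_integral_copies:
  fixes F :: "real \<Rightarrow> ennreal"
  assumes F[measurable]: "F \<in> borel_measurable \<mu>"
  shows "(\<integral>\<^sup>+x. F x \<partial>\<mu>) = (\<Sum>n. \<integral>\<^sup>+y. F (place n y) \<partial>\<mu>)"
proof -
  define c where "c j = (\<integral>\<^sup>+r. F (real j + r) * indicator {0<..1} r \<partial>lebesgue)" for j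
  have "(\<integral>\<^sup>+y. F (place n y) \<partial>\<mu>) = (\<Sum>k. c (prod_encode (n, k)))" for n
  proof -
    have "(\<integral>\<^sup>+y. F (place n y) \<partial>\<mu>) =
        (\<Sum>k. \<integral>\<^sup>+r. F (place n (real k + r)) * indicator {0<..1} r \<partial>lebesgue)"
      by (rule nn_integral_cells) measurable
    also have "\<dots> = (\<Sum>k. c (prod_encode (n, k)))"
      unfolding c_def by (intro suminf_cong nn_integral_cong) (auto simp: indicator_def place_add)
    finally show ?thesis .
  qed
  moreover have "(\<Sum>j. c (prod_encode (prod_decode j))) = (\<Sum>n. \<Sum>k. c (prod_encode (n, k)))"
    by (rule suminf_ennreal_2dimen[where f="\<lambda>p. c (prod_encode p)"]) simp
  ultimately show ?thesis using nn_integral_cells[OF F] by (simp add: c_def[symmetric])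
qed

lemma emeasure_copies:
  assumes P: "{x\<in>space \<mu>. P x} \<in> sets \<mu>"
  shows "emeasure \<mu> {x\<in>space \<mu>. P x} = (\<Sum>n. emeasure \<mu> {y\<in>space \<mu>. P (place n y)})"
proof -
  have [measurable]: "Measurable.pred \<mu> P" using P by (simp add: pred_def)
  have "emeasure \<mu> {x\<in>space \<mu>. P x} = (\<integral>\<^sup>+x. indicator {x\<in>space \<mu>. P x} x \<partial>\<mu>)"
    using P by simp
  also have "\<dots> = (\<Sum>n. \<integral>\<^sup>+y. indicator {x\<in>space \<mu>. P x} (place n y) \<partial>\<mu>)"
    using P by (intro nn_integral_copies) simp
  also have "\<dots> = (\<Sum>n. \<integral>\<^sup>+y. indicator {y\<in>space \<mu>. P (place n y)} y \<partial>\<mu>)"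
    by (intro suminf_cong nn_integral_cong) (auto simp: indicator_def)
  also have "\<dots> = (\<Sum>n. emeasure \<mu> {y\<in>space \<mu>. P (place n y)})"
    by (intro suminf_cong nn_integral_indicator) measurable
  finally show ?thesis .
qed

lemma AE_copies: 
  assumes "AE y in \<mu>. P y" shows "AE x in \<mu>. P (copy_pos x)"
proof -
  obtain N where N: "N \<in> null_sets \<mu>" "{y\<in>space \<mu>. \<not> P y} \<subseteq> N" using assms by (auto elim: AE_E simp: null_sets_def)
  have [measurable]: "N \<in> sets \<mu>" using N by auto
  have "emeasure \<mu> {x\<in>space \<mu>. copy_pos x \<in> N} = (\<Sum>n. emeasure \<mu> {y\<in>space \<mu>. copy_pos (place n y) \<in> N})"
    by (rule emeasure_copies) measurable
  also have "\<dots> = (\<Sum>n. emeasure \<mu> N)"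
    using sets.sets_into_space[of N \<mu>] by (intro suminf_cong arg_cong2[where f=emeasure]) (auto simp: copy_pos_place)
  also have "\<dots> = 0" using N by auto
  finally have "{x\<in>space \<mu>. copy_pos x \<in> N} \<in> null_sets \<mu>"
    by (intro null_setsI) measurable
  then show ?thesis
    by (rule AE_I') (use N(2) in auto)
qed

text \<open>
  Under the identification of the half-line with a product, this is the tensor product of a sequence
  and a function.
\<close>

definition tensor :: "(nat \<Rightarrow> real) \<Rightarrow> (real \<Rightarrow> real) \<Rightarrow> real \<Rightarrow> real" where
  "tensor a f x = a (copy_no x) * f (copy_pos x)"

text \<open>
  If the coefficients \<open>a\<close> are attached to the copies with numbers \<open>r 0, r 1, \<dots>\<close>, then \<open>push r a\<close> is the
  coefficient sequence with respect to all copies.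
\<close>

definition push :: "(nat \<Rightarrow> nat) \<Rightarrow> (nat \<Rightarrow> real) \<Rightarrow> nat \<Rightarrow> real" where
  "push r a m = (if m \<in> range r then a (inv r m) else 0)"

lemma tensor_place: "0 < y \<Longrightarrow> tensor a f (place n y) = a n * f y"
  by (simp add: tensor_def copy_no_place copy_pos_place)

lemma measurable_tensor [measurable]:
  "f \<in> borel_measurable \<mu> \<Longrightarrow> tensor a f \<in> borel_measurable \<mu>"
  unfolding tensor_def
  by (intro borel_measurable_times measurable_compose[OF measurable_copy_no]
      measurable_compose[OF measurable_copy_pos]) auto

lemma suminf_push:
  fixes h :: "nat \<Rightarrow> ennreal"
  assumes r: "strict_mono r" and h: "\<And>n. n \<notin> range r \<Longrightarrow> h n = 0"
  shows "(\<Sum>m. h m) = (\<Sum>n. h (r n))"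
  using suminf_mono_reindex[OF r, of h] h by simp

abbreviation distrib :: "(real \<Rightarrow> real) \<Rightarrow> real \<Rightarrow> ennreal" where
  "distrib f \<tau> \<equiv> emeasure \<mu> {t\<in>space \<mu>. \<bar>f t\<bar> > \<tau>}"

lemma distrib_tensor:
  assumes [measurable]: "f \<in> borel_measurable \<mu>"
  shows "distrib (tensor a f) \<tau> = (\<Sum>n. distrib (\<lambda>y. a n * f y) \<tau>)"
proof -
  have "distrib (tensor a f) \<tau> = (\<Sum>n. emeasure \<mu> {y\<in>space \<mu>. \<tau> < \<bar>tensor a f (place n y)\<bar>})"
    by (rule emeasure_copies) measurable
  also have "\<dots> = (\<Sum>n. distrib (\<lambda>y. a n * f y) \<tau>)"
    by (intro suminf_cong arg_cong2[where f=emeasure]) (auto simp: tensor_place)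
  finally show ?thesis .
qed

lemma nn_integral_tensor:
  assumes [measurable]: "f \<in> borel_measurable \<mu>" "g \<in> borel_measurable \<mu>"
  shows "(\<integral>\<^sup>+x. ennreal \<bar>g x * tensor a f x\<bar> \<partial>\<mu>) = (\<Sum>n. ennreal \<bar>a n\<bar> * (\<integral>\<^sup>+y. ennreal \<bar>g (place n y) * f y\<bar> \<partial>\<mu>))"
proof -
  have "(\<integral>\<^sup>+x. ennreal \<bar>g x * tensor a f x\<bar> \<partial>\<mu>) = (\<Sum>n. \<integral>\<^sup>+y. ennreal \<bar>g (place n y) * tensor a f (place n y)\<bar> \<partial>\<mu>)"
    by (rule nn_integral_copies) measurable
  also have "\<dots> = (\<Sum>n. \<integral>\<^sup>+y. ennreal \<bar>a n\<bar> * ennreal \<bar>g (place n y) * f y\<bar> \<partial>\<mu>)"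
    by (intro suminf_cong nn_integral_cong) (auto simp: tensor_place abs_mult ennreal_mult[symmetric] mult_ac)
  also have "\<dots> = (\<Sum>n. ennreal \<bar>a n\<bar> * (\<integral>\<^sup>+y. ennreal \<bar>g (place n y) * f y\<bar> \<partial>\<mu>))"
    by (intro suminf_cong nn_integral_cmult) measurable
  finally show ?thesis .
qed

lemma distrib_push:
  assumes "f \<in> borel_measurable \<mu>" "strict_mono r" "0 < \<tau>"
  shows "distrib (tensor (push r a) f) \<tau> = distrib (tensor a f) \<tau>"
proof -
  have "(\<Sum>m. distrib (\<lambda>y. push r a m * f y) \<tau>) = (\<Sum>n. distrib (\<lambda>y. push r a (r n) * f y) \<tau>)"
    using assms by (intro suminf_push) (auto simp: push_def)
  also have "\<dots> = (\<Sum>n. distrib (\<lambda>y. a n * f y) \<tau>)"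
    using assms(2) by (simp add: push_def strict_mono_imp_inj_on inv_f_f)
  finally show ?thesis using distrib_tensor assms by simp
qed

section \<open>Uniform domination of disjoint copies\<close>

definition unit :: "nat \<Rightarrow> nat \<Rightarrow> real" where
  "unit n m = (if m = n then 1 else 0)"

lemma tensor_eq_sum_unit:
  assumes "finite {n. a n \<noteq> 0}"
  shows "tensor a f x = (\<Sum>n | a n \<noteq> 0. a n * tensor (unit n) f x)"
proof -
  have "(\<Sum>n | a n \<noteq> 0. a n * tensor (unit n) f x) =
      (\<Sum>n | a n \<noteq> 0. if n = copy_no x then a n * f (copy_pos x) else 0)"
    by (intro sum.cong) (auto simp: tensor_def unit_def)
  also have "\<dots> = tensor a f x" using assms by (simp add: sum.delta' tensor_def)
  finally show ?thesis ..
qed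

lemma tensor_push_eq_sum:
  assumes a: "finite {n. a n \<noteq> 0}" and r: "strict_mono r"
  shows "(\<Sum>n | a n \<noteq> 0. a n * (c * tensor (unit (r n)) f x)) = c * tensor (push r a) f x"
proof -
  have inj: "inj r" using r by (simp add: strict_mono_imp_inj_on)
  have "push r a m = (\<Sum>n | a n \<noteq> 0. a n * unit (r n) m)" for m
  proof (cases "m \<in> range r")
    case True
    then obtain k where k: "m = r k" by auto
    have "(\<Sum>n | a n \<noteq> 0. a n * unit (r n) m) = (\<Sum>n | a n \<noteq> 0. if n = k then a n else 0)"
      using inj by (intro sum.cong) (auto simp: k unit_def dest: injD)
    then show ?thesis using a inj by (simp add: k push_def sum.delta')
  next
    case False
    then have "(\<Sum>n | a n \<noteq> 0. a n * unit (r n) m) = 0"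
      by (intro sum.neutral) (auto simp: unit_def)
    then show ?thesis using False by (simp add: push_def)
  qed
  then show ?thesis
    by (simp add: tensor_def sum_distrib_left sum_distrib_right mult_ac)
qed

lemma finite_support_push:
  "strict_mono r \<Longrightarrow> finite {n. a n \<noteq> 0} \<Longrightarrow> finite {n. push r a n \<noteq> 0}"
  by (rule finite_subset[of _ "r ` {n. a n \<noteq> 0}"])
     (auto simp: push_def strict_mono_imp_inj_on inv_f_f split: if_splits)

lemma distrib_tensor_unit:
  assumes "f \<in> borel_measurable \<mu>" "0 < \<tau>"
  shows "distrib (tensor (unit n) f) \<tau> = distrib f \<tau>"
proof -
  have "(\<Sum>m. distrib (\<lambda>y. unit n m * f y) \<tau>) = (\<Sum>m. if m = n then distrib f \<tau> else 0)"
    using assms by (intro suminf_cong) (auto simp: unit_def)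
  also have "\<dots> = distrib f \<tau>"
    using sums_single[of n "\<lambda>_. distrib f \<tau>"] by (simp add: sums_iff)
  finally show ?thesis using distrib_tensor assms by simp
qed

text \<open>
  Common to a rearrangement invariant space and its Koethe dual.  The condition \<open>dominated\<close> is the
  part of completeness that a gliding hump needs, and \<open>nrm_push\<close> says that passing to a
  subsequence of the copies is isometric.
\<close>

locale function_norm =
  fixes Y :: "real normed_lattice"
  assumes elts_measurable: "f \<in> elts Y \<Longrightarrow> f \<in> borel_measurable \<mu>"
    and scale_closed: "f \<in> elts Y \<Longrightarrow> (\<lambda>t. c * f t) \<in> elts Y"
    and nrm_scale: "f \<in> elts Y \<Longrightarrow> nrm Y (\<lambda>t. c * f t) = \<bar>c\<bar> * nrm Y f"
    and nrm_nonneg: "f \<in> elts Y \<Longrightarrow> 0 \<le> nrm Y f"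
    and nrm_eq_0: "f \<in> elts Y \<Longrightarrow> nrm Y f = 0 \<Longrightarrow> AE t in \<mu>. f t = 0"
    and ideal: "f \<in> borel_measurable \<mu> \<Longrightarrow> g \<in> elts Y \<Longrightarrow> AE t in \<mu>. \<bar>f t\<bar> \<le> \<bar>g t\<bar>
      \<Longrightarrow> f \<in> elts Y \<and> nrm Y f \<le> nrm Y g"
    and dominated: "(\<And>k::nat. u k \<in> elts Y) \<Longrightarrow> (\<And>k. nrm Y (u k) \<le> (1/2)^k)
      \<Longrightarrow> \<exists>h\<in>elts Y. \<forall>k. AE t in \<mu>. \<bar>u k t\<bar> \<le> h t"
    and tensor_closed: "f \<in> elts Y \<Longrightarrow> finite {n. a n \<noteq> 0} \<Longrightarrow> tensor a f \<in> elts Y"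
    and nrm_push: "f \<in> elts Y \<Longrightarrow> strict_mono r \<Longrightarrow> finite {n. a n \<noteq> 0}
      \<Longrightarrow> nrm Y (tensor (push r a) f) = nrm Y (tensor a f)"
begin

lemma nrm_mono:
  "f \<in> borel_measurable \<mu> \<Longrightarrow> g \<in> elts Y \<Longrightarrow> AE t in \<mu>. \<bar>f t\<bar> \<le> \<bar>g t\<bar> \<Longrightarrow> nrm Y f \<le> nrm Y g"
  using ideal by blast

lemma tensor_mono:
  assumes "f \<in> elts Y" "g \<in> elts Y" "AE t in \<mu>. \<bar>f t\<bar> \<le> \<bar>g t\<bar>" "finite {n. a n \<noteq> 0}"
  shows "nrm Y (tensor a f) \<le> nrm Y (tensor a g)"
proof (rule nrm_mono)
  show "AE t in \<mu>. \<bar>tensor a f t\<bar> \<le> \<bar>tensor a g t\<bar>"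
    using AE_copies[OF assms(3)] by eventually_elim (auto simp: tensor_def abs_mult intro: mult_left_mono)
qed (use assms tensor_closed elts_measurable in auto)

lemma tensor_null:
  assumes "f \<in> elts Y" "nrm Y f = 0" "finite {n. a n \<noteq> 0}"
  shows "nrm Y (tensor a f) = 0"
proof -
  have "AE t in \<mu>. \<bar>f t\<bar> \<le> \<bar>0 * f t\<bar>" using nrm_eq_0[OF assms(1,2)] by eventually_elim simp
  then have "nrm Y (tensor a f) \<le> nrm Y (tensor a (\<lambda>t. 0 * f t))"
    using assms scale_closed[OF assms(1), of 0] by (intro tensor_mono) auto
  also have "tensor a (\<lambda>t. 0 * f t) = (\<lambda>t. 0 * tensor a f t)" by (simp add: tensor_def fun_eq_iff)
  also have "nrm Y \<dots> = 0" using nrm_scale[OF tensor_closed[OF assms(1,3)], of 0] by simp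
  finally show ?thesis using nrm_nonneg[OF tensor_closed[OF assms(1,3)]] by linarith
qed

text \<open>
  A gliding hump.  If no constant works for all \<open>f\<close>, there are \<open>f k\<close> of norm \<open>2\<^sup>-\<^sup>k\<close> for which the estimate
  fails by a factor \<open>4\<^sup>k\<close>.  A common majorant \<open>h\<close> of all of them then fails by a factor \<open>2\<^sup>k\<close> for every \<open>k\<close>,
  contrary to the estimate for the single function \<open>h\<close>.
\<close>

lemma uniform_copies:
  assumes e: "e \<in> elts Y"
    and ptw: "\<And>f. f \<in> elts Y \<Longrightarrow> 0 < nrm Y f \<Longrightarrow>
      \<exists>C. \<forall>a. finite {n. a n \<noteq> 0} \<longrightarrow> nrm Y (tensor a f) \<le> C * nrm Y (tensor a e)"
  shows "\<exists>C>0. \<forall>f\<in>elts Y. \<forall>a. finite {n. a n \<noteq> 0} \<longrightarrow>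
      nrm Y (tensor a f) \<le> C * nrm Y (tensor a e) * nrm Y f"
proof (rule ccontr)
  assume "\<not> ?thesis"
  then have neg: "\<exists>f a. f \<in> elts Y \<and> finite {n. a n \<noteq> 0} \<and>
      C * nrm Y (tensor a e) * nrm Y f < nrm Y (tensor a f)" if "0 < C" for C
    using that by (fastforce simp: not_le)
  have "\<forall>k::nat. \<exists>f a. f \<in> elts Y \<and> finite {n. a n \<noteq> 0} \<and>
      4^k * nrm Y (tensor a e) * nrm Y f < nrm Y (tensor a f)"
    by (intro allI neg) simp
  then obtain f a where f: "\<And>k::nat. f k \<in> elts Y" and a: "\<And>k. finite {n. a k n \<noteq> 0}"
    and bad: "\<And>k. 4^k * nrm Y (tensor (a k) e) * nrm Y (f k) < nrm Y (tensor (a k) (f k))"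
    by metis
  have fpos: "0 < nrm Y (f k)" for k
    using bad[of k] tensor_null[OF f _ a, of k k] nrm_nonneg[OF f, of k] by (cases "nrm Y (f k) = 0") auto
  define g where "g k t = ((1/2)^k / nrm Y (f k)) * f k t" for k t
  have g: "g k \<in> elts Y" for k unfolding g_def[abs_def] by (rule scale_closed[OF f])
  have ng: "nrm Y (g k) = (1/2)^k" for k
    using fpos[of k] unfolding g_def[abs_def] by (subst nrm_scale[OF f]) (auto simp: abs_mult)
  obtain h where h: "h \<in> elts Y" "\<And>k. AE t in \<mu>. \<bar>g k t\<bar> \<le> h t"
    using dominated[of g] g ng by auto
  have gh: "AE t in \<mu>. \<bar>g k t\<bar> \<le> \<bar>h t\<bar>" for k using h(2)[of k] by eventually_elim auto
  have "1 \<le> nrm Y h" using nrm_mono[OF elts_measurable[OF g] h(1) gh, of 0] ng[of 0] by simp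
  then obtain C where C: "\<And>a. finite {n. a n \<noteq> 0} \<Longrightarrow> nrm Y (tensor a h) \<le> C * nrm Y (tensor a e)"
    using ptw[OF h(1)] by auto
  obtain k :: nat where k: "C < 2^k" using real_arch_pow[of 2 C] by auto
  have te: "0 \<le> nrm Y (tensor (a k) e)" using nrm_nonneg tensor_closed[OF e a] by auto
  have "2^k * nrm Y (tensor (a k) e) = ((1/2)^k / nrm Y (f k)) * (4^k * nrm Y (tensor (a k) e) * nrm Y (f k))"
  proof -
    have "(4::real)^k = 2^k * 2^k" by (simp flip: power_mult_distrib)
    then show ?thesis using fpos[of k] by (simp add: power_divide field_simps)
  qed
  also have "\<dots> < ((1/2)^k / nrm Y (f k)) * nrm Y (tensor (a k) (f k))"
    using bad[of k] fpos[of k] by (intro mult_strict_left_mono) auto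
  also have "\<dots> = nrm Y (\<lambda>t. ((1/2)^k / nrm Y (f k)) * tensor (a k) (f k) t)"
    using fpos[of k] by (subst nrm_scale[OF tensor_closed[OF f a]]) auto
  also have "(\<lambda>t. ((1/2)^k / nrm Y (f k)) * tensor (a k) (f k) t) = tensor (a k) (g k)"
    by (simp add: tensor_def g_def fun_eq_iff)
  also have "nrm Y (tensor (a k) (g k)) \<le> nrm Y (tensor (a k) h)"
    by (rule tensor_mono[OF g h(1) gh a])
  also have "\<dots> \<le> C * nrm Y (tensor (a k) e)" by (rule C[OF a])
  also have "\<dots> \<le> 2^k * nrm Y (tensor (a k) e)" using k te by (intro mult_right_mono) auto
  finally show False by simp
qed

text \<open>
  It suffices to compare two subsequences of copies, since by \<open>nrm_push\<close> each sequence of copies is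
  isometrically equivalent to its subsequences.
\<close>

lemma copies_dominated:
  fixes r s :: "nat \<Rightarrow> nat"
  assumes f: "f \<in> elts Y" and e: "e \<in> elts Y" and "0 < c" "0 < d"
    and r: "strict_mono r" and s: "strict_mono s"
    and le: "\<And>a. finite {n. a n \<noteq> 0} \<Longrightarrow>
      nrm Y (\<lambda>t. \<Sum>n | a n \<noteq> 0. a n * (c * tensor (unit (r n)) f t)) \<le>
      C * nrm Y (\<lambda>t. \<Sum>n | a n \<noteq> 0. a n * (d * tensor (unit (s n)) e t))"
  shows "\<exists>C. \<forall>a. finite {n. a n \<noteq> 0} \<longrightarrow> nrm Y (tensor a f) \<le> C * nrm Y (tensor a e)"
proof (intro exI allI impI)
  fix a :: "nat \<Rightarrow> real" assume a: "finite {n. a n \<noteq> 0}"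
  have "c * nrm Y (tensor a f) = nrm Y (\<lambda>t. c * tensor (push r a) f t)"
    using nrm_scale[OF tensor_closed[OF f finite_support_push[OF r a]], of c] nrm_push[OF f r a] \<open>0 < c\<close>
    by simp
  also have "\<dots> \<le> C * nrm Y (\<lambda>t. d * tensor (push s a) e t)"
    using le[OF a] by (simp add: tensor_push_eq_sum[OF a r] tensor_push_eq_sum[OF a s])
  also have "nrm Y (\<lambda>t. d * tensor (push s a) e t) = d * nrm Y (tensor a e)"
    using nrm_scale[OF tensor_closed[OF e finite_support_push[OF s a]], of d] nrm_push[OF e s a] \<open>0 < d\<close>
    by simp
  finally show "nrm Y (tensor a f) \<le> (C * d / c) * nrm Y (tensor a e)"
    using \<open>0 < c\<close> by (simp add: field_simps)
qed

end

section \<open>Rearrangement invariant spaces\<close>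

locale rearrangement_invariant =
  fixes X :: "real normed_lattice"
  assumes lattice: "banach_function_lattice X"
    and rearrange: "y \<in> elts X \<Longrightarrow> x \<in> borel_measurable \<mu> \<Longrightarrow> equimeasurable x y
      \<Longrightarrow> x \<in> elts X \<and> nrm X x = nrm X y"
begin

lemma measX: "f \<in> elts X \<Longrightarrow> f \<in> borel_measurable \<mu>"
  using lattice unfolding banach_function_lattice_def by blast

lemma zeroX: "(\<lambda>_. 0) \<in> elts X"
  using lattice unfolding banach_function_lattice_def by blast

lemma addX: "f \<in> elts X \<Longrightarrow> g \<in> elts X \<Longrightarrow> (\<lambda>t. f t + g t) \<in> elts X"
  using lattice unfolding banach_function_lattice_def by blast

lemma scaleX: "f \<in> elts X \<Longrightarrow> (\<lambda>t. c * f t) \<in> elts X"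
  using lattice unfolding banach_function_lattice_def by blast

lemma nonnegX: "f \<in> elts X \<Longrightarrow> 0 \<le> nrm X f"
  using lattice unfolding banach_function_lattice_def by blast

lemma nrmX_0_iff: "f \<in> elts X \<Longrightarrow> nrm X f = 0 \<longleftrightarrow> (AE t in \<mu>. f t = 0)"
  using lattice unfolding banach_function_lattice_def by blast

lemma nrmX_scale: "f \<in> elts X \<Longrightarrow> nrm X (\<lambda>t. c * f t) = \<bar>c\<bar> * nrm X f"
  using lattice unfolding banach_function_lattice_def by blast

lemma triangleX: "f \<in> elts X \<Longrightarrow> g \<in> elts X \<Longrightarrow> nrm X (\<lambda>t. f t + g t) \<le> nrm X f + nrm X g"
  using lattice unfolding banach_function_lattice_def by blast

lemma completeX:
  fixes u :: "nat \<Rightarrow> real \<Rightarrow> real"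
  shows "(\<And>n. u n \<in> elts X) \<Longrightarrow> (\<And>\<epsilon>. 0 < \<epsilon> \<Longrightarrow> \<exists>K. \<forall>i\<ge>K. \<forall>j\<ge>K. nrm X (\<lambda>t. u i t - u j t) < \<epsilon>)
    \<Longrightarrow> \<exists>f\<in>elts X. (\<lambda>n. nrm X (\<lambda>t. u n t - f t)) \<longlonglongrightarrow> 0"
  using lattice unfolding banach_function_lattice_def by blast

lemma idealX: "f \<in> borel_measurable \<mu> \<Longrightarrow> g \<in> elts X \<Longrightarrow> AE t in \<mu>. \<bar>f t\<bar> \<le> \<bar>g t\<bar>
    \<Longrightarrow> f \<in> elts X \<and> nrm X f \<le> nrm X g"
  using lattice unfolding banach_function_lattice_def by blast

lemma nontrivialX: "\<exists>f\<in>elts X. \<not> (AE t in \<mu>. f t = 0)"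
  using lattice unfolding banach_function_lattice_def by blast

lemma diffX: "f \<in> elts X \<Longrightarrow> g \<in> elts X \<Longrightarrow> (\<lambda>t. f t - g t) \<in> elts X"
  using addX[OF _ scaleX[of g "-1"], of f] by simp

lemma sumX:
  assumes "\<And>i. i \<in> I \<Longrightarrow> f i \<in> elts X"
  shows "(\<lambda>t. \<Sum>i\<in>I. f i t) \<in> elts X \<and> nrm X (\<lambda>t. \<Sum>i\<in>I. f i t) \<le> (\<Sum>i\<in>I. nrm X (f i))"
proof (cases "finite I")
  case True
  then show ?thesis using assms
  proof (induction I)
    case empty then show ?case using zeroX nrmX_0_iff[OF zeroX] by simp
  next
    case (insert i I)
    then have "(\<lambda>t. \<Sum>i\<in>I. f i t) \<in> elts X" "nrm X (\<lambda>t. \<Sum>i\<in>I. f i t) \<le> (\<Sum>i\<in>I. nrm X (f i))" by auto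
    then show ?case using insert addX[of "f i" "\<lambda>t. \<Sum>i\<in>I. f i t"] triangleX[of "f i" "\<lambda>t. \<Sum>i\<in>I. f i t"] by simp
  qed
qed (use zeroX nrmX_0_iff[OF zeroX] in simp)

text \<open>
  The limit of an increasing Cauchy sequence is a majorant of it: the positive part of \<open>u m - h\<close> is
  dominated by \<open>\<bar>u n - h\<bar>\<close> for every \<open>n \<ge> m\<close>, so its norm vanishes.
\<close>

lemma monotone_limit:
  fixes u :: "nat \<Rightarrow> real \<Rightarrow> real"
  assumes u: "\<And>n. u n \<in> elts X" and inc: "\<And>m n t. m \<le> n \<Longrightarrow> u m t \<le> u n t"
    and cauchy: "\<And>\<epsilon>. 0 < \<epsilon> \<Longrightarrow> \<exists>K. \<forall>i\<ge>K. \<forall>j\<ge>i. nrm X (\<lambda>t. u j t - u i t) < \<epsilon>"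
    and bound: "\<And>n. nrm X (u n) \<le> B"
  shows "\<exists>h\<in>elts X. (\<forall>n. AE t in \<mu>. u n t \<le> h t) \<and> nrm X h \<le> B"
proof -
  have sym: "nrm X (\<lambda>t. u i t - u j t) = nrm X (\<lambda>t. u j t - u i t)" for i j
    using nrmX_scale[OF diffX[OF u u], of "-1" j i] by simp
  have "\<exists>h\<in>elts X. (\<lambda>n. nrm X (\<lambda>t. u n t - h t)) \<longlonglongrightarrow> 0"
  proof (rule completeX[OF u])
    fix \<epsilon> :: real assume "0 < \<epsilon>"
    then obtain K where "\<forall>i\<ge>K. \<forall>j\<ge>i. nrm X (\<lambda>t. u j t - u i t) < \<epsilon>" using cauchy by blast
    then have "nrm X (\<lambda>t. u i t - u j t) < \<epsilon>" if "K \<le> i" "K \<le> j" for i j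
      using sym[of i j] that by (metis nle_le)
    then show "\<exists>K. \<forall>i\<ge>K. \<forall>j\<ge>K. nrm X (\<lambda>t. u i t - u j t) < \<epsilon>" by blast
  qed
  then obtain h where h: "h \<in> elts X" "(\<lambda>n. nrm X (\<lambda>t. u n t - h t)) \<longlonglongrightarrow> 0" by blast
  have "AE t in \<mu>. u m t \<le> h t" for m
  proof -
    define w where "w t = max 0 (u m t - h t)" for t
    have wm: "w \<in> borel_measurable \<mu>"
      using measX[OF u[of m]] measX[OF h(1)] unfolding w_def[abs_def] by measurable
    have le: "w \<in> elts X \<and> nrm X w \<le> nrm X (\<lambda>t. u n t - h t)" if "m \<le> n" for n
    proof (intro idealX wm diffX[OF u h(1)] AE_I2)
      show "\<bar>w t\<bar> \<le> \<bar>u n t - h t\<bar>" for t using inc[OF that, of t] by (simp add: w_def max_def)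
    qed
    then have "nrm X w \<le> 0"
      by (intro LIMSEQ_le_const[OF h(2)]) auto
    then have "AE t in \<mu>. w t = 0"
      using le[of m] nonnegX[of w] nrmX_0_iff[of w] by auto
    then show ?thesis by eventually_elim (auto simp: w_def max_def split: if_splits)
  qed
  moreover have "nrm X h \<le> B"
  proof -
    have "nrm X h \<le> B + nrm X (\<lambda>t. u n t - h t)" for n
    proof -
      have "nrm X (\<lambda>t. u n t + -1 * (u n t - h t)) \<le> nrm X (u n) + nrm X (\<lambda>t. -1 * (u n t - h t))"
        by (rule triangleX[OF u scaleX[OF diffX[OF u h(1)]]])
      then show ?thesis using nrmX_scale[OF diffX[OF u h(1)], of "-1" n] bound[of n] by simp
    qed
    moreover have "(\<lambda>n. B + nrm X (\<lambda>t. u n t - h t)) \<longlonglongrightarrow> B + 0" by (intro tendsto_intros h(2))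
    ultimately show ?thesis using LIMSEQ_le_const[of "\<lambda>n. B + nrm X (\<lambda>t. u n t - h t)" "B + 0" "nrm X h"] by auto
  qed
  ultimately show ?thesis using h(1) by blast
qed

lemma tensor_unitX:
  assumes "f \<in> elts X"
  shows "tensor (unit n) f \<in> elts X" "nrm X (tensor (unit n) f) = nrm X f"
  using rearrange[OF assms measurable_tensor[OF measX[OF assms]]] distrib_tensor_unit[OF measX[OF assms]]
  by (auto simp: equimeasurable_def)

lemma absX: "f \<in> elts X \<Longrightarrow> (\<lambda>t. \<bar>f t\<bar>) \<in> elts X \<and> nrm X (\<lambda>t. \<bar>f t\<bar>) = nrm X f"
proof -
  assume f: "f \<in> elts X"
  have 1: "(\<lambda>t. \<bar>f t\<bar>) \<in> elts X \<and> nrm X (\<lambda>t. \<bar>f t\<bar>) \<le> nrm X f"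
    using measX[OF f] by (intro idealX f borel_measurable_abs) auto
  then have "nrm X f \<le> nrm X (\<lambda>t. \<bar>f t\<bar>)"
    using measX[OF f] by (intro idealX[THEN conjunct2]) auto
  with 1 show ?thesis by linarith
qed

lemma tensor_closedX:
  assumes "f \<in> elts X" "finite {n. a n \<noteq> 0}"
  shows "tensor a f \<in> elts X"
proof -
  have "tensor a f = (\<lambda>t. \<Sum>n | a n \<noteq> 0. a n * tensor (unit n) f t)"
    using tensor_eq_sum_unit[OF assms(2)] by (simp add: fun_eq_iff)
  then show ?thesis using sumX[of "{n. a n \<noteq> 0}" "\<lambda>n t. a n * tensor (unit n) f t"]
      scaleX[OF tensor_unitX(1)[OF assms(1)]] by simp
qed

text \<open>
  The common majorant is the limit of the partial sums of the moduli.
\<close>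

sublocale X: function_norm X
proof
  fix f :: "nat \<Rightarrow> real \<Rightarrow> real"
  assume f: "\<And>k. f k \<in> elts X" and small: "\<And>k. nrm X (f k) \<le> (1/2)^k"
  define u where "u n t = (\<Sum>k<n. \<bar>f k t\<bar>)" for n t
  have fa: "(\<lambda>t. \<bar>f k t\<bar>) \<in> elts X" "nrm X (\<lambda>t. \<bar>f k t\<bar>) \<le> (1/2)^k" for k
    using absX[OF f] small by auto
  have geo: "(\<Sum>k=i..<j. (1/2)^k) \<le> 2 * (1/2::real)^i" for i j :: nat
  proof (cases "i \<le> j")
    case True
    then have "(\<Sum>k=i..<j. (1/2)^k) = 2 * (1/2::real)^i - 2 * (1/2)^j"
      by (induction j rule: dec_induct) auto
    then show ?thesis by simp
  qed simp
  have diff: "(\<lambda>t. u j t - u i t) = (\<lambda>t. \<Sum>k=i..<j. \<bar>f k t\<bar>)" if "i \<le> j" for i j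
    using that sum_diff_nat_ivl[of 0 i j] by (auto simp: u_def fun_eq_iff atLeast0LessThan)
  have small_diff: "nrm X (\<lambda>t. \<Sum>k=i..<j. \<bar>f k t\<bar>) \<le> 2 * (1/2)^i" for i j
  proof -
    have "nrm X (\<lambda>t. \<Sum>k=i..<j. \<bar>f k t\<bar>) \<le> (\<Sum>k=i..<j. nrm X (\<lambda>t. \<bar>f k t\<bar>))"
      using sumX[of "{i..<j}" "\<lambda>k t. \<bar>f k t\<bar>"] fa(1) by simp
    also have "\<dots> \<le> (\<Sum>k=i..<j. (1/2)^k)" by (rule sum_mono) (rule fa(2))
    finally show ?thesis using geo[of i j] by linarith
  qed
  have "\<exists>h\<in>elts X. (\<forall>n. AE t in \<mu>. u n t \<le> h t) \<and> nrm X h \<le> 2"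
  proof (rule monotone_limit)
    show "u n \<in> elts X" for n using sumX[of "{..<n}" "\<lambda>k t. \<bar>f k t\<bar>"] fa by (simp add: u_def[abs_def])
    show "u m t \<le> u n t" if "m \<le> n" for m n t
      unfolding u_def using that by (intro sum_mono2) auto
    show "nrm X (u n) \<le> 2" for n
      using small_diff[of 0 n] by (simp add: u_def[abs_def] atLeast0LessThan)
    fix \<epsilon> :: real assume "0 < \<epsilon>"
    then obtain K where K: "(1/2)^K < \<epsilon> / 2" using real_arch_pow_inv[of "\<epsilon>/2" "1/2"] by auto
    have "nrm X (\<lambda>t. u j t - u i t) < \<epsilon>" if "K \<le> i" "i \<le> j" for i j
    proof -
      have "(1/2::real)^i \<le> (1/2)^K" using that by (intro power_decreasing) auto
      then show ?thesis unfolding diff[OF that(2)] using small_diff[of i j] K by linarith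
    qed
    then show "\<exists>K. \<forall>i\<ge>K. \<forall>j\<ge>i. nrm X (\<lambda>t. u j t - u i t) < \<epsilon>" by blast
  qed
  then obtain h where h: "h \<in> elts X" "\<And>n. AE t in \<mu>. u n t \<le> h t" by blast
  have "AE t in \<mu>. \<bar>f k t\<bar> \<le> h t" for k
    using h(2)[of "Suc k"]
  proof eventually_elim
    case (elim t)
    moreover have "\<bar>f k t\<bar> \<le> u (Suc k) t" unfolding u_def by (rule member_le_sum) auto
    ultimately show ?case by linarith
  qed
  then show "\<exists>h\<in>elts X. \<forall>k. AE t in \<mu>. \<bar>f k t\<bar> \<le> h t" using h(1) by blast
next
  fix f :: "real \<Rightarrow> real" and r :: "nat \<Rightarrow> nat" and a :: "nat \<Rightarrow> real"
  assume f: "f \<in> elts X" and r: "strict_mono r" and a: "finite {n. a n \<noteq> 0}"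
  show "nrm X (tensor (push r a) f) = nrm X (tensor a f)"
  proof -
    have "equimeasurable (tensor (push r a) f) (tensor a f)"
      unfolding equimeasurable_def by (intro allI impI distrib_push measX f r)
    then show ?thesis
      by (rule conjunct2[OF rearrange[OF tensor_closedX[OF f a] measurable_tensor[OF measX[OF f]]]])
  qed
qed (erule measX, erule scaleX, erule nrmX_scale, erule nonnegX, erule (1) nrmX_0_iff[THEN iffD1],
    erule (2) idealX, erule (1) tensor_closedX)

lemma copies_dominatedX:
  assumes DH: "disjointly_homogeneous X" and f: "f \<in> elts X" "0 < nrm X f" and e: "e \<in> elts X" "0 < nrm X e"
  shows "\<exists>C. \<forall>a. finite {n. a n \<noteq> 0} \<longrightarrow> nrm X (tensor a f) \<le> C * nrm X (tensor a e)"
proof -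
  have nds: "normalized_disjoint_seq X (\<lambda>n t. (1 / nrm X g) * tensor (unit n) g t)"
    if g: "g \<in> elts X" "0 < nrm X g" for g
    unfolding normalized_disjoint_seq_def
  proof (intro conjI allI impI)
    fix i j :: nat
    show el: "(\<lambda>t. (1 / nrm X g) * tensor (unit i) g t) \<in> elts X" for i by (rule scaleX[OF tensor_unitX(1)[OF g(1)]])
    show "nrm X (\<lambda>t. (1 / nrm X g) * tensor (unit i) g t) = 1"
      using g tensor_unitX[OF g(1)] by (subst nrmX_scale) auto
    assume "i \<noteq> j"
    then show "lattice_disjoint X (\<lambda>t. (1 / nrm X g) * tensor (unit i) g t) (\<lambda>t. (1 / nrm X g) * tensor (unit j) g t)"
      by (subst lattice_disjoint_function_lattice[OF lattice el el]) (simp add: tensor_def unit_def)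
  qed
  define x where "x g n t = (1 / nrm X g) * tensor (unit n) g t" for g n t
  have "normalized_disjoint_seq X (x e) \<and> normalized_disjoint_seq X (x f)"
    using nds[OF e] nds[OF f] by (simp add: x_def[abs_def])
  then obtain s r where s: "strict_mono s" and r: "strict_mono r" and eq: "equivalent_seqs X (x e \<circ> s) X (x f \<circ> r)"
    using DH[unfolded disjointly_homogeneous_def, rule_format, of "x e" "x f"] by auto
  obtain C where C: "\<forall>a::nat \<Rightarrow> real. finite {n. a n \<noteq> 0} \<longrightarrow>
      nrm X (\<lambda>t. \<Sum>n | a n \<noteq> 0. a n * (x f \<circ> r) n t) \<le>
      C * nrm X (\<lambda>t. \<Sum>n | a n \<noteq> 0. a n * (x e \<circ> s) n t)"
    using eq unfolding equivalent_seqs_def by auto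
  show ?thesis
  proof (rule X.copies_dominated[OF f(1) e(1) _ _ r s])
    show "0 < 1 / nrm X f" "0 < 1 / nrm X e" using f e by auto
  qed (rule C[rule_format, unfolded comp_def x_def])
qed

end

section \<open>The Koethe dual as a function norm\<close>

text \<open>
  Lebesgue measure has no atoms: the measure of \<open>B \<inter> (0, t]\<close> is a Lipschitz function of \<open>t\<close>, so the
  intermediate value theorem applies.
\<close>

lemma exists_subset_of_measure:
  assumes B: "B \<in> sets \<mu>" and m: "0 \<le> m" "ennreal m \<le> emeasure \<mu> B"
  shows "\<exists>C\<in>sets \<mu>. C \<subseteq> B \<and> emeasure \<mu> C = ennreal m"
proof (cases "emeasure \<mu> B = ennreal m")
  case False
  then have lt: "ennreal m < emeasure \<mu> B" using m by auto
  have BL: "B \<in> sets lebesgue" "B \<subseteq> {0<..}" using B by (auto simp: sets_mu)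
  have BS: "B \<inter> {0<..t} \<in> lmeasurable" for t
  proof (rule fmeasurableI2[of "{0..t}"])
    show "B \<inter> {0<..t} \<in> sets lebesgue" using BL by auto
  qed auto
  define g where "g t = measure lebesgue (B \<inter> {0<..t})" for t
  have "(\<Union>n. B \<inter> {0<..real n}) = B" using BL real_arch_simple by fastforce
  then have "(SUP n. emeasure lebesgue (B \<inter> {0<..real n})) = emeasure lebesgue B"
    using BL by (subst SUP_emeasure_incseq) (auto simp: incseq_def simp del: emeasure_completion)
  then have "ennreal m < (SUP n. emeasure lebesgue (B \<inter> {0<..real n}))" using lt by (simp add: emeasure_mu[OF B])
  then obtain n where "ennreal m < emeasure lebesgue (B \<inter> {0<..real n})" by (auto simp: less_SUP_iff)
  then have n: "m < g (real n)" using m by (simp add: g_def emeasure_eq_measure2[OF BS] ennreal_less_iff)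
  have lip: "\<bar>g t - g s\<bar> \<le> \<bar>t - s\<bar>" for t s
  proof -
    have "g s \<le> g t \<and> g t - g s \<le> t - s" if "s \<le> t" for s t
    proof
      have eq: "B \<inter> {0<..t} - B \<inter> {0<..s} = B \<inter> {0<..t} \<inter> {s<..t}" using that by auto
      show "g s \<le> g t" unfolding g_def using that BS by (intro measure_mono_fmeasurable) auto
      have "g t - g s = measure lebesgue (B \<inter> {0<..t} \<inter> {s<..t})"
        unfolding g_def eq[symmetric] using BS that by (intro measurable_measure_Diff[symmetric]) auto
      also have "\<dots> \<le> measure lebesgue {s..t}" 
        using BS[of t] by (intro measure_mono_fmeasurable) auto
      finally show "g t - g s \<le> t - s" using that by simp
    qed
    from this[of s t] this[of t s] show ?thesis by (cases "s \<le> t") auto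
  qed
  have "continuous_on {0..real n} g"
    unfolding continuous_on_iff dist_real_def using lip by (meson le_less_trans)
  moreover have "g 0 \<le> m" using m by (simp add: g_def)
  ultimately obtain t where "g t = m" using IVT'[of g 0 m "real n"] n by auto
  moreover have s: "B \<inter> {0<..t} \<in> sets \<mu>" using BL by (auto simp: sets_mu)
  moreover have "emeasure \<mu> (B \<inter> {0<..t}) = ennreal (g t)"
    unfolding g_def emeasure_mu[OF s] by (rule emeasure_eq_measure2[OF BS])
  ultimately show ?thesis by (intro bexI[of _ "B \<inter> {0<..t}"]) auto
qed (use B in auto)

definition chi :: "real \<Rightarrow> real \<Rightarrow> real" where
  "chi t = indicator {0<..t}"

lemma measurable_chi [measurable]: "chi t \<in> borel_measurable \<mu>"
  unfolding chi_def by (intro borel_measurable_indicator) (simp add: sets_mu subset_iff)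

lemma sets_Ioc_mu: "{0<..t} \<in> sets \<mu>" by (simp add: sets_mu subset_iff)

lemma emeasure_Ioc_mu: "0 \<le> t \<Longrightarrow> emeasure \<mu> {0<..t} = ennreal t"
  by (subst emeasure_mu[OF sets_Ioc_mu]) simp

lemma distrib_indicator:
  assumes "A \<in> sets \<mu>" "0 < \<tau>"
  shows "distrib (\<lambda>y. c * indicator A y) \<tau> = (if \<tau> < \<bar>c\<bar> then emeasure \<mu> A else 0)"
proof -
  have "A \<subseteq> {0<..}" using assms by (simp add: sets_mu)
  then have "{t\<in>space \<mu>. \<bar>c * indicator A t\<bar> > \<tau>} = (if \<tau> < \<bar>c\<bar> then A else {})"
    using assms by (auto simp: indicator_def split: if_splits)
  then show ?thesis by simp
qed

lemma distrib_indicator1: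
  "A \<in> sets \<mu> \<Longrightarrow> 0 < \<tau> \<Longrightarrow> distrib (indicator A) \<tau> = (if \<tau> < 1 then emeasure \<mu> A else 0)"
  using distrib_indicator[of A \<tau> 1] by simp

text \<open>
  Copy \<open>n\<close> of the result is copy \<open>r n\<close> of \<open>f\<close>.  Test functions for the Koethe norm are transported in this way.
\<close>

definition reindex :: "(nat \<Rightarrow> nat) \<Rightarrow> nat set \<Rightarrow> (real \<Rightarrow> real) \<Rightarrow> real \<Rightarrow> real" where
  "reindex r A f x = (if copy_no x \<in> A then f (place (r (copy_no x)) (copy_pos x)) else 0)"

lemma reindex_place: "0 < y \<Longrightarrow> reindex r A f (place n y) = (if n \<in> A then f (place (r n) y) else 0)"
  by (simp add: reindex_def copy_no_place copy_pos_place)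

lemma measurable_reindex:
  assumes [measurable]: "f \<in> borel_measurable \<mu>"
  shows "reindex r A f \<in> borel_measurable \<mu>"
proof -
  have [measurable]: "Measurable.pred \<mu> (\<lambda>x. copy_no x \<in> A)"
    by (rule measurable_compose[OF measurable_copy_no]) simp
  have [measurable]: "(\<lambda>x. f (place (r (copy_no x)) (copy_pos x))) \<in> borel_measurable \<mu>"
    by (rule measurable_compose_countable[where f="\<lambda>n x. f (place n (copy_pos x))" and g="\<lambda>x. r (copy_no x)"]) measurable
  show ?thesis unfolding reindex_def[abs_def] by measurable
qed

lemma distrib_reindex:
  assumes f: "f \<in> borel_measurable \<mu>" and \<tau>: "0 < \<tau>"
  shows "distrib (reindex r A f) \<tau> = (\<integral>\<^sup>+n. emeasure \<mu> {y\<in>space \<mu>. \<tau> < \<bar>f (place (r n) y)\<bar>} \<partial>count_space A)"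
proof -
  note [measurable] = measurable_reindex[OF f]
  let ?d = "\<lambda>n. emeasure \<mu> {y\<in>space \<mu>. \<tau> < \<bar>f (place (r n) y)\<bar>}"
  have "distrib (reindex r A f) \<tau> = (\<Sum>n. emeasure \<mu> {y\<in>space \<mu>. \<tau> < \<bar>reindex r A f (place n y)\<bar>})"
    by (rule emeasure_copies) measurable
  also have "\<dots> = (\<Sum>n. ?d n * indicator A n)"
  proof (intro suminf_cong)
    fix n
    have "{y\<in>space \<mu>. \<tau> < \<bar>reindex r A f (place n y)\<bar>} = (if n \<in> A then {y\<in>space \<mu>. \<tau> < \<bar>f (place (r n) y)\<bar>} else {})"
      using \<tau> by (auto simp: reindex_place)
    then show "emeasure \<mu> {y\<in>space \<mu>. \<tau> < \<bar>reindex r A f (place n y)\<bar>} = ?d n * indicator A n"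
      by simp
  qed
  also have "\<dots> = (\<integral>\<^sup>+n. ?d n \<partial>count_space A)"
    by (simp only: nn_integral_count_space_nat[symmetric] nn_integral_count_space_indicator[symmetric])
      (simp add: nn_integral_count_space_indicator)
  finally show ?thesis .
qed

context rearrangement_invariant
begin

text \<open>
  For a nonzero \<open>f\<close> in the space, some set \<open>{\<bar>f\<bar> > 1/(k+1)}\<close> has positive measure.  It contains a set of measure
  \<open>t/m\<close> for large \<open>m\<close>, and \<open>m\<close> copies of that set have the same distribution as \<open>(0, t]\<close>.
\<close>

lemma chiX: assumes "0 < t" shows "chi t \<in> elts X"
proof -
  obtain f where f: "f \<in> elts X" "\<not> (AE t in \<mu>. f t = 0)" using nontrivialX by blast
  note [measurable] = measX[OF f(1)]
  define A where "A k = {x\<in>space \<mu>. 1 / real (Suc k) < \<bar>f x\<bar>}" for k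
  have A[measurable]: "A k \<in> sets \<mu>" for k unfolding A_def by measurable
  have "\<exists>k. emeasure \<mu> (A k) \<noteq> 0"
  proof (rule ccontr)
    assume "\<not> ?thesis"
    then have "(\<Union>k. A k) \<in> null_sets \<mu>" by (intro null_sets_UN) auto
    moreover have "{x\<in>space \<mu>. f x \<noteq> 0} \<subseteq> (\<Union>k. A k)"
    proof
      fix x assume x: "x \<in> {x\<in>space \<mu>. f x \<noteq> 0}"
      then obtain k where "1 / real (Suc k) < \<bar>f x\<bar>" using nat_approx_posE[of "\<bar>f x\<bar>"] by auto
      then show "x \<in> (\<Union>k. A k)" using x by (auto simp: A_def)
    qed
    ultimately have "AE t in \<mu>. f t = 0" by (intro AE_I') auto
    then show False using f by blast
  qed
  then obtain k where k: "0 < emeasure \<mu> (A k)" by (auto simp: zero_less_iff_neq_zero)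
  have "\<exists>d>0. ennreal d \<le> emeasure \<mu> (A k)"
    using k by (cases "emeasure \<mu> (A k)") (auto intro: exI[of _ 1])
  then obtain d where d: "0 < d" "ennreal d \<le> emeasure \<mu> (A k)" by blast
  obtain m :: nat where m: "t / d < real m" using reals_Archimedean2 by blast
  then have m0: "0 < real m" using assms d by (meson divide_pos_pos less_trans)
  have "t / m \<le> d" using m m0 d by (simp add: field_simps)
  then obtain C where C: "C \<in> sets \<mu>" "C \<subseteq> A k" "emeasure \<mu> C = ennreal (t / m)"
    using exists_subset_of_measure[OF A[of k], of "t / m", OF _ order_trans[OF ennreal_leI d(2)]] assms by auto
  note [measurable] = C(1)
  have "(indicator C :: real \<Rightarrow> real) \<in> elts X"
  proof (rule idealX[THEN conjunct1, OF _ scaleX[OF f(1), of "real (Suc k)"]])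
    show "AE t in \<mu>. \<bar>indicator C t\<bar> \<le> \<bar>real (Suc k) * f t\<bar>"
      using C(2) by (intro AE_I2) (auto simp: A_def indicator_def abs_mult field_simps)
  qed measurable
  moreover define a where "a n = (if n < m then 1 else 0 :: real)" for n
  ultimately have T: "tensor a (indicator C) \<in> elts X" by (intro tensor_closedX) (auto simp: a_def)
  have "equimeasurable (chi t) (tensor a (indicator C))"
    unfolding equimeasurable_def
  proof (intro allI impI)
    fix \<tau> :: real assume \<tau>: "0 < \<tau>"
    have "distrib (tensor a (indicator C)) \<tau> = (\<Sum>n. distrib (\<lambda>y. a n * indicator C y) \<tau>)"
      by (rule distrib_tensor) measurable
    also have "\<dots> = (\<Sum>n. if n < m \<and> \<tau> < 1 then ennreal (t / m) else 0)"
      using \<tau> by (intro suminf_cong, subst distrib_indicator[OF C(1) \<tau>]) (auto simp: a_def C(3))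
    also have "\<dots> = (\<Sum>n<m. if \<tau> < 1 then ennreal (t / m) else 0)"
      by (subst suminf_finite[of "{..<m}"]) (auto intro!: sum.cong)
    also have "\<dots> = (if \<tau> < 1 then ennreal t else 0)"
      using m0 assms by (simp add: ennreal_of_nat_eq_real_of_nat ennreal_mult[symmetric])
    also have "\<dots> = distrib (chi t) \<tau>"
      unfolding chi_def using assms by (subst distrib_indicator1[OF sets_Ioc_mu \<tau>]) (simp add: emeasure_Ioc_mu)
    finally show "distrib (chi t) \<tau> = distrib (tensor a (indicator C)) \<tau>" ..
  qed
  then show ?thesis using rearrange[OF T measurable_chi] by blast
qed

lemma nrm_chi_pos: "0 < t \<Longrightarrow> 0 < nrm X (chi t)"
proof -
  assume t: "0 < t"
  have "\<not> (AE x in \<mu>. chi t x = 0)"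
  proof
    assume "AE x in \<mu>. chi t x = 0"
    then have "(\<integral>\<^sup>+x. indicator {0<..t} x \<partial>\<mu>) = (\<integral>\<^sup>+x. 0 \<partial>\<mu>)"
      by (intro nn_integral_cong_AE) (auto simp: chi_def indicator_def elim: eventually_mono)
    then show False using t by (subst (asm) nn_integral_indicator[OF sets_Ioc_mu]) (simp add: emeasure_Ioc_mu)
  qed
  then show ?thesis using nonnegX[OF chiX[OF t]] nrmX_0_iff[OF chiX[OF t]] by linarith
qed

lemma hoelder:
  assumes f: "f \<in> elts X" and g: "g \<in> borel_measurable \<mu>"
  shows "(\<integral>\<^sup>+t. ennreal \<bar>g t * f t\<bar> \<partial>\<mu>) \<le> ennreal (nrm X f) * koethe_enorm X g"
proof (cases "nrm X f = 0")
  case True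
  then have "AE t in \<mu>. f t = 0" using nrmX_0_iff[OF f] by simp
  then have "(\<integral>\<^sup>+t. ennreal \<bar>g t * f t\<bar> \<partial>\<mu>) = (\<integral>\<^sup>+t. 0 \<partial>\<mu>)"
    by (intro nn_integral_cong_AE) (auto elim: eventually_mono)
  then show ?thesis by simp
next
  case False
  then have pos: "0 < nrm X f" using nonnegX[OF f] by simp
  note [measurable] = measX[OF f] g
  define h where "h t = (1 / nrm X f) * f t" for t
  have h: "h \<in> elts X" "nrm X h \<le> 1"
    using scaleX[OF f, of "1 / nrm X f"] nrmX_scale[OF f, of "1 / nrm X f"] pos unfolding h_def[abs_def] by auto
  have "(\<integral>\<^sup>+t. ennreal \<bar>g t * f t\<bar> \<partial>\<mu>) = (\<integral>\<^sup>+t. ennreal (nrm X f) * ennreal \<bar>g t * h t\<bar> \<partial>\<mu>)"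
    using pos by (intro nn_integral_cong) (simp add: h_def ennreal_mult[symmetric] abs_mult)
  also have "\<dots> = ennreal (nrm X f) * (\<integral>\<^sup>+t. ennreal \<bar>g t * h t\<bar> \<partial>\<mu>)"
    by (rule nn_integral_cmult) (simp add: h_def)
  also have "\<dots> \<le> ennreal (nrm X f) * koethe_enorm X g"
    unfolding koethe_enorm_def using h by (intro mult_left_mono SUP_upper) auto
  finally show ?thesis .
qed

text \<open>
  Since no copy of \<open>f\<close> is used twice, the result is a rearrangement of the restriction of \<open>f\<close> to the copies
  with numbers in \<open>r ` A\<close>.
\<close>

lemma reindexX:
  assumes f: "f \<in> elts X" and r: "inj_on r A"
  shows "reindex r A f \<in> elts X \<and> nrm X (reindex r A f) \<le> nrm X f"
proof -
  note fm = measX[OF f]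
  let ?F = "reindex id (r ` A) f"
  have F: "?F \<in> elts X \<and> nrm X ?F \<le> nrm X f"
    by (intro idealX f measurable_reindex fm AE_I2) (simp add: reindex_def place_copy)
  have "equimeasurable (reindex r A f) ?F"
    unfolding equimeasurable_def
  proof (intro allI impI)
    fix \<tau> :: real assume \<tau>: "0 < \<tau>"
    have "bij_betw r A (r ` A)" using r by (simp add: bij_betw_def)
    then show "distrib (reindex r A f) \<tau> = distrib ?F \<tau>"
      unfolding distrib_reindex[OF fm \<tau>] id_def by (rule nn_integral_bij_count_space)
  qed
  then have "reindex r A f \<in> elts X \<and> nrm X (reindex r A f) = nrm X ?F"
    using F measurable_reindex[OF fm] by (intro rearrange) auto
  then show ?thesis using F by simp
qed

lemma placeX:
  assumes f: "f \<in> elts X"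
  shows "(\<lambda>y. f (place n y)) \<in> elts X" "nrm X (\<lambda>y. f (place n y)) \<le> nrm X f"
proof -
  note [measurable] = measX[OF f]
  let ?g = "\<lambda>y. f (place n y)"
  have g: "?g \<in> borel_measurable \<mu>" by measurable
  have R: "reindex (\<lambda>_. n) {0} f \<in> elts X \<and> nrm X (reindex (\<lambda>_. n) {0} f) \<le> nrm X f" by (intro reindexX f) simp
  have T: "tensor (unit 0) ?g \<in> elts X \<and> nrm X (tensor (unit 0) ?g) \<le> nrm X (reindex (\<lambda>_. n) {0} f)"
    using R by (intro idealX measurable_tensor g AE_I2) (auto simp: tensor_def unit_def reindex_def)
  have "equimeasurable ?g (tensor (unit 0) ?g)"
    unfolding equimeasurable_def using distrib_tensor_unit[OF g] by simp
  then have "?g \<in> elts X \<and> nrm X ?g = nrm X (tensor (unit 0) ?g)" using T g by (intro rearrange) auto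
  then show "?g \<in> elts X" "nrm X ?g \<le> nrm X f" using T R by auto
qed

lemma nn_integral_tensor_mult:
  assumes "g \<in> borel_measurable \<mu>" "f \<in> elts X"
  shows "(\<integral>\<^sup>+t. ennreal \<bar>tensor a g t * f t\<bar> \<partial>\<mu>) =
    (\<Sum>n. ennreal \<bar>a n\<bar> * (\<integral>\<^sup>+y. ennreal \<bar>f (place n y) * g y\<bar> \<partial>\<mu>))"
  using nn_integral_tensor[OF assms(1) measX[OF assms(2)], of a] by (simp add: mult.commute)

text \<open>
  The two suprema agree because test functions can be transported along \<open>r\<close> in both directions.
\<close>

lemma enorm_tensor_push:
  assumes g: "g \<in> borel_measurable \<mu>" and r: "strict_mono r"
  shows "koethe_enorm X (tensor (push r a) g) = koethe_enorm X (tensor a g)"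
proof -
  have inj: "inj r" using r by (simp add: strict_mono_imp_inj_on)
  have push: "(\<integral>\<^sup>+t. ennreal \<bar>tensor (push r a) g t * f t\<bar> \<partial>\<mu>) = (\<integral>\<^sup>+t. ennreal \<bar>tensor a g t * h t\<bar> \<partial>\<mu>)"
    if f: "f \<in> elts X" and h: "h \<in> elts X" and fh: "\<And>n y. 0 < y \<Longrightarrow> h (place n y) = f (place (r n) y)" for f h
  proof -
    have "(\<integral>\<^sup>+t. ennreal \<bar>tensor (push r a) g t * f t\<bar> \<partial>\<mu>) =
        (\<Sum>n. ennreal \<bar>a n\<bar> * (\<integral>\<^sup>+y. ennreal \<bar>f (place (r n) y) * g y\<bar> \<partial>\<mu>))"
      unfolding nn_integral_tensor_mult[OF g f] using inj by (subst suminf_push[OF r]) (auto simp: push_def inv_f_f)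
    then show ?thesis
      unfolding nn_integral_tensor_mult[OF g h]
      by (auto intro!: suminf_cong arg_cong2[where f="(*)"] nn_integral_cong simp: fh)
  qed
  show ?thesis
  proof (rule antisym)
    show "koethe_enorm X (tensor (push r a) g) \<le> koethe_enorm X (tensor a g)"
      unfolding koethe_enorm_def
    proof (rule SUP_mono)
      fix f assume f: "f \<in> {g \<in> elts X. nrm X g \<le> 1}"
      then show "\<exists>h\<in>{g \<in> elts X. nrm X g \<le> 1}. (\<integral>\<^sup>+t. ennreal \<bar>tensor (push r a) g t * f t\<bar> \<partial>\<mu>) \<le> (\<integral>\<^sup>+t. ennreal \<bar>tensor a g t * h t\<bar> \<partial>\<mu>)"
        using reindexX[of f r UNIV] inj push[of f "reindex r UNIV f"]
        by (intro bexI[of _ "reindex r UNIV f"]) (auto simp: reindex_place)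
    qed
    show "koethe_enorm X (tensor a g) \<le> koethe_enorm X (tensor (push r a) g)"
      unfolding koethe_enorm_def
    proof (rule SUP_mono)
      fix f assume f: "f \<in> {g \<in> elts X. nrm X g \<le> 1}"
      let ?h = "reindex (inv r) (range r) f"
      have "?h \<in> elts X \<and> nrm X ?h \<le> nrm X f" using f by (intro reindexX inj_on_inv_into) auto
      then show "\<exists>h\<in>{g \<in> elts X. nrm X g \<le> 1}. (\<integral>\<^sup>+t. ennreal \<bar>tensor a g t * f t\<bar> \<partial>\<mu>) \<le> (\<integral>\<^sup>+t. ennreal \<bar>tensor (push r a) g t * h t\<bar> \<partial>\<mu>)"
        using f inj push[of ?h f] by (intro bexI[of _ ?h]) (auto simp: reindex_place inv_f_f)
    qed
  qed
qed

lemma enorm_scale: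
  assumes g: "g \<in> borel_measurable \<mu>"
  shows "koethe_enorm X (\<lambda>t. c * g t) = ennreal \<bar>c\<bar> * koethe_enorm X g"
proof -
  have "(\<integral>\<^sup>+t. ennreal \<bar>c * g t * f t\<bar> \<partial>\<mu>) = ennreal \<bar>c\<bar> * (\<integral>\<^sup>+t. ennreal \<bar>g t * f t\<bar> \<partial>\<mu>)" if "f \<in> elts X" for f
    using measX[OF that] g
    by (subst nn_integral_cmult[symmetric]) (auto simp: ennreal_mult[symmetric] abs_mult mult_ac)
  then show ?thesis
    unfolding koethe_enorm_def by (subst SUP_mult_left_ennreal) (auto intro!: SUP_cong)
qed

lemma enorm_mono:
  assumes "AE t in \<mu>. \<bar>f t\<bar> \<le> \<bar>g t\<bar>"
  shows "koethe_enorm X f \<le> koethe_enorm X g"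
  unfolding koethe_enorm_def
proof (intro SUP_mono' nn_integral_mono_AE)
  fix h :: "real \<Rightarrow> real"
  show "AE t in \<mu>. ennreal \<bar>f t * h t\<bar> \<le> ennreal \<bar>g t * h t\<bar>"
    using assms by eventually_elim (auto simp: abs_mult intro!: ennreal_leI mult_right_mono)
qed

lemma AE_locally:
  assumes "\<And>n::nat. AE t in \<mu>. t \<le> real n \<longrightarrow> P t"
  shows "AE t in \<mu>. P t"
proof -
  have "AE t in \<mu>. \<forall>n::nat. t \<le> real n \<longrightarrow> P t" using assms by (subst AE_all_countable) blast
  then show ?thesis by eventually_elim (meson real_arch_simple)
qed

lemma enorm_eq_0:
  assumes g[measurable]: "g \<in> borel_measurable \<mu>" and 0: "koethe_enorm X g = 0"
  shows "AE t in \<mu>. g t = 0"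
proof (rule AE_locally)
  fix n :: nat
  have "(\<integral>\<^sup>+t. ennreal \<bar>g t * chi (real (Suc n)) t\<bar> \<partial>\<mu>) = 0"
    using hoelder[OF chiX g, of "real (Suc n)"] 0 by simp
  then have "AE t in \<mu>. ennreal \<bar>g t * chi (real (Suc n)) t\<bar> = 0"
    by (subst (asm) nn_integral_0_iff_AE) auto
  then show "AE t in \<mu>. t \<le> real n \<longrightarrow> g t = 0"
    using AE_space by eventually_elim (auto simp: chi_def indicator_def split: if_splits)
qed

lemma suminf_half_powers: "(\<Sum>k. ennreal ((1/2)^k)) = 2"
proof -
  have "(\<lambda>k. (1/2::real)^k) sums 2" using geometric_sums[of "1/2::real"] by simp
  then have "(\<Sum>k. ennreal ((1/2)^k)) = ennreal 2" by (intro suminf_ennreal_eq) auto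
  then show ?thesis by (simp only: ennreal_numeral)
qed

text \<open>
  The majorant is the pointwise sum of the moduli; its Koethe norm is controlled by interchanging the
  sum with the integral.  The sum is finite almost everywhere because the indicators of the intervals \<open>(0, n]\<close>
  are test functions.
\<close>

lemma dominated_koethe:
  assumes u: "\<And>k::nat. u k \<in> borel_measurable \<mu>" and small: "\<And>k. koethe_enorm X (u k) \<le> ennreal ((1/2)^k)"
  shows "\<exists>h\<in>borel_measurable \<mu>. koethe_enorm X h \<le> 2 \<and> (\<forall>k. AE t in \<mu>. \<bar>u k t\<bar> \<le> h t)"
proof -
  note [measurable] = u
  define H where "H t = (\<Sum>k. ennreal \<bar>u k t\<bar>)" for t
  have H[measurable]: "H \<in> borel_measurable \<mu>" unfolding H_def by measurable
  have int: "(\<integral>\<^sup>+t. H t * ennreal \<bar>f t\<bar> \<partial>\<mu>) \<le> ennreal (nrm X f) * 2" if f: "f \<in> elts X" for f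
  proof -
    note [measurable] = measX[OF f]
    have "(\<integral>\<^sup>+t. H t * ennreal \<bar>f t\<bar> \<partial>\<mu>) = (\<integral>\<^sup>+t. (\<Sum>k. ennreal \<bar>u k t * f t\<bar>) \<partial>\<mu>)"
      unfolding H_def by (intro nn_integral_cong) (simp add: abs_mult ennreal_mult flip: ennreal_suminf_multc)
    also have "\<dots> = (\<Sum>k. \<integral>\<^sup>+t. ennreal \<bar>u k t * f t\<bar> \<partial>\<mu>)" by (rule nn_integral_suminf) measurable
    also have "\<dots> \<le> (\<Sum>k. ennreal (nrm X f) * ennreal ((1/2)^k))"
      using order_trans[OF hoelder[OF f u] mult_left_mono[OF small]] by (intro suminf_le) auto
    also have "\<dots> = ennreal (nrm X f) * 2" by (simp only: ennreal_suminf_cmult suminf_half_powers)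
    finally show ?thesis .
  qed
  have fin: "AE t in \<mu>. H t \<noteq> \<infinity>"
  proof (rule AE_locally)
    fix n :: nat
    have "AE t in \<mu>. H t * ennreal \<bar>chi (real (Suc n)) t\<bar> \<noteq> \<infinity>"
      using int[OF chiX, of "real (Suc n)"]
      by (intro nn_integral_noteq_infinite) (auto simp: ennreal_mult_eq_top_iff top_unique)
    then show "AE t in \<mu>. t \<le> real n \<longrightarrow> H t \<noteq> \<infinity>"
      using AE_space by eventually_elim (auto simp: chi_def)
  qed
  define h where "h t = enn2real (H t)" for t
  have hm: "h \<in> borel_measurable \<mu>" unfolding h_def by measurable
  have eq: "AE t in \<mu>. ennreal (h t) = H t"
    using fin by eventually_elim (simp add: h_def less_top)
  have "koethe_enorm X h \<le> 2"
    unfolding koethe_enorm_def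
  proof (rule SUP_least)
    fix f assume f: "f \<in> {g \<in> elts X. nrm X g \<le> 1}"
    have "(\<integral>\<^sup>+t. ennreal \<bar>h t * f t\<bar> \<partial>\<mu>) = (\<integral>\<^sup>+t. H t * ennreal \<bar>f t\<bar> \<partial>\<mu>)"
      using eq by (intro nn_integral_cong_AE) (auto elim!: eventually_mono simp: abs_mult ennreal_mult h_def)
    also have "\<dots> \<le> ennreal (nrm X f) * 2" using f int by simp
    also have "\<dots> \<le> 1 * 2" using f by (intro mult_right_mono) (auto simp: ennreal_le_1)
    finally show "(\<integral>\<^sup>+t. ennreal \<bar>h t * f t\<bar> \<partial>\<mu>) \<le> 2" by simp
  qed
  moreover have "AE t in \<mu>. \<bar>u k t\<bar> \<le> h t" for k
    using eq
  proof eventually_elim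
    case (elim t)
    have "ennreal \<bar>u k t\<bar> \<le> H t" 
    proof -
      have "(\<Sum>j\<in>{k}. ennreal \<bar>u j t\<bar>) \<le> H t"
        unfolding H_def by (intro sum_le_suminf summableI) auto
      then show ?thesis by simp
    qed
    then have "ennreal \<bar>u k t\<bar> \<le> ennreal (h t)" by (simp only: elim)
    then show ?case by (subst (asm) ennreal_le_iff) (auto simp: h_def)
  qed
  ultimately show ?thesis using hm by blast
qed

lemma enorm_tensor_unit:
  assumes g[measurable]: "g \<in> borel_measurable \<mu>"
  shows "koethe_enorm X (tensor (unit n) g) = koethe_enorm X g"
proof -
  have swap: "(\<integral>\<^sup>+t. ennreal \<bar>tensor (unit n) g t * f t\<bar> \<partial>\<mu>) = (\<integral>\<^sup>+y. ennreal \<bar>g y * f (place n y)\<bar> \<partial>\<mu>)"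
    if "f \<in> elts X" for f
  proof -
    have "(\<integral>\<^sup>+t. ennreal \<bar>tensor (unit n) g t * f t\<bar> \<partial>\<mu>) = (\<Sum>m. ennreal \<bar>unit n m\<bar> * (\<integral>\<^sup>+y. ennreal \<bar>f (place m y) * g y\<bar> \<partial>\<mu>))"
      by (rule nn_integral_tensor_mult[OF g that])
    also have "\<dots> = (\<Sum>m. if m = n then (\<integral>\<^sup>+y. ennreal \<bar>g y * f (place n y)\<bar> \<partial>\<mu>) else 0)"
      by (intro suminf_cong) (simp add: unit_def mult.commute)
    also have "\<dots> = (\<integral>\<^sup>+y. ennreal \<bar>g y * f (place n y)\<bar> \<partial>\<mu>)"
      using sums_single[of n "\<lambda>_. (\<integral>\<^sup>+y. ennreal \<bar>g y * f (place n y)\<bar> \<partial>\<mu>)"] by (simp add: sums_iff)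
    finally show ?thesis .
  qed
  show ?thesis
  proof (rule antisym)
    show "koethe_enorm X (tensor (unit n) g) \<le> koethe_enorm X g"
      unfolding koethe_enorm_def
    proof (rule SUP_mono)
      fix f assume f: "f \<in> {g \<in> elts X. nrm X g \<le> 1}"
      then show "\<exists>h\<in>{g \<in> elts X. nrm X g \<le> 1}. (\<integral>\<^sup>+t. ennreal \<bar>tensor (unit n) g t * f t\<bar> \<partial>\<mu>) \<le> (\<integral>\<^sup>+t. ennreal \<bar>g t * h t\<bar> \<partial>\<mu>)"
        using placeX[of f n] swap[of f] by (intro bexI[of _ "\<lambda>y. f (place n y)"]) auto
    qed
    show "koethe_enorm X g \<le> koethe_enorm X (tensor (unit n) g)"
      unfolding koethe_enorm_def
    proof (rule SUP_mono)
      fix f assume f: "f \<in> {g \<in> elts X. nrm X g \<le> 1}"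
      then have t: "tensor (unit n) f \<in> elts X" "nrm X (tensor (unit n) f) = nrm X f" using tensor_unitX by auto
      have "(\<integral>\<^sup>+t. ennreal \<bar>g t * f t\<bar> \<partial>\<mu>) = (\<integral>\<^sup>+t. ennreal \<bar>tensor (unit n) g t * tensor (unit n) f t\<bar> \<partial>\<mu>)"
        unfolding swap[OF t(1)] by (intro nn_integral_cong) (simp add: tensor_place unit_def)
      then show "\<exists>h\<in>{g \<in> elts X. nrm X g \<le> 1}. (\<integral>\<^sup>+t. ennreal \<bar>g t * f t\<bar> \<partial>\<mu>) \<le> (\<integral>\<^sup>+t. ennreal \<bar>tensor (unit n) g t * h t\<bar> \<partial>\<mu>)"
        using f t by (intro bexI[of _ "tensor (unit n) f"]) auto
    qed
  qed
qed

lemma enorm_tensor_finite: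
  assumes g[measurable]: "g \<in> borel_measurable \<mu>" and fin: "koethe_enorm X g < \<infinity>" and a: "finite {n. a n \<noteq> 0}"
  shows "koethe_enorm X (tensor a g) < \<infinity>"
proof -
  have "koethe_enorm X (tensor a g) \<le> (\<Sum>n | a n \<noteq> 0. ennreal \<bar>a n\<bar>) * koethe_enorm X g"
    unfolding koethe_enorm_def[of X "tensor a g"]
  proof (rule SUP_least)
    fix f assume f: "f \<in> {g \<in> elts X. nrm X g \<le> 1}"
    have le: "(\<integral>\<^sup>+y. ennreal \<bar>f (place n y) * g y\<bar> \<partial>\<mu>) \<le> koethe_enorm X g" for n
    proof -
      have "(\<integral>\<^sup>+y. ennreal \<bar>g y * f (place n y)\<bar> \<partial>\<mu>) \<le> koethe_enorm X g"
        unfolding koethe_enorm_def using f placeX[of f n] by (intro SUP_upper) auto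
      then show ?thesis by (simp add: mult.commute)
    qed
    have "(\<integral>\<^sup>+t. ennreal \<bar>tensor a g t * f t\<bar> \<partial>\<mu>) = (\<Sum>n. ennreal \<bar>a n\<bar> * (\<integral>\<^sup>+y. ennreal \<bar>f (place n y) * g y\<bar> \<partial>\<mu>))"
      using f by (intro nn_integral_tensor_mult g) simp
    also have "\<dots> = (\<Sum>n | a n \<noteq> 0. ennreal \<bar>a n\<bar> * (\<integral>\<^sup>+y. ennreal \<bar>f (place n y) * g y\<bar> \<partial>\<mu>))"
      using a by (intro suminf_finite) auto
    also have "\<dots> \<le> (\<Sum>n | a n \<noteq> 0. ennreal \<bar>a n\<bar> * koethe_enorm X g)"
      by (intro sum_mono mult_left_mono le) auto
    finally show "(\<integral>\<^sup>+t. ennreal \<bar>tensor a g t * f t\<bar> \<partial>\<mu>) \<le> (\<Sum>n | a n \<noteq> 0. ennreal \<bar>a n\<bar>) * koethe_enorm X g"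
      by (simp only: sum_distrib_right)
  qed
  also have "\<dots> < \<infinity>" using fin a by (auto simp: ennreal_mult_less_top)
  finally show ?thesis .
qed

lemma koethe_iff: "g \<in> elts (koethe_dual X) \<longleftrightarrow> g \<in> borel_measurable \<mu> \<and> koethe_enorm X g < \<infinity>"
  by (simp add: koethe_dual_def)

lemma nrm_koethe: "nrm (koethe_dual X) g = enn2real (koethe_enorm X g)"
  by (simp add: koethe_dual_def)

lemma enorm_eq: "g \<in> elts (koethe_dual X) \<Longrightarrow> koethe_enorm X g = ennreal (nrm (koethe_dual X) g)"
  by (simp add: koethe_iff nrm_koethe)

sublocale K: function_norm "koethe_dual X"
proof
  fix f g :: "real \<Rightarrow> real" and c :: real
  show "f \<in> borel_measurable \<mu>" if "f \<in> elts (koethe_dual X)" using that by (simp add: koethe_iff)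
  show "(\<lambda>t. c * f t) \<in> elts (koethe_dual X)" if "f \<in> elts (koethe_dual X)"
    using that enorm_scale[of f c] by (auto simp: koethe_iff ennreal_mult_less_top)
  show "nrm (koethe_dual X) (\<lambda>t. c * f t) = \<bar>c\<bar> * nrm (koethe_dual X) f" if "f \<in> elts (koethe_dual X)"
    using that enorm_scale[of f c] by (simp add: koethe_iff nrm_koethe enn2real_mult)
  show "0 \<le> nrm (koethe_dual X) f" by (simp add: nrm_koethe)
  show "AE t in \<mu>. f t = 0" if "f \<in> elts (koethe_dual X)" "nrm (koethe_dual X) f = 0"
    using that enorm_eq[of f] enorm_eq_0[of f] by (simp add: koethe_iff)
  show "f \<in> elts (koethe_dual X) \<and> nrm (koethe_dual X) f \<le> nrm (koethe_dual X) g"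
    if "f \<in> borel_measurable \<mu>" "g \<in> elts (koethe_dual X)" "AE t in \<mu>. \<bar>f t\<bar> \<le> \<bar>g t\<bar>"
    using enorm_mono[OF that(3)] that by (auto simp: koethe_iff nrm_koethe intro: enn2real_mono)
  show "tensor a f \<in> elts (koethe_dual X)" if "f \<in> elts (koethe_dual X)" "finite {n. a n \<noteq> 0}" for a
    using that enorm_tensor_finite[of f a] by (auto simp: koethe_iff)
  show "nrm (koethe_dual X) (tensor (push r a) f) = nrm (koethe_dual X) (tensor a f)"
    if "f \<in> elts (koethe_dual X)" "strict_mono r" for a r
    using that enorm_tensor_push[of f r a] by (simp add: koethe_iff nrm_koethe)
next
  fix u :: "nat \<Rightarrow> real \<Rightarrow> real"
  assume u: "\<And>k. u k \<in> elts (koethe_dual X)" and s: "\<And>k. nrm (koethe_dual X) (u k) \<le> (1/2)^k"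
  have "koethe_enorm X (u k) \<le> ennreal ((1/2)^k)" for k
    unfolding enorm_eq[OF u] using s by (rule ennreal_leI)
  then obtain h where h: "h \<in> borel_measurable \<mu>" "koethe_enorm X h \<le> 2" "\<forall>k. AE t in \<mu>. \<bar>u k t\<bar> \<le> h t"
    using dominated_koethe[of u] u by (auto simp: koethe_iff)
  have "koethe_enorm X h < \<infinity>" using h(2) by (rule le_less_trans) simp
  then show "\<exists>h\<in>elts (koethe_dual X). \<forall>k. AE t in \<mu>. \<bar>u k t\<bar> \<le> h t"
    using h by (intro bexI[of _ h]) (auto simp: koethe_iff)
qed

end

section \<open>The Koethe dual inside the Banach dual\<close>

text \<open>
  The value \<open>0\<close> off the space is the convention for elements of \<open>dual_space\<close>.
\<close>

definition pairing :: "real normed_lattice \<Rightarrow> (real \<Rightarrow> real) \<Rightarrow> (real \<Rightarrow> real) \<Rightarrow> real" where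
  "pairing X g f = (if f \<in> elts X then \<integral>t. f t * g t \<partial>\<mu> else 0)"

context rearrangement_invariant
begin

lemma integrable_pair:
  assumes f: "f \<in> elts X" and g: "g \<in> elts (koethe_dual X)"
  shows "integrable \<mu> (\<lambda>t. f t * g t)"
    and "(\<integral>t. \<bar>f t * g t\<bar> \<partial>\<mu>) \<le> nrm X f * nrm (koethe_dual X) g"
proof -
  have gm[measurable]: "g \<in> borel_measurable \<mu>" using g by (simp add: koethe_iff)
  note [measurable] = measX[OF f]
  have le: "(\<integral>\<^sup>+t. ennreal \<bar>f t * g t\<bar> \<partial>\<mu>) \<le> ennreal (nrm X f * nrm (koethe_dual X) g)"
    using hoelder[OF f gm] nonnegX[OF f] K.nrm_nonneg[OF g]
    by (simp add: enorm_eq[OF g] ennreal_mult mult.commute)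
  show int: "integrable \<mu> (\<lambda>t. f t * g t)"
    using le by (intro integrableI_bounded) (auto intro: le_less_trans)
  have "ennreal (\<integral>t. \<bar>f t * g t\<bar> \<partial>\<mu>) \<le> ennreal (nrm X f * nrm (koethe_dual X) g)"
    using le int by (subst nn_integral_eq_integral[symmetric]) auto
  then show "(\<integral>t. \<bar>f t * g t\<bar> \<partial>\<mu>) \<le> nrm X f * nrm (koethe_dual X) g"
    using nonnegX[OF f] K.nrm_nonneg[OF g] by (subst (asm) ennreal_le_iff) auto
qed

lemma pairing_bound:
  assumes f: "f \<in> elts X" and g: "g \<in> elts (koethe_dual X)"
  shows "\<bar>pairing X g f\<bar> \<le> nrm X f * nrm (koethe_dual X) g"
  using order_trans[OF integral_abs_bound integrable_pair(2)[OF f g]] f by (simp add: pairing_def)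

lemma pairing_in_dual:
  assumes g: "g \<in> elts (koethe_dual X)"
  shows "pairing X g \<in> elts (dual_space X)"
proof -
  have "pairing X g (\<lambda>t. f t + h t) = pairing X g f + pairing X g h" if "f \<in> elts X" "h \<in> elts X" for f h
    using that addX[OF that] integrable_pair(1)[OF that(1) g] integrable_pair(1)[OF that(2) g]
    by (simp add: pairing_def distrib_right)
  moreover have "pairing X g (\<lambda>t. c * f t) = c * pairing X g f" if "f \<in> elts X" for f c
    using that scaleX[OF that, of c] by (simp add: pairing_def mult.assoc)
  moreover have "\<exists>C. \<forall>f\<in>elts X. \<bar>pairing X g f\<bar> \<le> C * nrm X f"
    using pairing_bound[OF _ g] by (intro exI[of _ "nrm (koethe_dual X) g"]) (auto simp: mult.commute)
  moreover have "pairing X g f = 0" if "f \<notin> elts X" for f using that by (simp add: pairing_def)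
  ultimately show ?thesis unfolding dual_space_def by simp
qed

text \<open>
  Multiplying a test function by the sign of \<open>g\<close> turns the integral of \<open>\<bar>f g\<bar>\<close>, which defines the
  Koethe norm, into a value of the functional.
\<close>

lemma nrm_pairing:
  assumes g: "g \<in> elts (koethe_dual X)"
  shows "nrm (dual_space X) (pairing X g) = nrm (koethe_dual X) g"
proof -
  define S where "S = {f\<in>elts X. nrm X f \<le> 1}"
  have gm[measurable]: "g \<in> borel_measurable \<mu>" using g by (simp add: koethe_iff)
  have nrm: "nrm (dual_space X) (pairing X g) = (SUP f\<in>S. \<bar>pairing X g f\<bar>)"
    by (simp add: dual_space_def S_def)
  have 0: "(\<lambda>_. 0) \<in> S" using zeroX nrmX_0_iff[OF zeroX] by (simp add: S_def)
  have b: "\<bar>pairing X g f\<bar> \<le> nrm (koethe_dual X) g" if "f \<in> S" for f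
  proof -
    have "\<bar>pairing X g f\<bar> \<le> nrm X f * nrm (koethe_dual X) g" using that by (intro pairing_bound g) (auto simp: S_def)
    also have "\<dots> \<le> 1 * nrm (koethe_dual X) g" using that K.nrm_nonneg[OF g] by (intro mult_right_mono) (auto simp: S_def)
    finally show ?thesis by simp
  qed
  have bdd: "bdd_above ((\<lambda>f. \<bar>pairing X g f\<bar>) ` S)" using b by (auto intro!: bdd_aboveI[of _ "nrm (koethe_dual X) g"])
  show ?thesis unfolding nrm
  proof (rule antisym)
    show "(SUP f\<in>S. \<bar>pairing X g f\<bar>) \<le> nrm (koethe_dual X) g"
      using 0 b by (intro cSUP_least) auto
    have "koethe_enorm X g \<le> ennreal (SUP f\<in>S. \<bar>pairing X g f\<bar>)"
      unfolding koethe_enorm_def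
    proof (rule SUP_least)
      fix f assume f: "f \<in> {g \<in> elts X. nrm X g \<le> 1}"
      then have [measurable]: "f \<in> borel_measurable \<mu>" using measX by auto
      define h where "h t = \<bar>f t\<bar> * sgn (g t)" for t
      have hm: "h \<in> borel_measurable \<mu>" unfolding h_def[abs_def] by measurable
      have hX: "h \<in> elts X \<and> nrm X h \<le> nrm X f"
        using f by (intro idealX hm AE_I2) (auto simp: h_def abs_mult sgn_if)
      then have hS: "h \<in> S" using f by (auto simp: S_def)
      have hg: "h t * g t = \<bar>g t * f t\<bar>" for t by (simp add: h_def abs_mult sgn_if)
      have "(\<integral>\<^sup>+t. ennreal \<bar>g t * f t\<bar> \<partial>\<mu>) = ennreal (pairing X g h)"
        using integrable_pair(1)[of h g] hX g
        by (subst nn_integral_eq_integral) (auto simp: pairing_def hg)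
      also have "\<dots> \<le> ennreal (SUP f\<in>S. \<bar>pairing X g f\<bar>)"
        by (intro ennreal_leI order_trans[OF abs_ge_self cSUP_upper[OF hS bdd]])
      finally show "(\<integral>\<^sup>+t. ennreal \<bar>g t * f t\<bar> \<partial>\<mu>) \<le> ennreal (SUP f\<in>S. \<bar>pairing X g f\<bar>)" .
    qed
    moreover have "0 \<le> (SUP f\<in>S. \<bar>pairing X g f\<bar>)"
      by (rule order_trans[OF abs_ge_zero cSUP_upper[OF 0 bdd]])
    ultimately show "nrm (koethe_dual X) g \<le> (SUP f\<in>S. \<bar>pairing X g f\<bar>)"
      unfolding enorm_eq[OF g] by (subst (asm) ennreal_le_iff) auto
  qed
qed

lemma pairing_sum:
  assumes "finite A" and G: "\<And>n. n \<in> A \<Longrightarrow> G n \<in> elts (koethe_dual X)"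
  shows "(\<lambda>f. \<Sum>n\<in>A. a n * pairing X (G n) f) = pairing X (\<lambda>t. \<Sum>n\<in>A. a n * G n t)"
proof
  fix f
  show "(\<Sum>n\<in>A. a n * pairing X (G n) f) = pairing X (\<lambda>t. \<Sum>n\<in>A. a n * G n t) f"
  proof (cases "f \<in> elts X")
    case True
    have "pairing X (\<lambda>t. \<Sum>n\<in>A. a n * G n t) f = (\<integral>t. (\<Sum>n\<in>A. a n * (f t * G n t)) \<partial>\<mu>)"
      using True by (simp add: pairing_def sum_distrib_left mult_ac)
    also have "\<dots> = (\<Sum>n\<in>A. a n * pairing X (G n) f)"
      using integrable_pair(1)[OF True G] True
      by (subst Bochner_Integration.integral_sum) (auto simp: pairing_def)
    finally show ?thesis ..
  qed (simp add: pairing_def)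
qed

lemma leq_dual:
  "leq (dual_space X) \<phi> \<psi> \<longleftrightarrow> (\<forall>f\<in>elts X. (AE t in \<mu>. 0 \<le> f t) \<longrightarrow> \<phi> f \<le> \<psi> f)"
proof -
  have "leq X = ae_le" using lattice by (simp add: banach_function_lattice_def)
  then show ?thesis by (simp add: dual_space_def ae_le_def)
qed

lemma dual_add:
  "\<phi> \<in> elts (dual_space X) \<Longrightarrow> f \<in> elts X \<Longrightarrow> g \<in> elts X \<Longrightarrow> \<phi> (\<lambda>t. f t + g t) = \<phi> f + \<phi> g"
  by (simp add: dual_space_def)

text \<open>
  Functionals are compared by cutting a nonnegative function into two pieces.
\<close>

lemma split_dual:
  assumes w: "w \<in> elts (dual_space X)" and f: "f \<in> elts X" and P: "{t\<in>space \<mu>. P t} \<in> sets \<mu>"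
  shows "(\<lambda>t. if P t then f t else 0) \<in> elts X" "(\<lambda>t. if P t then 0 else f t) \<in> elts X"
    "w f = w (\<lambda>t. if P t then f t else 0) + w (\<lambda>t. if P t then 0 else f t)"
proof -
  note [measurable] = measX[OF f]
  have [measurable]: "Measurable.pred \<mu> P" using P by (simp add: pred_def)
  have m: "(\<lambda>t. if P t then f t else 0) \<in> borel_measurable \<mu>" "(\<lambda>t. if P t then 0 else f t) \<in> borel_measurable \<mu>"
    by measurable
  show 1: "(\<lambda>t. if P t then f t else 0) \<in> elts X" "(\<lambda>t. if P t then 0 else f t) \<in> elts X"
    by (rule idealX[THEN conjunct1, OF m(1) f], simp, rule idealX[THEN conjunct1, OF m(2) f], simp)
  have "f = (\<lambda>t. (if P t then f t else 0) + (if P t then 0 else f t))" by auto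
  then show "w f = w (\<lambda>t. if P t then f t else 0) + w (\<lambda>t. if P t then 0 else f t)"
    using dual_add[OF w 1] by simp
qed

lemma abs_koethe: "g \<in> elts (koethe_dual X) \<Longrightarrow> (\<lambda>t. \<bar>g t\<bar>) \<in> elts (koethe_dual X)"
proof -
  assume g: "g \<in> elts (koethe_dual X)"
  then have m: "(\<lambda>t. \<bar>g t\<bar>) \<in> borel_measurable \<mu>" by (auto simp: koethe_iff)
  show ?thesis by (rule K.ideal[THEN conjunct1, OF m g]) simp
qed

text \<open>
  For minimality, cut \<open>f \<ge> 0\<close> into its parts over \<open>{g \<ge> 0}\<close> and \<open>{g < 0}\<close>: on the first part the functional of
  \<open>\<bar>g\<bar>\<close> is that of \<open>g\<close>, on the second that of \<open>- g\<close>, and an upper bound \<open>w\<close> dominates both.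
\<close>

lemma modulus_pairing:
  assumes g: "g \<in> elts (koethe_dual X)"
  shows "is_modulus (dual_space X) (pairing X g) (pairing X (\<lambda>t. \<bar>g t\<bar>))"
  unfolding is_modulus_def leq_dual
proof (intro conjI ballI impI)
  let ?a = "\<lambda>t. \<bar>g t\<bar>"
  have gm[measurable]: "g \<in> borel_measurable \<mu>" using g by (simp add: koethe_iff)
  show "pairing X ?a \<in> elts (dual_space X)" by (rule pairing_in_dual[OF abs_koethe[OF g]])
  show "pairing X g f \<le> pairing X ?a f" if f: "f \<in> elts X" "AE t in \<mu>. 0 \<le> f t" for f
  proof -
    have "(\<integral>t. f t * g t \<partial>\<mu>) \<le> (\<integral>t. f t * \<bar>g t\<bar> \<partial>\<mu>)"
    proof (rule integral_mono_AE)
      show "AE t in \<mu>. f t * g t \<le> f t * \<bar>g t\<bar>"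
        using f(2) by eventually_elim (intro mult_left_mono, auto)
    qed (use integrable_pair(1)[OF f(1) g] integrable_pair(1)[OF f(1) abs_koethe[OF g]] in auto)
    then show ?thesis using f(1) by (simp add: pairing_def)
  qed
  show "- pairing X g f \<le> pairing X ?a f" if f: "f \<in> elts X" "AE t in \<mu>. 0 \<le> f t" for f
  proof -
    have "(\<integral>t. - (f t * g t) \<partial>\<mu>) \<le> (\<integral>t. f t * \<bar>g t\<bar> \<partial>\<mu>)"
    proof (rule integral_mono_AE)
      show "AE t in \<mu>. - (f t * g t) \<le> f t * \<bar>g t\<bar>"
        using f(2)
      proof eventually_elim
        case (elim t)
        then show ?case using mult_left_mono[of "- g t" "\<bar>g t\<bar>" "f t"] by simp
      qed
    qed (use integrable_pair(1)[OF f(1) g] integrable_pair(1)[OF f(1) abs_koethe[OF g]] in auto)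
    then show ?thesis using f(1) by (simp add: pairing_def)
  qed
  fix w f
  assume w: "w \<in> elts (dual_space X)"
    and le: "(\<forall>f\<in>elts X. (AE t in \<mu>. 0 \<le> f t) \<longrightarrow> pairing X g f \<le> w f) \<and>
      (\<forall>f\<in>elts X. (AE t in \<mu>. 0 \<le> f t) \<longrightarrow> - pairing X g f \<le> w f)"
    and f: "f \<in> elts X" "AE t in \<mu>. 0 \<le> f t"
  let ?p = "\<lambda>t. if 0 \<le> g t then f t else 0" and ?n = "\<lambda>t. if 0 \<le> g t then 0 else f t"
  have P: "{t\<in>space \<mu>. 0 \<le> g t} \<in> sets \<mu>" by measurable
  have pn: "?p \<in> elts X" "?n \<in> elts X" "AE t in \<mu>. 0 \<le> ?p t" "AE t in \<mu>. 0 \<le> ?n t"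
    using split_dual(1,2)[OF w f(1) P] f(2) by auto
  have "pairing X ?a f = pairing X ?a ?p + pairing X ?a ?n"
    by (rule split_dual(3)[OF pairing_in_dual[OF abs_koethe[OF g]] f(1) P])
  also have "pairing X ?a ?p = pairing X g ?p"
    using pn by (auto simp: pairing_def intro!: Bochner_Integration.integral_cong)
  also have "pairing X ?a ?n = - pairing X g ?n"
    using pn unfolding pairing_def by (auto simp flip: Bochner_Integration.integral_minus intro!: Bochner_Integration.integral_cong)
  also have "pairing X g ?p + - pairing X g ?n \<le> w ?p + w ?n"
    using le pn by (intro add_mono) auto
  also have "\<dots> = w f" by (rule split_dual(3)[OF w f(1) P, symmetric])
  finally show "pairing X ?a f \<le> w f" .
qed

text \<open>
  A functional below both moduli is nonpositive: cut \<open>f \<ge> 0\<close> into its parts over \<open>{g = 0}\<close>, where the first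
  modulus vanishes, and over \<open>{g \<noteq> 0}\<close>, where the second one does.
\<close>

lemma disjoint_pairing:
  assumes g: "g \<in> elts (koethe_dual X)" and h: "h \<in> elts (koethe_dual X)" and disj: "\<And>t. g t * h t = 0"
  shows "lattice_disjoint (dual_space X) (pairing X g) (pairing X h)"
  unfolding lattice_disjoint_def
proof (intro exI conjI ballI impI)
  have gm[measurable]: "g \<in> borel_measurable \<mu>" using g by (simp add: koethe_iff)
  show "is_modulus (dual_space X) (pairing X g) (pairing X (\<lambda>t. \<bar>g t\<bar>))" by (rule modulus_pairing[OF g])
  show "is_modulus (dual_space X) (pairing X h) (pairing X (\<lambda>t. \<bar>h t\<bar>))" by (rule modulus_pairing[OF h])
  show "leq (dual_space X) (\<lambda>_. 0) (pairing X (\<lambda>t. \<bar>g t\<bar>))" "leq (dual_space X) (\<lambda>_. 0) (pairing X (\<lambda>t. \<bar>h t\<bar>))"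
    unfolding leq_dual by (auto simp: pairing_def intro!: integral_nonneg_AE elim: eventually_mono)
  fix w assume w: "w \<in> elts (dual_space X)"
    and le: "leq (dual_space X) w (pairing X (\<lambda>t. \<bar>g t\<bar>)) \<and> leq (dual_space X) w (pairing X (\<lambda>t. \<bar>h t\<bar>))"
  show "leq (dual_space X) w (\<lambda>_. 0)"
    unfolding leq_dual
  proof (intro ballI impI)
    fix f assume f: "f \<in> elts X" "AE t in \<mu>. 0 \<le> f t"
    let ?p = "\<lambda>t. if g t = 0 then f t else 0" and ?n = "\<lambda>t. if g t = 0 then 0 else f t"
    have P: "{t\<in>space \<mu>. g t = 0} \<in> sets \<mu>" by measurable
    have pn: "?p \<in> elts X" "?n \<in> elts X" "AE t in \<mu>. 0 \<le> ?p t" "AE t in \<mu>. 0 \<le> ?n t"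
      using split_dual(1,2)[OF w f(1) P] f(2) by auto
    have "w ?p \<le> pairing X (\<lambda>t. \<bar>g t\<bar>) ?p" "w ?n \<le> pairing X (\<lambda>t. \<bar>h t\<bar>) ?n"
      using le pn unfolding leq_dual by auto
    moreover have "pairing X (\<lambda>t. \<bar>g t\<bar>) ?p = 0"
    proof -
      have "(\<lambda>t. ?p t * \<bar>g t\<bar>) = (\<lambda>_. 0)" by auto
      then show ?thesis by (simp only: pairing_def) simp
    qed
    moreover have "pairing X (\<lambda>t. \<bar>h t\<bar>) ?n = 0"
    proof -
      have "(\<lambda>t. ?n t * \<bar>h t\<bar>) = (\<lambda>_. 0)" using disj by (auto simp: fun_eq_iff)
      then show ?thesis by (simp only: pairing_def) simp
    qed
    ultimately show "w f \<le> 0" using split_dual(3)[OF w f(1) P] by linarith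
  qed
qed

text \<open>
  The functionals given by the copies of \<open>f\<close> and of \<open>e\<close> are disjoint sequences in the Banach dual, and their
  linear combinations have the Koethe norm of the corresponding combinations of copies.
\<close>

lemma copies_dominatedK:
  assumes DH: "disjointly_homogeneous (dual_space X)"
    and f: "f \<in> elts (koethe_dual X)" "0 < nrm (koethe_dual X) f"
    and e: "e \<in> elts (koethe_dual X)" "0 < nrm (koethe_dual X) e"
  shows "\<exists>C. \<forall>a. finite {n. a n \<noteq> 0} \<longrightarrow>
    nrm (koethe_dual X) (tensor a f) \<le> C * nrm (koethe_dual X) (tensor a e)"
proof -
  define x where "x g n t = (1 / nrm (koethe_dual X) g) * tensor (unit n) g t" for g n t
  have u: "tensor (unit n) g \<in> elts (koethe_dual X)" "nrm (koethe_dual X) (tensor (unit n) g) = nrm (koethe_dual X) g"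
    if "g \<in> elts (koethe_dual X)" for g n
    using that enorm_tensor_unit[of g n] by (auto simp: koethe_iff nrm_koethe)
  have x: "x g n \<in> elts (koethe_dual X)" if "g \<in> elts (koethe_dual X)" for g n
    unfolding x_def[abs_def] by (rule K.scale_closed[OF u(1)[OF that]])
  have nds: "normalized_disjoint_seq (dual_space X) (\<lambda>n. pairing X (x g n))"
    if g: "g \<in> elts (koethe_dual X)" "0 < nrm (koethe_dual X) g" for g
    unfolding normalized_disjoint_seq_def
  proof (intro conjI allI impI)
    fix i j :: nat
    show "pairing X (x g i) \<in> elts (dual_space X)" by (rule pairing_in_dual[OF x[OF g(1)]])
    have "nrm (koethe_dual X) (x g i) = 1"
      unfolding x_def[abs_def] using g u(2)[OF g(1), of i] by (subst K.nrm_scale[OF u(1)[OF g(1)]]) auto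
    then show "nrm (dual_space X) (pairing X (x g i)) = 1" by (simp add: nrm_pairing[OF x[OF g(1)]])
    assume "i \<noteq> j"
    then show "lattice_disjoint (dual_space X) (pairing X (x g i)) (pairing X (x g j))"
      by (intro disjoint_pairing x g) (simp add: x_def tensor_def unit_def)
  qed
  then obtain s r where s: "strict_mono s" and r: "strict_mono r"
    and eq: "equivalent_seqs (dual_space X) ((\<lambda>n. pairing X (x e n)) \<circ> s) (dual_space X) ((\<lambda>n. pairing X (x f n)) \<circ> r)"
    using DH[unfolded disjointly_homogeneous_def, rule_format, of "\<lambda>n. pairing X (x e n)" "\<lambda>n. pairing X (x f n)"] e f
    by auto
  obtain C where C: "\<forall>a::nat \<Rightarrow> real. finite {n. a n \<noteq> 0} \<longrightarrow>
      nrm (dual_space X) (\<lambda>h. \<Sum>n | a n \<noteq> 0. a n * ((\<lambda>n. pairing X (x f n)) \<circ> r) n h) \<le>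
      C * nrm (dual_space X) (\<lambda>h. \<Sum>n | a n \<noteq> 0. a n * ((\<lambda>n. pairing X (x e n)) \<circ> s) n h)"
    using eq unfolding equivalent_seqs_def by auto
  have nrm_sum: "nrm (dual_space X) (\<lambda>h. \<Sum>n | a n \<noteq> 0. a n * ((\<lambda>n. pairing X (x g n)) \<circ> q) n h) =
      nrm (koethe_dual X) (\<lambda>t. \<Sum>n | a n \<noteq> 0. a n * ((1 / nrm (koethe_dual X) g) * tensor (unit (q n)) g t))"
    if a: "finite {n. a n \<noteq> 0}" and q: "strict_mono q" and g: "g \<in> elts (koethe_dual X)" for a :: "nat \<Rightarrow> real" and g and q :: "nat \<Rightarrow> nat"
  proof -
    have "(\<lambda>h. \<Sum>n | a n \<noteq> 0. a n * ((\<lambda>n. pairing X (x g n)) \<circ> q) n h) =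
        pairing X (\<lambda>t. \<Sum>n | a n \<noteq> 0. a n * x g (q n) t)"
      unfolding comp_def by (rule pairing_sum[OF a x[OF g]])
    moreover have "(\<lambda>t. \<Sum>n | a n \<noteq> 0. a n * x g (q n) t) \<in> elts (koethe_dual X)"
      unfolding x_def tensor_push_eq_sum[OF a q]
      by (intro K.scale_closed K.tensor_closed g finite_support_push[OF q a])
    ultimately show ?thesis by (simp add: nrm_pairing x_def)
  qed
  show ?thesis
  proof (rule K.copies_dominated[OF f(1) e(1) _ _ r s])
    show "0 < 1 / nrm (koethe_dual X) f" "0 < 1 / nrm (koethe_dual X) e" using f e by auto
    fix a :: "nat \<Rightarrow> real" assume a: "finite {n. a n \<noteq> 0}"
    show "nrm (koethe_dual X) (\<lambda>t. \<Sum>n | a n \<noteq> 0. a n * ((1 / nrm (koethe_dual X) f) * tensor (unit (r n)) f t)) \<le>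
      C * nrm (koethe_dual X) (\<lambda>t. \<Sum>n | a n \<noteq> 0. a n * ((1 / nrm (koethe_dual X) e) * tensor (unit (s n)) e t))"
      using C[rule_format, OF a] unfolding nrm_sum[OF a r f(1)] nrm_sum[OF a s e(1)] .
  qed
qed

lemma uniform_copiesX:
  assumes "disjointly_homogeneous X"
  shows "\<exists>C>0. \<forall>f\<in>elts X. \<forall>a. finite {n. a n \<noteq> 0} \<longrightarrow>
      nrm X (tensor a f) \<le> C * nrm X (tensor a (chi 1)) * nrm X f"
  using copies_dominatedX[OF assms _ _ chiX nrm_chi_pos] chiX by (intro X.uniform_copies) auto

lemma uniform_copiesK:
  assumes "disjointly_homogeneous (dual_space X)" and e: "chi 1 \<in> elts (koethe_dual X)"
  shows "\<exists>C>0. \<forall>f\<in>elts (koethe_dual X). \<forall>a. finite {n. a n \<noteq> 0} \<longrightarrow>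
      nrm (koethe_dual X) (tensor a f) \<le> C * nrm (koethe_dual X) (tensor a (chi 1)) * nrm (koethe_dual X) f"
proof -
  have "nrm (koethe_dual X) (chi 1) \<noteq> 0"
    using K.nrm_eq_0[OF e] nrm_chi_pos[of 1] nrmX_0_iff[OF chiX, of 1] by auto
  then have "0 < nrm (koethe_dual X) (chi 1)" using K.nrm_nonneg[OF e] by simp
  then show ?thesis using copies_dominatedK[OF assms(1) _ _ e] e by (intro K.uniform_copies) auto
qed

end

section \<open>Supporting functionals in finite dimension\<close>

definition sublinear :: "((nat \<Rightarrow> real) \<Rightarrow> real) \<Rightarrow> bool" where
  "sublinear p \<longleftrightarrow> (\<forall>x y. p (\<lambda>i. x i + y i) \<le> p x + p y) \<and> (\<forall>c x. 0 \<le> c \<longrightarrow> p (\<lambda>i. c * x i) = c * p x)"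

lemma sublinear_add: "sublinear p \<Longrightarrow> p (\<lambda>i. x i + y i) \<le> p x + p y"
  by (simp add: sublinear_def)

lemma sublinear_scale: "sublinear p \<Longrightarrow> 0 \<le> c \<Longrightarrow> p (\<lambda>i. c * x i) = c * p x"
  by (simp add: sublinear_def)

text \<open>
  The largest sublinear functional below \<open>p\<close> with this property is the infimum over \<open>s \<ge> 0\<close> of
  \<open>p (v + s e) - s p e\<close>; it is linear along \<open>e\<close>.
\<close>

lemma sublinear_linearize:
  assumes p: "sublinear p"
  shows "\<exists>q. sublinear q \<and> q \<le> p \<and> q (\<lambda>i. - e i) \<le> - p e"
proof -
  define F where "F v s = p (\<lambda>i. v i + s * e i) - s * p e" for v s
  define q where "q v = (INF s\<in>{0..}. F v s)" for v
  have lower: "- p (\<lambda>i. - v i) \<le> F v s" if "0 \<le> s" for v s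
  proof -
    have "s * p e = p (\<lambda>i. s * e i)" using sublinear_scale[OF p that] by simp
    also have "\<dots> = p (\<lambda>i. (v i + s * e i) + - v i)" by simp
    also have "\<dots> \<le> p (\<lambda>i. v i + s * e i) + p (\<lambda>i. - v i)" by (rule sublinear_add[OF p])
    finally show ?thesis by (simp add: F_def)
  qed
  have bdd: "bdd_below (F v ` {0..})" for v using lower by (intro bdd_belowI[of _ "- p (\<lambda>i. - v i)"]) auto
  have q_le: "q v \<le> F v s" if "0 \<le> s" for v s
    unfolding q_def using that bdd by (intro cINF_lower) auto
  have q_ge: "z \<le> q v" if "\<And>s. 0 \<le> s \<Longrightarrow> z \<le> F v s" for z v
    unfolding q_def using that by (intro cINF_greatest) auto
  have "q (\<lambda>i. x i + y i) \<le> q x + q y" for x y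
  proof -
    have "q (\<lambda>i. x i + y i) - F y r \<le> q x" if r: "0 \<le> r" for r
    proof (rule q_ge)
      fix s :: real assume s: "0 \<le> s"
      have "p (\<lambda>i. (x i + y i) + (s + r) * e i) = p (\<lambda>i. (x i + s * e i) + (y i + r * e i))"
        by (simp add: algebra_simps)
      also have "\<dots> \<le> p (\<lambda>i. x i + s * e i) + p (\<lambda>i. y i + r * e i)" by (rule sublinear_add[OF p])
      finally have "F (\<lambda>i. x i + y i) (s + r) \<le> F x s + F y r" by (simp add: F_def algebra_simps)
      then show "q (\<lambda>i. x i + y i) - F y r \<le> F x s" using q_le[of "s + r" "\<lambda>i. x i + y i"] r s by simp
    qed
    then have "q (\<lambda>i. x i + y i) - q x \<le> q y" by (intro q_ge) (simp add: algebra_simps)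
    then show ?thesis by simp
  qed
  moreover have "q (\<lambda>i. c * x i) = c * q x" if c: "0 \<le> c" for c x
  proof (cases "c = 0")
    case True
    have "F (\<lambda>i. 0) s = 0" if "0 \<le> s" for s using sublinear_scale[OF p that, of e] by (simp add: F_def)
    then have "q (\<lambda>i. 0) = 0" unfolding q_def by simp
    then show ?thesis using True by simp
  next
    case False
    have le: "c * q x \<le> q (\<lambda>i. c * x i)" if c: "0 < c" for c x
    proof (rule q_ge)
      fix s :: real assume s: "0 \<le> s"
      have "p (\<lambda>i. c * (x i + (s / c) * e i)) = c * p (\<lambda>i. x i + (s / c) * e i)"
        using c by (intro sublinear_scale[OF p]) simp
      then have "p (\<lambda>i. c * x i + s * e i) = c * p (\<lambda>i. x i + (s / c) * e i)"
        using c by (simp add: distrib_left)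
      then have "F (\<lambda>i. c * x i) s = c * F x (s / c)"
        using c by (simp add: F_def right_diff_distrib)
      then show "c * q x \<le> F (\<lambda>i. c * x i) s" using q_le[of "s / c" x] c s by simp
    qed
    from False c have "0 < c" by simp
    moreover have "q (\<lambda>i. c * x i) \<le> c * q x"
      using le[of "1 / c" "\<lambda>i. c * x i"] \<open>0 < c\<close> by (simp add: field_simps)
    ultimately show ?thesis using le[of c x] by simp
  qed
  ultimately have "sublinear q" unfolding sublinear_def by blast
  moreover have "q v \<le> p v" for v using q_le[of 0 v] by (simp add: F_def)
  moreover have "q (\<lambda>i. - e i) \<le> - p e"
  proof -
    have "p (\<lambda>i. 0 * e i) = 0" using sublinear_scale[OF p, of 0 e] by simp
    then show ?thesis using q_le[of 1 "\<lambda>i. - e i"] by (simp add: F_def)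
  qed
  ultimately show ?thesis by (auto simp: le_fun_def)
qed

text \<open>
  Linearize successively: first along \<open>a\<close>, which fixes the value at \<open>a\<close>, then along the unit vectors.  The
  resulting functional is linear on the first \<open>n\<close> coordinates and lies below \<open>p\<close>.
\<close>

lemma hahn_banach_finite:
  assumes p: "sublinear p" and a: "\<And>i. n \<le> i \<Longrightarrow> a i = 0"
  shows "\<exists>c. p a \<le> (\<Sum>i<n. c i * a i) \<and> (\<forall>d. (\<forall>i\<ge>n. d i = 0) \<longrightarrow> (\<Sum>i<n. c i * d i) \<le> p d)"
proof -
  obtain q0 where q0: "sublinear q0" "q0 \<le> p" "q0 (\<lambda>i. - a i) \<le> - p a"
    using sublinear_linearize[OF p] by blast
  have "\<exists>q. sublinear q \<and> q \<le> q0 \<and> (\<forall>k<m. q (\<lambda>i. - unit k i) \<le> - q (unit k))" for m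
  proof (induction m)
    case 0 then show ?case using q0 by auto
  next
    case (Suc m)
    then obtain q where q: "sublinear q" "q \<le> q0" "\<And>k. k < m \<Longrightarrow> q (\<lambda>i. - unit k i) \<le> - q (unit k)" by blast
    obtain r where r: "sublinear r" "r \<le> q" "r (\<lambda>i. - unit m i) \<le> - q (unit m)"
      using sublinear_linearize[OF q(1)] by blast
    have rq: "r v \<le> q v" for v using r(2) by (simp add: le_fun_def)
    have "r (\<lambda>i. - unit k i) \<le> - r (unit k)" if "k < Suc m" for k
    proof (cases "k = m")
      case True then show ?thesis using r(3) rq[of "unit m"] by simp
    next
      case False
      then have "q (\<lambda>i. - unit k i) \<le> - q (unit k)" using that q(3) by simp
      then show ?thesis using rq[of "unit k"] rq[of "\<lambda>i. - unit k i"] by linarith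
    qed
    then show ?case using r(1,2) q(2) by (intro exI[of _ r]) (auto intro: order_trans)
  qed
  then obtain q where q: "sublinear q" "q \<le> q0" "\<And>k. k < n \<Longrightarrow> q (\<lambda>i. - unit k i) \<le> - q (unit k)" by blast
  have qp: "q v \<le> p v" for v using order_trans[OF le_funD[OF q(2)] le_funD[OF q0(2)]] .
  have q00: "q (\<lambda>_. 0) = 0" using sublinear_scale[OF q(1), of 0 "\<lambda>_. 0"] by simp
  define c where "c k = q (unit k)" for k
  have one: "q (\<lambda>i. r * unit k i) \<le> r * c k" if "k < n" for r k
  proof (cases "0 \<le> r")
    case True then show ?thesis using sublinear_scale[OF q(1) True, of "unit k"] by (simp add: c_def)
  next
    case False
    then have "q (\<lambda>i. (- r) * (- unit k i)) = (- r) * q (\<lambda>i. - unit k i)"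
      by (intro sublinear_scale[OF q(1)]) simp
    also have "\<dots> \<le> (- r) * (- c k)" using q(3)[OF that] False by (intro mult_left_mono) (auto simp: c_def)
    finally show ?thesis by simp
  qed
  have part: "q (\<lambda>i. \<Sum>k<m. d k * unit k i) \<le> (\<Sum>k<m. c k * d k)" if "m \<le> n" for m d
    using that
  proof (induction m)
    case (Suc m)
    have "q (\<lambda>i. (\<Sum>k<m. d k * unit k i) + d m * unit m i) \<le>
      q (\<lambda>i. \<Sum>k<m. d k * unit k i) + q (\<lambda>i. d m * unit m i)" by (rule sublinear_add[OF q(1)])
    then show ?case using Suc one[of m "d m"] by (simp add: mult.commute)
  qed (simp add: q00)
  have expand: "(\<lambda>i. \<Sum>k<n. d k * unit k i) = d" if "\<forall>i\<ge>n. d i = 0" for d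
  proof
    fix i
    have "(\<Sum>k<n. d k * unit k i) = (\<Sum>k<n. if k = i then d k else 0)"
      by (intro sum.cong) (auto simp: unit_def)
    then show "(\<Sum>k<n. d k * unit k i) = d i" using that by (auto simp: not_less)
  qed
  have le: "q d \<le> (\<Sum>k<n. c k * d k)" if "\<forall>i\<ge>n. d i = 0" for d
    using part[of n d] expand[OF that] by simp
  have add0: "0 \<le> q d + q (\<lambda>i. - d i)" for d
    using sublinear_add[OF q(1), of d "\<lambda>i. - d i"] q00 by simp
  have "p a \<le> (\<Sum>k<n. c k * a k)"
  proof -
    have "q (\<lambda>i. - a i) \<le> q0 (\<lambda>i. - a i)" using le_funD[OF q(2)] .
    moreover have "q a \<le> (\<Sum>k<n. c k * a k)" using a by (intro le) simp
    ultimately show ?thesis using add0[of a] q0(3) by linarith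
  qed
  moreover have "(\<Sum>k<n. c k * d k) \<le> p d" if d: "\<forall>i\<ge>n. d i = 0" for d
  proof -
    have "q (\<lambda>i. - d i) \<le> (\<Sum>k<n. c k * - d k)" using d by (intro le) simp
    then show ?thesis using add0[of d] qp[of d] by (simp add: sum_negf)
  qed
  ultimately show ?thesis by blast
qed

section \<open>Step functions with steps of equal measure\<close>

lemma simple_approximation:
  fixes f :: "real \<Rightarrow> real"
  assumes f: "f \<in> borel_measurable \<mu>"
  shows "\<exists>u. (\<forall>n. simple_function \<mu> (u n)) \<and> (\<forall>n t. 0 \<le> u n t \<and> u n t \<le> \<bar>f t\<bar>) \<and>
    (\<forall>m n t. m \<le> n \<longrightarrow> u m t \<le> u n t) \<and> (\<forall>t>0. (\<lambda>n. u n t) \<longlonglongrightarrow> \<bar>f t\<bar>) \<and> (\<forall>n t. real n < t \<longrightarrow> u n t = 0)"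
proof -
  have "(\<lambda>t. \<bar>f t\<bar>) \<in> borel_measurable \<mu>" using f by measurable
  from borel_measurable_implies_simple_function_sequence_real[OF this]
  obtain g where g: "incseq g" "\<And>i. simple_function \<mu> (g i)" "\<And>x. bdd_above (range (\<lambda>i. g i x))"
    "\<And>i x. 0 \<le> g i x" "(\<lambda>t. \<bar>f t\<bar>) = (SUP i. g i)" by auto
  have sup: "\<bar>f t\<bar> = (SUP i. g i t)" for t using fun_cong[OF g(5), of t] by (simp add: image_comp)
  have inc: "incseq (\<lambda>i. g i t)" for t using g(1) by (auto simp: incseq_def le_fun_def)
  define u where "u n t = g n t * indicator {0<..real n} t" for n t
  have le: "g n t \<le> \<bar>f t\<bar>" for n t unfolding sup by (rule cSUP_upper[OF _ g(3)]) simp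
  have lim: "(\<lambda>n. g n t) \<longlonglongrightarrow> \<bar>f t\<bar>" for t unfolding sup by (rule LIMSEQ_incseq_SUP[OF g(3) inc])
  have "simple_function \<mu> (u n)" for n
    unfolding u_def[abs_def] by (intro simple_function_mult g(2) simple_function_indicator sets_Ioc_mu)
  moreover have "0 \<le> u n t \<and> u n t \<le> \<bar>f t\<bar>" for n t
    using g(4) le[of n t] by (auto simp: u_def indicator_def)
  moreover have "u m t \<le> u n t" if "m \<le> n" for m n t
    using that g(4) incseqD[OF inc that] by (auto simp: u_def indicator_def)
  moreover have "(\<lambda>n. u n t) \<longlonglongrightarrow> \<bar>f t\<bar>" if t: "0 < t" for t
  proof (rule Lim_transform_eventually[OF lim])
    obtain N :: nat where "t \<le> real N" using real_arch_simple by blast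
    then show "\<forall>\<^sub>F n in sequentially. g n t = u n t"
      by (intro eventually_sequentiallyI[of N]) (use t in \<open>auto simp: u_def indicator_def\<close>)
  qed
  moreover have "u n t = 0" if "real n < t" for n t using that by (simp add: u_def)
  ultimately show ?thesis by blast
qed

text \<open>
  Monotone convergence, in the form in which it extends estimates from simple functions with bounded
  support to all measurable functions.
\<close>

lemma nn_integral_le_by_simple:
  fixes f :: "real \<Rightarrow> real"
  assumes f: "f \<in> borel_measurable \<mu>"
    and meas: "\<And>u. u \<in> borel_measurable \<mu> \<Longrightarrow> (\<lambda>x. H x (u x)) \<in> borel_measurable \<mu>"
    and mono: "\<And>x s s'. 0 \<le> s \<Longrightarrow> s \<le> s' \<Longrightarrow> H x s \<le> H x s'"
    and cont: "\<And>x u l. \<forall>n. 0 \<le> u n \<Longrightarrow> u \<longlonglongrightarrow> l \<Longrightarrow> (\<lambda>n. H x (u n)) \<longlonglongrightarrow> (H x l :: real)"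
    and bound: "\<And>u n. simple_function \<mu> u \<Longrightarrow> (\<And>x. 0 \<le> u x) \<Longrightarrow> (\<And>x. u x \<le> \<bar>f x\<bar>) \<Longrightarrow>
      (\<And>x. real n < x \<Longrightarrow> u x = 0) \<Longrightarrow> (\<integral>\<^sup>+x. ennreal (H x (u x)) \<partial>\<mu>) \<le> R"
  shows "(\<integral>\<^sup>+x. ennreal (H x \<bar>f x\<bar>) \<partial>\<mu>) \<le> R"
proof -
  from simple_approximation[OF f] obtain u where
    u: "(\<forall>n. simple_function \<mu> (u n)) \<and> (\<forall>n t. 0 \<le> u n t \<and> u n t \<le> \<bar>f t\<bar>) \<and>
    (\<forall>m n t. m \<le> n \<longrightarrow> u m t \<le> u n t) \<and> (\<forall>t>0. (\<lambda>n. u n t) \<longlonglongrightarrow> \<bar>f t\<bar>) \<and> (\<forall>n t. real n < t \<longrightarrow> u n t = 0)"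
    by (elim exE)
  define w where "w n x = ennreal (H x (u n x))" for n x
  have wm: "w n \<in> borel_measurable \<mu>" for n
    unfolding w_def[abs_def] using u
    by (intro measurable_compose[OF meas measurable_ennreal] borel_measurable_simple_function) simp
  have inc: "incseq w" using u mono by (auto simp: incseq_def le_fun_def w_def intro!: ennreal_leI)
  have "(\<integral>\<^sup>+x. ennreal (H x \<bar>f x\<bar>) \<partial>\<mu>) = (\<integral>\<^sup>+x. (SUP n. w n x) \<partial>\<mu>)"
  proof (rule nn_integral_cong)
    fix x assume "x \<in> space \<mu>"
    then have "(\<lambda>n. w n x) \<longlonglongrightarrow> ennreal (H x \<bar>f x\<bar>)"
      unfolding w_def using u by (intro tendsto_ennrealI cont) auto
    moreover have "(\<lambda>n. w n x) \<longlonglongrightarrow> (SUP n. w n x)"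
      using inc by (intro LIMSEQ_SUP) (auto simp: incseq_def le_fun_def)
    ultimately show "ennreal (H x \<bar>f x\<bar>) = (SUP n. w n x)" by (rule LIMSEQ_unique)
  qed
  also have "\<dots> = (SUP n. integral\<^sup>N \<mu> (w n))" by (rule nn_integral_monotone_convergence_SUP[OF inc wm])
  also have "\<dots> \<le> R" unfolding w_def using u by (intro SUP_least bound) auto
  finally show ?thesis .
qed

definition entries :: "real list \<Rightarrow> nat \<Rightarrow> real" where
  "entries xs n = (if n < length xs then xs ! n else 0)"

text \<open>
  A step of measure \<open>t\<close> for every entry of the list, each step on a copy of its own.
\<close>

definition steps :: "real \<Rightarrow> real list \<Rightarrow> real \<Rightarrow> real" where
  "steps t xs = tensor (entries xs) (chi t)"

text \<open>
  The tensor product of two finite sequences, listed in some order.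
\<close>

definition lprod :: "real list \<Rightarrow> real list \<Rightarrow> real list" where
  "lprod xs ys = concat (map (\<lambda>x. map ((*) x) ys) xs)"

lemma finite_support_entries [simp]: "finite {n. entries xs n \<noteq> 0}"
  by (rule finite_subset[of _ "{..<length xs}"]) (auto simp: entries_def split: if_splits)

lemma measurable_steps [measurable]: "steps t xs \<in> borel_measurable \<mu>"
  unfolding steps_def by (intro measurable_tensor measurable_chi)

lemma count_list_eq_card: "count_list xs v = card {n. n < length xs \<and> xs ! n = v}"
  by (simp add: count_list_eq_length_filter length_filter_conv_card eq_commute)

lemma count_list_concat: "count_list (concat xss) v = (\<Sum>xs\<leftarrow>xss. count_list xs v)"
  by (induction xss) auto

lemma emeasure_level_tensor:
  assumes [measurable]: "f \<in> borel_measurable \<mu>"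
  shows "emeasure \<mu> {x\<in>space \<mu>. tensor a f x = v} = (\<Sum>n. emeasure \<mu> {y\<in>space \<mu>. a n * f y = v})"
proof -
  have "emeasure \<mu> {x\<in>space \<mu>. tensor a f x = v} = (\<Sum>n. emeasure \<mu> {y\<in>space \<mu>. tensor a f (place n y) = v})"
    by (rule emeasure_copies) measurable
  also have "\<dots> = (\<Sum>n. emeasure \<mu> {y\<in>space \<mu>. a n * f y = v})"
    by (intro suminf_cong arg_cong2[where f=emeasure]) (auto simp: tensor_place)
  finally show ?thesis .
qed

lemma emeasure_level_steps:
  assumes v: "v \<noteq> 0" and t: "0 \<le> t"
  shows "emeasure \<mu> {x\<in>space \<mu>. steps t xs x = v} = ennreal (real (count_list xs v) * t)"
proof -
  have lev: "emeasure \<mu> {y\<in>space \<mu>. entries xs n * chi t y = v} = (if n < length xs \<and> xs ! n = v then ennreal t else 0)" for n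
  proof -
    have "{y\<in>space \<mu>. entries xs n * chi t y = v} = (if n < length xs \<and> xs ! n = v then {0<..t} else {})"
      using v by (auto simp: entries_def chi_def indicator_def split: if_splits)
    then show ?thesis using t by (simp add: emeasure_Ioc_mu del: emeasure_completion)
  qed
  have "emeasure \<mu> {x\<in>space \<mu>. steps t xs x = v} = (\<Sum>n. if n < length xs \<and> xs ! n = v then ennreal t else 0)"
    unfolding steps_def emeasure_level_tensor[OF measurable_chi] lev ..
  also have "\<dots> = (\<Sum>n<length xs. if n < length xs \<and> xs ! n = v then ennreal t else 0)"
    by (intro suminf_finite) auto
  also have "\<dots> = (\<Sum>n | n < length xs \<and> xs ! n = v. ennreal t)"
    by (intro sum.mono_neutral_cong_right) auto
  also have "\<dots> = ennreal (real (count_list xs v) * t)"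
    using t by (simp add: count_list_eq_card ennreal_of_nat_eq_real_of_nat ennreal_mult)
  finally show ?thesis .
qed

lemma count_list_lprod:
  "count_list (lprod xs ys) v = (\<Sum>n<length xs. count_list (map ((*) (xs ! n)) ys) v)"
  by (simp add: lprod_def count_list_concat comp_def sum_list_sum_nth atLeast0LessThan)

lemma emeasure_level_tensor_steps:
  assumes v: "v \<noteq> 0" and t: "0 \<le> t"
  shows "emeasure \<mu> {x\<in>space \<mu>. tensor (entries xs) (steps t ys) x = v} = ennreal (real (count_list (lprod xs ys) v) * t)"
proof -
  have scale: "c * steps t ys y = steps t (map ((*) c) ys) y" for c y
    by (simp add: steps_def tensor_def entries_def)
  have "emeasure \<mu> {x\<in>space \<mu>. tensor (entries xs) (steps t ys) x = v} =
      (\<Sum>n. ennreal (real (count_list (map ((*) (entries xs n)) ys) v) * t))"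
    unfolding emeasure_level_tensor[OF measurable_steps] scale emeasure_level_steps[OF v t] ..
  also have "\<dots> = (\<Sum>n<length xs. ennreal (real (count_list (map ((*) (entries xs n)) ys) v) * t))"
  proof (intro suminf_finite)
    fix n assume "n \<notin> {..<length xs}"
    then have "v \<notin> set (map ((*) (entries xs n)) ys)" using v by (auto simp: entries_def)
    then show "ennreal (real (count_list (map ((*) (entries xs n)) ys) v) * t) = 0" by (subst count_notin) auto
  qed simp
  also have "\<dots> = (\<Sum>n<length xs. ennreal (real (count_list (map ((*) (xs ! n)) ys) v) * t))"
    by (intro sum.cong) (auto simp: entries_def)
  also have "\<dots> = ennreal (real (count_list (lprod xs ys) v) * t)"
    using t by (simp add: count_list_lprod sum_distrib_right)
  finally show ?thesis .
qed

context rearrangement_invariant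
begin

text \<open>
  Shrinking the level set of \<open>g\<close> at each height \<open>v\<close> to a subset with the measure of the level set of \<open>f\<close> gives
  a function below \<open>\<bar>g\<bar>\<close> that is a rearrangement of \<open>f\<close>.
\<close>

lemma level_domination:
  assumes f: "f \<in> borel_measurable \<mu>" and g: "g \<in> elts X" and V: "finite V" "\<And>v. v \<in> V \<Longrightarrow> 0 < v"
    and fV: "\<And>t. 0 < t \<Longrightarrow> f t = 0 \<or> f t \<in> V"
    and le: "\<And>v. v \<in> V \<Longrightarrow> emeasure \<mu> {x\<in>space \<mu>. f x = v} \<le> emeasure \<mu> {x\<in>space \<mu>. g x = v}"
  shows "f \<in> elts X \<and> nrm X f \<le> nrm X g"
proof -
  note [measurable] = f measX[OF g]
  have "\<exists>C\<in>sets \<mu>. C \<subseteq> {x\<in>space \<mu>. g x = v} \<and> emeasure \<mu> C = emeasure \<mu> {x\<in>space \<mu>. f x = v}" if "v \<in> V" for v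
  proof (cases "emeasure \<mu> {x\<in>space \<mu>. f x = v} = \<infinity>")
    case True
    then have "emeasure \<mu> {x\<in>space \<mu>. g x = v} = \<infinity>" using le[OF that] by (simp add: top_unique)
    moreover have "{x\<in>space \<mu>. g x = v} \<in> sets \<mu>" by measurable
    ultimately show ?thesis using True by (intro bexI[of _ "{x\<in>space \<mu>. g x = v}"]) auto
  next
    case False
    then obtain m where m: "0 \<le> m" "emeasure \<mu> {x\<in>space \<mu>. f x = v} = ennreal m"
      by (cases "emeasure \<mu> {x\<in>space \<mu>. f x = v}") auto
    have "{x\<in>space \<mu>. g x = v} \<in> sets \<mu>" by measurable
    then show ?thesis using exists_subset_of_measure[of "{x\<in>space \<mu>. g x = v}" m] le[OF that] m by simp
  qed
  then have "\<forall>v\<in>V. \<exists>C. C \<in> sets \<mu> \<and> C \<subseteq> {x\<in>space \<mu>. g x = v} \<and> emeasure \<mu> C = emeasure \<mu> {x\<in>space \<mu>. f x = v}"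
    by blast
  from bchoice[OF this] obtain C where "\<forall>v\<in>V. C v \<in> sets \<mu> \<and> C v \<subseteq> {x\<in>space \<mu>. g x = v} \<and>
      emeasure \<mu> (C v) = emeasure \<mu> {x\<in>space \<mu>. f x = v}" by blast
  then have C: "\<And>v. v \<in> V \<Longrightarrow> C v \<in> sets \<mu>" "\<And>v. v \<in> V \<Longrightarrow> C v \<subseteq> {x\<in>space \<mu>. g x = v}"
    "\<And>v. v \<in> V \<Longrightarrow> emeasure \<mu> (C v) = emeasure \<mu> {x\<in>space \<mu>. f x = v}" by blast+
  define D where "D = (\<Union>v\<in>V. C v)"
  have D[measurable]: "D \<in> sets \<mu>" unfolding D_def using V C by auto
  define h where "h x = (if x \<in> D then g x else 0)" for x
  have hm: "h \<in> borel_measurable \<mu>" unfolding h_def[abs_def] by measurable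
  have h: "h \<in> elts X \<and> nrm X h \<le> nrm X g"
    by (intro idealX hm g AE_I2) (simp add: h_def)
  have "equimeasurable f h" unfolding equimeasurable_def
  proof (intro allI impI)
    fix \<tau> :: real assume \<tau>: "0 < \<tau>"
    let ?W = "{v\<in>V. \<tau> < v}"
    have "{x\<in>space \<mu>. \<tau> < \<bar>h x\<bar>} = (\<Union>v\<in>?W. C v)"
    proof
      show "{x\<in>space \<mu>. \<tau> < \<bar>h x\<bar>} \<subseteq> (\<Union>v\<in>?W. C v)"
      proof
        fix x assume x: "x \<in> {x\<in>space \<mu>. \<tau> < \<bar>h x\<bar>}"
        then have "x \<in> D" using \<tau> by (auto simp: h_def split: if_splits)
        then obtain v where v: "v \<in> V" "x \<in> C v" by (auto simp: D_def)
        then have "g x = v" using C(2) by auto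
        then have "\<tau> < v" using x \<open>x \<in> D\<close> V(2)[OF v(1)] by (auto simp: h_def)
        then show "x \<in> (\<Union>v\<in>?W. C v)" using v by auto
      qed
      show "(\<Union>v\<in>?W. C v) \<subseteq> {x\<in>space \<mu>. \<tau> < \<bar>h x\<bar>}"
      proof
        fix x assume "x \<in> (\<Union>v\<in>?W. C v)"
        then obtain v where v: "v \<in> V" "\<tau> < v" "x \<in> C v" by auto
        then have "x \<in> D" "g x = v" "x \<in> space \<mu>" using C(2)[OF v(1)] by (auto simp: D_def)
        then show "x \<in> {x\<in>space \<mu>. \<tau> < \<bar>h x\<bar>}" using v by (auto simp: h_def)
      qed
    qed
    then have "distrib h \<tau> = emeasure \<mu> (\<Union>v\<in>?W. C v)" by (simp only:)
    also have "\<dots> = (\<Sum>v\<in>?W. emeasure \<mu> (C v))"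
    proof (rule sum_emeasure[symmetric])
      show "disjoint_family_on C ?W"
        unfolding disjoint_family_on_def
      proof (intro ballI impI)
        fix m n assume "m \<in> ?W" "n \<in> ?W" "m \<noteq> n"
        then show "C m \<inter> C n = {}" using C(2)[of m] C(2)[of n] by auto
      qed
    qed (use V C in auto)
    also have "\<dots> = (\<Sum>v\<in>?W. emeasure \<mu> {x\<in>space \<mu>. f x = v})" using C(3) by (intro sum.cong) auto
    also have "\<dots> = emeasure \<mu> (\<Union>v\<in>?W. {x\<in>space \<mu>. f x = v})"
    proof (rule sum_emeasure)
      have "{x\<in>space \<mu>. f x = v} \<in> sets \<mu>" for v by measurable
      then show "(\<lambda>v. {x\<in>space \<mu>. f x = v}) ` ?W \<subseteq> sets \<mu>" by blast
    qed (use V in \<open>auto simp: disjoint_family_on_def\<close>)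
    also have "(\<Union>v\<in>?W. {x\<in>space \<mu>. f x = v}) = {x\<in>space \<mu>. \<tau> < \<bar>f x\<bar>}"
    proof -
      have "\<bar>f x\<bar> = f x \<and> (\<tau> < f x \<longrightarrow> f x \<in> V)" if "0 < x" for x
        using fV[OF that] V(2)[of "f x"] \<tau> by auto
      then show ?thesis by auto
    qed
    finally show "distrib f \<tau> = distrib h \<tau>" ..
  qed
  then have "f \<in> elts X \<and> nrm X f = nrm X h" using h f by (intro rearrange) auto
  then show ?thesis using h by simp
qed

lemma stepsX: "0 < t \<Longrightarrow> steps t xs \<in> elts X"
  unfolding steps_def by (intro tensor_closedX chiX) auto

lemma steps_values: "steps t xs x = 0 \<or> steps t xs x \<in> set xs"
  by (auto simp: steps_def tensor_def entries_def chi_def indicator_def)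

lemma steps_dominated:
  assumes xs: "\<And>x. x \<in> set xs \<Longrightarrow> 0 \<le> x" and s: "0 < s" and g: "g \<in> elts X"
    and le: "\<And>v. v \<in> set xs \<Longrightarrow> 0 < v \<Longrightarrow> ennreal (real (count_list xs v) * s) \<le> emeasure \<mu> {x\<in>space \<mu>. g x = v}"
  shows "nrm X (steps s xs) \<le> nrm X g"
proof -
  have "steps s xs \<in> elts X \<and> nrm X (steps s xs) \<le> nrm X g"
  proof (rule level_domination[OF measurable_steps g])
    show "finite {v\<in>set xs. 0 < v}" by simp
    show "steps s xs t = 0 \<or> steps s xs t \<in> {v\<in>set xs. 0 < v}" for t
      using steps_values[of s xs t] xs by force
    show "emeasure \<mu> {x\<in>space \<mu>. steps s xs x = v} \<le> emeasure \<mu> {x\<in>space \<mu>. g x = v}"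
      if "v \<in> {v\<in>set xs. 0 < v}" for v
      using that le s by (subst emeasure_level_steps) auto
  qed auto
  then show ?thesis ..
qed

lemma steps_mono:
  assumes xs: "\<And>x. x \<in> set xs \<Longrightarrow> 0 \<le> x" and "0 < s" "0 < t"
    and le: "\<And>v. 0 < v \<Longrightarrow> real (count_list xs v) * s \<le> real (count_list ys v) * t"
  shows "nrm X (steps s xs) \<le> nrm X (steps t ys)"
proof (rule steps_dominated[OF xs \<open>0 < s\<close> stepsX[OF \<open>0 < t\<close>]])
  fix v assume v: "v \<in> set xs" "0 < (v::real)"
  then show "ennreal (real (count_list xs v) * s) \<le> emeasure \<mu> {x\<in>space \<mu>. steps t ys x = v}"
    using \<open>0 < t\<close> le[OF v(2)] by (subst emeasure_level_steps) (auto intro!: ennreal_leI)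
qed

text \<open>
  Both functions have level sets of the same measure.
\<close>

lemma nrm_tensor_steps:
  assumes xs: "\<And>x. x \<in> set xs \<Longrightarrow> 0 \<le> x" and ys: "\<And>y. y \<in> set ys \<Longrightarrow> 0 \<le> y" and t: "0 < t"
  shows "nrm X (tensor (entries xs) (steps t ys)) = nrm X (steps t (lprod xs ys))"
proof (rule antisym)
  have pos: "0 \<le> z" if "z \<in> set (lprod xs ys)" for z using that xs ys by (auto simp: lprod_def)
  have T: "tensor (entries xs) (steps t ys) \<in> elts X" by (intro tensor_closedX stepsX t) simp
  show "nrm X (steps t (lprod xs ys)) \<le> nrm X (tensor (entries xs) (steps t ys))"
  proof (rule steps_dominated[OF pos t T])
    fix v assume v: "v \<in> set (lprod xs ys)" "0 < v"
    then show "ennreal (real (count_list (lprod xs ys) v) * t) \<le> emeasure \<mu> {x\<in>space \<mu>. tensor (entries xs) (steps t ys) x = v}"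
      using t by (subst emeasure_level_tensor_steps) auto
  qed
  have "tensor (entries xs) (steps t ys) \<in> elts X \<and> nrm X (tensor (entries xs) (steps t ys)) \<le> nrm X (steps t (lprod xs ys))"
  proof (rule level_domination[OF measurable_tensor[OF measurable_steps] stepsX[OF t]])
    show "finite {v\<in>set (lprod xs ys). 0 < v}" by simp
    show "tensor (entries xs) (steps t ys) x = 0 \<or> tensor (entries xs) (steps t ys) x \<in> {v\<in>set (lprod xs ys). 0 < v}" for x
    proof -
      have "tensor (entries xs) (steps t ys) x = 0 \<or> tensor (entries xs) (steps t ys) x \<in> set (lprod xs ys)"
        using steps_values[of t ys "copy_pos x"] by (auto simp: tensor_def entries_def lprod_def)
      then show ?thesis using pos by force
    qed
    show "emeasure \<mu> {x\<in>space \<mu>. tensor (entries xs) (steps t ys) x = v} \<le> emeasure \<mu> {x\<in>space \<mu>. steps t (lprod xs ys) x = v}"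
      if "v \<in> {v\<in>set (lprod xs ys). 0 < v}" for v
      using that t by (subst emeasure_level_tensor_steps, simp, simp, subst emeasure_level_steps) auto
  qed auto
  then show "nrm X (tensor (entries xs) (steps t ys)) \<le> nrm X (steps t (lprod xs ys))" ..
qed

end

section \<open>Norming step functions by step functions\<close>

lemma map_rotate_upt:
  assumes "0 < K"
  shows "map (\<lambda>s. h ((q + s) mod K)) [0..<K] = rotate q (map h [0..<K])"
  using assms by (intro nth_equalityI) (auto simp: nth_rotate)

lemma count_list_rotate: "count_list (rotate q xs) v = count_list xs v"
proof -
  let ?k = "q mod length xs"
  have "count_list (take ?k xs @ drop ?k xs) v = count_list (take ?k xs) v + count_list (drop ?k xs) v"
    by (rule count_list_append)
  then show ?thesis by (simp add: rotate_drop_take)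
qed

lemma sum_rotate:
  fixes h :: "nat \<Rightarrow> real"
  assumes "0 < K"
  shows "(\<Sum>s<K. h ((q + s) mod K)) = (\<Sum>s<K. h s)"
proof -
  have sl: "sum_list (rotate q xs) = sum_list xs" for xs :: "real list"
  proof -
    let ?k = "q mod length xs"
    have "sum_list (take ?k xs @ drop ?k xs) = sum_list (take ?k xs) + sum_list (drop ?k xs)"
      by (rule sum_list_append)
    then show ?thesis by (simp add: rotate_drop_take)
  qed
  have "(\<Sum>s<K. h ((q + s) mod K)) = sum_list (map (\<lambda>s. h ((q + s) mod K)) [0..<K])"
    by (simp add: interv_sum_list_conv_sum_set_nat atLeast0LessThan)
  also have "\<dots> = (\<Sum>s<K. h s)"
    unfolding map_rotate_upt[OF assms] sl by (simp add: interv_sum_list_conv_sum_set_nat atLeast0LessThan)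
  finally show ?thesis .
qed

lemma map_div_mod_upt:
  assumes "0 < K"
  shows "map (\<lambda>j. g (j div K) (j mod K)) [0..<n * K] = concat (map (\<lambda>i. map (g i) [0..<K]) [0..<n])"
proof (induction n)
  case (Suc n)
  have "[0..<Suc n * K] = [0..<n * K] @ map (\<lambda>q. q + n * K) [0..<K]"
    using upt_add_eq_append[of 0 "n * K" K] by (simp add: add.commute map_add_upt)
  moreover have "map (\<lambda>j. g (j div K) (j mod K)) (map (\<lambda>q. q + n * K) [0..<K]) = map (g n) [0..<K]"
    using assms by (auto simp: comp_def)
  ultimately show ?case using Suc by simp
qed simp

lemma count_list_map_const: "count_list (map (\<lambda>_. c) [0..<K]) v = (if c = v then K else 0)"
  by (induction K) auto

lemma count_list_blocks:
  "count_list (concat (map (\<lambda>i. map (\<lambda>_. e i) [0..<K]) xs)) v = K * count_list (map e xs) v"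
  by (induction xs) (auto simp: count_list_map_const)

lemma nn_integral_tensor_tensor:
  assumes [measurable]: "f \<in> borel_measurable \<mu>" "g \<in> borel_measurable \<mu>"
  shows "(\<integral>\<^sup>+x. ennreal \<bar>tensor b g x * tensor a f x\<bar> \<partial>\<mu>) = (\<Sum>n. ennreal \<bar>b n * a n\<bar>) * (\<integral>\<^sup>+y. ennreal \<bar>g y * f y\<bar> \<partial>\<mu>)"
proof -
  have "(\<integral>\<^sup>+x. ennreal \<bar>tensor b g x * tensor a f x\<bar> \<partial>\<mu>) =
      (\<Sum>n. ennreal \<bar>a n\<bar> * (\<integral>\<^sup>+y. ennreal \<bar>tensor b g (place n y) * f y\<bar> \<partial>\<mu>))"
    by (rule nn_integral_tensor) measurable
  also have "\<dots> = (\<Sum>n. ennreal \<bar>b n * a n\<bar> * (\<integral>\<^sup>+y. ennreal \<bar>g y * f y\<bar> \<partial>\<mu>))"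
  proof (intro suminf_cong)
    fix n
    have "(\<integral>\<^sup>+y. ennreal \<bar>tensor b g (place n y) * f y\<bar> \<partial>\<mu>) = (\<integral>\<^sup>+y. ennreal \<bar>b n\<bar> * ennreal \<bar>g y * f y\<bar> \<partial>\<mu>)"
      by (intro nn_integral_cong) (simp add: tensor_place abs_mult ennreal_mult mult.assoc)
    also have "\<dots> = ennreal \<bar>b n\<bar> * (\<integral>\<^sup>+y. ennreal \<bar>g y * f y\<bar> \<partial>\<mu>)" by (rule nn_integral_cmult) measurable
    finally show "ennreal \<bar>a n\<bar> * (\<integral>\<^sup>+y. ennreal \<bar>tensor b g (place n y) * f y\<bar> \<partial>\<mu>) =
        ennreal \<bar>b n * a n\<bar> * (\<integral>\<^sup>+y. ennreal \<bar>g y * f y\<bar> \<partial>\<mu>)"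
      by (simp add: abs_mult ennreal_mult mult_ac)
  qed
  finally show ?thesis by simp
qed

lemma suminf_entries_prod:
  assumes "\<And>x. x \<in> set xs \<Longrightarrow> 0 \<le> x" "\<And>y. y \<in> set ys \<Longrightarrow> 0 \<le> y" "length ys = length xs"
  shows "(\<Sum>n. ennreal \<bar>entries xs n * entries ys n\<bar>) = ennreal (\<Sum>i<length xs. xs ! i * ys ! i)"
proof -
  have "(\<Sum>n. ennreal \<bar>entries xs n * entries ys n\<bar>) = (\<Sum>n<length xs. ennreal \<bar>entries xs n * entries ys n\<bar>)"
    by (intro suminf_finite) (auto simp: entries_def)
  also have "\<dots> = (\<Sum>n<length xs. ennreal (xs ! n * ys ! n))"
    using assms by (intro sum.cong) (auto simp: entries_def)
  also have "\<dots> = ennreal (\<Sum>i<length xs. xs ! i * ys ! i)" using assms by (intro sum_ennreal) auto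
  finally show ?thesis .
qed

lemma nn_integral_chi: "0 \<le> t \<Longrightarrow> (\<integral>\<^sup>+y. ennreal \<bar>chi t y * chi t y\<bar> \<partial>\<mu>) = ennreal t"
proof -
  assume "0 \<le> t"
  moreover have "(\<lambda>y. ennreal \<bar>chi t y * chi t y\<bar>) = indicator {0<..t}"
    by (auto simp: chi_def indicator_def fun_eq_iff)
  ultimately show ?thesis using nn_integral_indicator[OF sets_Ioc_mu] by (simp add: emeasure_Ioc_mu)
qed

lemma count_list_replicate: "count_list (replicate m x) v = (if x = v then m else 0)"
  by (induction m) auto

context rearrangement_invariant
begin

text \<open>
  The steps come in \<open>n\<close> blocks of \<open>K\<close> steps each.  Cyclic shifts inside the blocks do not change the norm, and
  the mean of the \<open>K\<close> shifts is constant on each block.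
\<close>

lemma averaging:
  assumes h: "\<And>i q. 0 \<le> h i q" and K: "0 < K" and t: "0 < t"
  shows "nrm X (steps t (map (\<lambda>i. (\<Sum>q<K. h i q) / real K) [0..<n])) \<le>
    nrm X (steps (t / real K) (concat (map (\<lambda>i. map (h i) [0..<K]) [0..<n])))"
proof -
  define e where "e i = (\<Sum>q<K. h i q) / real K" for i
  define W where "W s = map (\<lambda>j. h (j div K) ((j mod K + s) mod K)) [0..<n * K]" for s
  define E where "E = map (\<lambda>j. e (j div K)) [0..<n * K]"
  let ?W = "concat (map (\<lambda>i. map (h i) [0..<K]) [0..<n])"
  have tK: "0 < t / real K" using t K by simp
  have e0: "0 \<le> e i" for i unfolding e_def using h by (intro divide_nonneg_nonneg sum_nonneg) auto
  have W: "nrm X (steps (t / real K) (W s)) \<le> nrm X (steps (t / real K) ?W)" for s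
  proof (rule steps_mono[OF _ tK tK])
    have eq: "W s = concat (map (\<lambda>i. map (\<lambda>q. h i ((s + q) mod K)) [0..<K]) [0..<n])"
      unfolding W_def using map_div_mod_upt[OF K, of "\<lambda>i q. h i ((q + s) mod K)"] by (simp add: add.commute)
    show "0 \<le> x" if "x \<in> set (W s)" for x using that h by (auto simp: W_def)
    show "real (count_list (W s) v) * (t / real K) \<le> real (count_list ?W v) * (t / real K)" for v
      by (simp add: eq count_list_concat comp_def map_rotate_upt[OF K] count_list_rotate)
  qed
  have lin: "steps (t / real K) E x = (\<Sum>s<K. (1 / real K) * steps (t / real K) (W s) x)" for x
  proof -
    have "entries E m = (\<Sum>s<K. (1 / real K) * entries (W s) m)" for m
    proof (cases "m < n * K")
      case True
      have "(\<Sum>s<K. (1 / real K) * entries (W s) m) = (1 / real K) * (\<Sum>s<K. h (m div K) ((m mod K + s) mod K))"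
        using True by (simp add: entries_def W_def sum_distrib_left)
      also have "\<dots> = e (m div K)" unfolding sum_rotate[OF K] by (simp add: e_def)
      finally show ?thesis using True by (simp add: entries_def E_def)
    qed (simp add: entries_def E_def W_def)
    then show ?thesis by (simp add: steps_def tensor_def sum_distrib_left sum_distrib_right mult_ac)
  qed
  have "nrm X (steps t (map e [0..<n])) \<le> nrm X (steps (t / real K) E)"
  proof (rule steps_mono[OF _ t tK])
    have eq: "E = concat (map (\<lambda>i. map (\<lambda>_. e i) [0..<K]) [0..<n])"
      unfolding E_def using map_div_mod_upt[OF K, of "\<lambda>i q. e i"] by simp
    show "real (count_list (map e [0..<n]) v) * t \<le> real (count_list E v) * (t / real K)" for v
      unfolding eq count_list_blocks using K by simp
    show "0 \<le> x" if "x \<in> set (map e [0..<n])" for x using that e0 by auto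
  qed
  also have "steps (t / real K) E = (\<lambda>x. \<Sum>s<K. (1 / real K) * steps (t / real K) (W s) x)"
    using lin by auto
  also have "nrm X \<dots> \<le> (\<Sum>s<K. nrm X (\<lambda>x. (1 / real K) * steps (t / real K) (W s) x))"
    using sumX[of "{..<K}" "\<lambda>s x. (1 / real K) * steps (t / real K) (W s) x"] scaleX[OF stepsX[OF tK]] by blast
  also have "\<dots> \<le> (\<Sum>s<K. (1 / real K) * nrm X (steps (t / real K) ?W))"
  proof (rule sum_mono)
    fix s
    have "nrm X (\<lambda>x. (1 / real K) * steps (t / real K) (W s) x) = (1 / real K) * nrm X (steps (t / real K) (W s))"
      using nrmX_scale[OF stepsX[OF tK], of "1 / real K"] by simp
    then show "nrm X (\<lambda>x. (1 / real K) * steps (t / real K) (W s) x) \<le> (1 / real K) * nrm X (steps (t / real K) ?W)"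
      using W[of s] K by (simp add: divide_right_mono)
  qed
  also have "\<dots> = nrm X (steps (t / real K) ?W)" using K by simp
  finally show ?thesis by (simp add: e_def)
qed

text \<open>
  The hypothesis \<open>key\<close> bounds the pairing of \<open>steps t ys\<close> with nonnegative step functions that have
  the same steps.  A simple function \<open>u\<close> is compared to such a function by replacing it, over each step, by
  its mean.  To see that this does not increase the norm, \<open>u\<close> is first minorized by a step
  function with \<open>K\<close> steps of measure \<open>t/K\<close> over each step of \<open>steps t ys\<close>, so that \<open>averaging\<close> applies; the
  error is \<open>c/K\<close> and vanishes as \<open>K\<close> tends to infinity.
\<close>

lemma koethe_steps_simple:
  assumes ys: "\<And>y. y \<in> set ys \<Longrightarrow> 0 \<le> y" and t: "0 < t"
    and key: "\<And>e. (\<And>i. 0 \<le> e i) \<Longrightarrow>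
      t * (\<Sum>i<length ys. ys ! i * e i) \<le> nrm X (steps t (map e [0..<length ys]))"
    and u: "simple_function \<mu> u" "\<And>x. 0 \<le> u x" "u \<in> elts X" "nrm X u \<le> 1"
  shows "(\<integral>\<^sup>+x. ennreal (steps t ys x * u x) \<partial>\<mu>) \<le> 1"
proof -
  have um[measurable]: "u \<in> borel_measurable \<mu>" by (rule measX[OF u(3)])
  define n where "n = length ys"
  define V where "V = {v\<in>u ` space \<mu>. 0 < v}"
  have V: "finite V" using simple_functionD(1)[OF u(1)] by (simp add: V_def)
  define A where "A i = {x\<in>space \<mu>. copy_no x = i \<and> copy_pos x \<le> t}" for i
  define B where "B i v = {x\<in>space \<mu>. (copy_no x = i \<and> copy_pos x \<le> t) \<and> u x = v}" for i v
  have [measurable]: "Measurable.pred \<mu> (\<lambda>x. copy_no x = i \<and> copy_pos x \<le> t)" for i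
  proof -
    have "Measurable.pred \<mu> (\<lambda>x. copy_no x = i)" by (rule measurable_compose[OF measurable_copy_no]) simp
    moreover have "Measurable.pred \<mu> (\<lambda>x. copy_pos x \<le> t)"
    proof (rule measurable_compose[OF measurable_copy_pos])
      have "{x \<in> space \<mu>. x \<le> t} = {0<..t}" by auto
      then show "Measurable.pred \<mu> (\<lambda>x. x \<le> t)" using sets_Ioc_mu[of t] by (simp add: pred_def del: space_mu)
    qed
    ultimately show ?thesis by (rule pred_intros_logic)
  qed
  have A[measurable]: "A i \<in> sets \<mu>" for i unfolding A_def by measurable
  have B[measurable]: "B i v \<in> sets \<mu>" for i v unfolding B_def by measurable
  have eA: "emeasure \<mu> (A i) = ennreal t" for i
  proof -
    have "emeasure \<mu> (A i) = (\<Sum>m. emeasure \<mu> {y\<in>space \<mu>. copy_no (place m y) = i \<and> copy_pos (place m y) \<le> t})"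
      unfolding A_def by (rule emeasure_copies) measurable
    also have "\<dots> = (\<Sum>m. if m = i then ennreal t else 0)"
    proof (intro suminf_cong)
      fix m
      have "{y\<in>space \<mu>. copy_no (place m y) = i \<and> copy_pos (place m y) \<le> t} = (if m = i then {0<..t} else {})"
        by (auto simp: copy_no_place copy_pos_place)
      then show "emeasure \<mu> {y\<in>space \<mu>. copy_no (place m y) = i \<and> copy_pos (place m y) \<le> t} = (if m = i then ennreal t else 0)"
        using emeasure_Ioc_mu[of t] t by (simp only: if_distrib[of "emeasure \<mu>"] emeasure_empty)
    qed
    also have "\<dots> = ennreal t" using sums_single[of i "\<lambda>_. ennreal t"] by (simp add: sums_iff)
    finally show ?thesis .
  qed
  define \<beta> where "\<beta> i v = measure \<mu> (B i v)" for i v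
  have \<beta>0: "0 \<le> \<beta> i v" for i v by (simp add: \<beta>_def)
  have eB: "emeasure \<mu> (B i v) = ennreal (\<beta> i v)" for i v
  proof -
    have "emeasure \<mu> (B i v) \<le> emeasure \<mu> (A i)" by (rule emeasure_mono[OF _ A]) (auto simp: A_def B_def)
    then show ?thesis unfolding \<beta>_def using eA[of i] by (intro emeasure_eq_ennreal_measure) (auto simp: top_unique)
  qed
  have sumV: "(\<Sum>v\<in>V. \<beta> i v) \<le> t" for i
  proof -
    have "(\<Sum>v\<in>V. emeasure \<mu> (B i v)) = emeasure \<mu> (\<Union>v\<in>V. B i v)"
    proof (rule sum_emeasure)
      show "(\<lambda>v. B i v) ` V \<subseteq> sets \<mu>" using B by blast
      show "disjoint_family_on (\<lambda>v. B i v) V" unfolding disjoint_family_on_def B_def by blast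
    qed (rule V)
    also have "\<dots> \<le> emeasure \<mu> (A i)" by (rule emeasure_mono[OF _ A]) (auto simp: A_def B_def)
    finally have "ennreal (\<Sum>v\<in>V. \<beta> i v) \<le> ennreal t" by (simp add: eB eA \<beta>0)
    then show ?thesis using t by simp
  qed
  have sumI: "ennreal (\<Sum>i<n. \<beta> i v) \<le> emeasure \<mu> {x\<in>space \<mu>. u x = v}" for v
  proof -
    have "ennreal (\<Sum>i<n. \<beta> i v) = (\<Sum>i<n. emeasure \<mu> (B i v))" by (simp add: eB \<beta>0)
    also have "\<dots> = emeasure \<mu> (\<Union>i<n. B i v)"
    proof (rule sum_emeasure)
      show "(\<lambda>i. B i v) ` {..<n} \<subseteq> sets \<mu>" using B by blast
      show "disjoint_family_on (\<lambda>i. B i v) {..<n}" unfolding disjoint_family_on_def B_def by blast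
    qed simp
    also have "\<dots> \<le> emeasure \<mu> {x\<in>space \<mu>. u x = v}"
    proof (rule emeasure_mono)
      show "{x\<in>space \<mu>. u x = v} \<in> sets \<mu>" by measurable
    qed (auto simp: B_def)
    finally show ?thesis .
  qed
  have ysn: "0 \<le> ys ! i" if "i < n" for i using that ys by (simp add: n_def)
  have Vpos: "0 < v" if "v \<in> V" for v using that by (simp add: V_def)
  define S where "S = (\<Sum>i<n. \<Sum>v\<in>V. ys ! i * v * \<beta> i v)"
  have int: "(\<integral>\<^sup>+x. ennreal (steps t ys x * u x) \<partial>\<mu>) = ennreal S"
  proof -
    have pt: "ennreal (steps t ys x * u x) = (\<Sum>i<n. \<Sum>v\<in>V. ennreal (ys ! i * v) * indicator (B i v) x)" if x: "x \<in> space \<mu>" for x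
    proof -
      have "(\<Sum>i<n. \<Sum>v\<in>V. ennreal (ys ! i * v) * indicator (B i v) x) =
          (\<Sum>i<n. if i = copy_no x then (\<Sum>v\<in>V. if v = u x then (if copy_pos x \<le> t then ennreal (ys ! i * v) else 0) else 0) else 0)"
        using x by (intro sum.cong) (auto simp: B_def indicator_def intro!: sum.cong)
      also have "\<dots> = (if copy_no x < n \<and> u x \<in> V \<and> copy_pos x \<le> t then ennreal (ys ! copy_no x * u x) else 0)"
        using V by (simp add: sum.delta)
      also have "\<dots> = ennreal (steps t ys x * u x)"
      proof (cases "u x = 0")
        case False
        then have "u x \<in> V" using u(2)[of x] x by (auto simp: V_def)
        then show ?thesis using x by (auto simp: steps_def tensor_def entries_def chi_def n_def indicator_def)
      qed simp
      finally show ?thesis ..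
    qed
    have "(\<integral>\<^sup>+x. ennreal (steps t ys x * u x) \<partial>\<mu>) = (\<integral>\<^sup>+x. (\<Sum>i<n. \<Sum>v\<in>V. ennreal (ys ! i * v) * indicator (B i v) x) \<partial>\<mu>)"
      by (intro nn_integral_cong pt)
    also have "\<dots> = (\<Sum>i<n. \<Sum>v\<in>V. ennreal (ys ! i * v) * emeasure \<mu> (B i v))"
      by (simp add: nn_integral_sum nn_integral_cmult_indicator)
    also have "\<dots> = (\<Sum>i<n. \<Sum>v\<in>V. ennreal (ys ! i * v * \<beta> i v))"
      using ysn Vpos \<beta>0 by (intro sum.cong refl) (simp add: eB ennreal_mult less_imp_le)
    also have "\<dots> = ennreal S"
    proof -
      have pos: "0 \<le> ys ! i * v * \<beta> i v" if "i \<in> {..<n}" "v \<in> V" for i v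
        using that ysn[of i] Vpos[of v] \<beta>0[of i v] by (auto intro!: mult_nonneg_nonneg)
      have "(\<Sum>v\<in>V. ennreal (ys ! i * v * \<beta> i v)) = ennreal (\<Sum>v\<in>V. ys ! i * v * \<beta> i v)" if "i \<in> {..<n}" for i
        using pos[OF that] by (intro sum_ennreal) auto
      then have "(\<Sum>i<n. \<Sum>v\<in>V. ennreal (ys ! i * v * \<beta> i v)) = (\<Sum>i<n. ennreal (\<Sum>v\<in>V. ys ! i * v * \<beta> i v))"
        by (intro sum.cong) auto
      also have "\<dots> = ennreal S" unfolding S_def using pos by (intro sum_ennreal sum_nonneg) auto
      finally show ?thesis .
    qed
    finally show ?thesis .
  qed
  define c where "c = t * (\<Sum>i<n. \<Sum>v\<in>V. ys ! i * v)"
  have est: "S - c / real K \<le> 1" if K: "0 < K" for K :: nat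
  proof -
    \<comment> \<open>Height \<open>v\<close> over step \<open>i\<close> is given to as many pieces of measure \<open>t/K\<close> as fit into its level set.\<close>
    define m where "m i v = nat \<lfloor>\<beta> i v * real K / t\<rfloor>" for i v
    define vs where "vs = sorted_list_of_set V"
    have vs: "set vs = V" "distinct vs" using V by (auto simp: vs_def)
    define M where "M i = concat (map (\<lambda>v. replicate (m i v) v) vs)" for i
    have mr: "real (m i v) \<le> \<beta> i v * real K / t" "\<beta> i v * real K / t - 1 \<le> real (m i v)" for i v
    proof -
      have "0 \<le> \<beta> i v * real K / t" using \<beta>0 t by simp
      then have "real (m i v) = \<lfloor>\<beta> i v * real K / t\<rfloor>" by (simp add: m_def)
      then show "real (m i v) \<le> \<beta> i v * real K / t" "\<beta> i v * real K / t - 1 \<le> real (m i v)" by linarith+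
    qed
    have lenM: "length (M i) \<le> K" for i
    proof -
      have "real (length (M i)) = (\<Sum>v\<in>V. real (m i v))"
        using vs by (simp add: M_def length_concat comp_def sum_list_distinct_conv_sum_set)
      also have "\<dots> \<le> (\<Sum>v\<in>V. \<beta> i v * (real K / t))" using mr(1) by (intro sum_mono) simp
      also have "\<dots> \<le> t * (real K / t)" unfolding sum_distrib_right[symmetric] using sumV[of i] t by (intro mult_right_mono) auto
      finally show ?thesis using t by simp
    qed
    have countM: "count_list (M i) v = (if v \<in> V then m i v else 0)" for i v
    proof -
      have "count_list (M i) v = (\<Sum>w\<in>V. if w = v then m i w else 0)"
        using vs by (simp add: M_def count_list_concat comp_def count_list_replicate sum_list_distinct_conv_sum_set)
      then show ?thesis using V by (simp add: sum.delta')
    qed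
    have sumM: "sum_list (M i) = (\<Sum>v\<in>V. real (m i v) * v)" for i
    proof -
      have "sum_list (concat xss) = (\<Sum>xs\<leftarrow>xss. sum_list xs)" for xss :: "real list list" by (induction xss) auto
      then show ?thesis using vs by (simp add: M_def comp_def sum_list_replicate sum_list_distinct_conv_sum_set)
    qed
    have block: "map (entries (M i)) [0..<K] = M i @ replicate (K - length (M i)) 0" for i
      using lenM[of i] by (intro nth_equalityI) (auto simp: entries_def nth_append)
    have h: "0 \<le> entries (M i) q" for i q
    proof (cases "q < length (M i)")
      case True
      then have "entries (M i) q \<in> set (M i)" by (simp add: entries_def)
      then have "entries (M i) q \<in> V" using vs by (auto simp: M_def)
      then show ?thesis using Vpos by (simp add: less_imp_le)
    qed (simp add: entries_def)
    define e where "e i = (\<Sum>q<K. entries (M i) q) / real K" for i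
    have e: "e i = (\<Sum>v\<in>V. real (m i v) * v) / real K" for i
    proof -
      have "(\<Sum>q<K. entries (M i) q) = sum_list (map (entries (M i)) [0..<K])"
        by (simp add: interv_sum_list_conv_sum_set_nat atLeast0LessThan)
      then show ?thesis by (simp add: e_def block sum_list_replicate sumM)
    qed
    let ?W = "concat (map (\<lambda>i. map (entries (M i)) [0..<K]) [0..<n])"
    have "t * (\<Sum>i<n. ys ! i * e i) \<le> nrm X (steps t (map e [0..<n]))"
      unfolding n_def using h by (intro key) (simp add: e_def sum_nonneg)
    also have "\<dots> \<le> nrm X (steps (t / real K) ?W)"
      unfolding e_def[abs_def] by (rule averaging[OF h K t])
    also have "\<dots> \<le> nrm X u"
    proof (rule steps_dominated)
      show "0 \<le> x" if "x \<in> set ?W" for x using that h by auto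
      show "0 < t / real K" using t K by simp
      fix v :: real assume v: "0 < v"
      have "real (count_list ?W v) * (t / real K) = (\<Sum>i<n. real (if v \<in> V then m i v else 0)) * (t / real K)"
        using v by (simp add: count_list_concat comp_def block countM count_list_replicate
            interv_sum_list_conv_sum_set_nat atLeast0LessThan)
      also have "\<dots> \<le> (\<Sum>i<n. \<beta> i v * real K / t) * (t / real K)"
        using mr(1) \<beta>0 t K by (intro mult_right_mono sum_mono) auto
      also have "\<dots> = (\<Sum>i<n. \<beta> i v)"
        unfolding sum_distrib_right using t K by (intro sum.cong) auto
      finally show "ennreal (real (count_list ?W v) * (t / real K)) \<le> emeasure \<mu> {x\<in>space \<mu>. u x = v}"
        using sumI[of v] by (meson ennreal_leI order_trans)
    qed (rule u(3))
    also have "\<dots> \<le> 1" by (rule u(4))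
    finally have le1: "t * (\<Sum>i<n. ys ! i * e i) \<le> 1" .
    have "S - c / real K = (\<Sum>i<n. \<Sum>v\<in>V. ys ! i * v * (\<beta> i v - t / real K))"
      by (simp add: S_def c_def right_diff_distrib sum_subtractf sum_distrib_left sum_divide_distrib mult_ac)
    also have "\<dots> \<le> (\<Sum>i<n. \<Sum>v\<in>V. ys ! i * v * (real (m i v) * t / real K))"
    proof (intro sum_mono mult_left_mono)
      fix i v assume "i \<in> {..<n}" "v \<in> V"
      have "(\<beta> i v * real K / t - 1) * (t / real K) \<le> real (m i v) * (t / real K)"
        using mr(2) t K by (intro mult_right_mono) auto
      moreover have "(\<beta> i v * real K / t - 1) * (t / real K) = \<beta> i v - t / real K"
        using t K by (simp add: left_diff_distrib diff_divide_distrib)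
      ultimately show "\<beta> i v - t / real K \<le> real (m i v) * t / real K" by simp
    qed (use ysn Vpos in \<open>auto simp: less_imp_le\<close>)
    also have "\<dots> = t * (\<Sum>i<n. ys ! i * e i)"
      by (simp add: e sum_distrib_left sum_divide_distrib mult_ac)
    finally show ?thesis using le1 by simp
  qed
  have "(\<lambda>k. S - c / real (Suc k)) \<longlonglongrightarrow> S - 0"
    by (intro tendsto_intros LIMSEQ_Suc lim_const_over_n)
  then have "S \<le> 1" using est[of "Suc _"] by (intro LIMSEQ_le_const2[where X="\<lambda>k. S - c / real (Suc k)"]) auto
  then show ?thesis unfolding int by (simp add: ennreal_le_1)
qed

lemma koethe_steps_le_1:
  assumes ys: "\<And>y. y \<in> set ys \<Longrightarrow> 0 \<le> y" and t: "0 < t"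
    and key: "\<And>e. (\<And>i. 0 \<le> e i) \<Longrightarrow>
      t * (\<Sum>i<length ys. ys ! i * e i) \<le> nrm X (steps t (map e [0..<length ys]))"
  shows "koethe_enorm X (steps t ys) \<le> 1"
  unfolding koethe_enorm_def
proof (rule SUP_least)
  fix f assume f: "f \<in> {g \<in> elts X. nrm X g \<le> 1}"
  then have fX: "f \<in> elts X" by simp
  have s0: "0 \<le> steps t ys x" for x using steps_values[of t ys x] ys by auto
  have "(\<integral>\<^sup>+x. ennreal (steps t ys x * \<bar>f x\<bar>) \<partial>\<mu>) \<le> 1"
  proof (rule nn_integral_le_by_simple[OF measX[OF fX]])
    show "(\<lambda>x. steps t ys x * u x) \<in> borel_measurable \<mu>" if "u \<in> borel_measurable \<mu>" for u
      using that by (intro borel_measurable_times measurable_steps)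
    fix u assume u: "simple_function \<mu> u" "\<And>x. 0 \<le> u x" "\<And>x. u x \<le> \<bar>f x\<bar>"
    then have "u \<in> elts X \<and> nrm X u \<le> nrm X f"
      by (intro idealX borel_measurable_simple_function fX AE_I2) simp_all
    then show "(\<integral>\<^sup>+x. ennreal (steps t ys x * u x) \<partial>\<mu>) \<le> 1"
      using f by (intro koethe_steps_simple[OF ys t key u(1,2)]) auto
  qed (use s0 in \<open>auto intro!: mult_left_mono tendsto_mult\<close>)
  then show "(\<integral>\<^sup>+x. ennreal \<bar>steps t ys x * f x\<bar> \<partial>\<mu>) \<le> 1" using s0 by (simp add: abs_mult)
qed

text \<open>
  The Hahn-Banach functional \<open>c\<close> for the norm on the span of the steps may have negative coefficients;
  their moduli still define a functional of norm at most one, because the norm does not depend on signs.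
\<close>

lemma norming:
  assumes xs: "\<And>x. x \<in> set xs \<Longrightarrow> 0 \<le> x" and t: "0 < t"
  shows "\<exists>ys. (\<forall>y\<in>set ys. 0 \<le> y) \<and> length ys = length xs \<and> koethe_enorm X (steps t ys) \<le> 1 \<and>
    nrm X (steps t xs) \<le> t * (\<Sum>i<length xs. xs ! i * ys ! i)"
proof -
  define n where "n = length xs"
  define cut where "cut d i = (if i < n then d i else 0)" for d :: "nat \<Rightarrow> real" and i
  define p where "p d = nrm X (tensor (cut d) (chi t))" for d
  have fin: "finite {i. cut d i \<noteq> 0}" for d
    by (rule finite_subset[of _ "{..<n}"]) (auto simp: cut_def split: if_splits)
  have TX: "tensor (cut d) (chi t) \<in> elts X" for d by (intro tensor_closedX chiX t fin)
  have "sublinear p"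
    unfolding sublinear_def
  proof (intro conjI allI impI)
    fix x y :: "nat \<Rightarrow> real"
    have "tensor (cut (\<lambda>i. x i + y i)) (chi t) = (\<lambda>s. tensor (cut x) (chi t) s + tensor (cut y) (chi t) s)"
      by (auto simp: tensor_def cut_def fun_eq_iff distrib_right)
    then show "p (\<lambda>i. x i + y i) \<le> p x + p y" unfolding p_def using triangleX[OF TX TX, of x y] by simp
  next
    fix c :: real and x :: "nat \<Rightarrow> real" assume "0 \<le> c"
    moreover have "tensor (cut (\<lambda>i. c * x i)) (chi t) = (\<lambda>s. c * tensor (cut x) (chi t) s)"
      by (auto simp: tensor_def cut_def fun_eq_iff)
    ultimately show "p (\<lambda>i. c * x i) = c * p x" unfolding p_def using nrmX_scale[OF TX, of c x] by simp
  qed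
  moreover have "entries xs i = 0" if "n \<le> i" for i using that by (simp add: entries_def n_def)
  ultimately obtain c where c: "p (entries xs) \<le> (\<Sum>i<n. c i * entries xs i)"
    "\<And>d. (\<forall>i\<ge>n. d i = 0) \<Longrightarrow> (\<Sum>i<n. c i * d i) \<le> p d"
    using hahn_banach_finite[of p n "entries xs"] by blast
  define ys where "ys = map (\<lambda>i. \<bar>c i\<bar> / t) [0..<n]"
  have ys: "0 \<le> y" if "y \<in> set ys" for y using that t by (auto simp: ys_def)
  have len: "length ys = n" by (simp add: ys_def)
  have key: "t * (\<Sum>i<length ys. ys ! i * e i) \<le> nrm X (steps t (map e [0..<length ys]))" if e: "\<And>i. 0 \<le> e i" for e
  proof -
    define d where "d i = (if i < n then sgn (c i) * e i else 0)" for i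
    have "t * (\<Sum>i<length ys. ys ! i * e i) = (\<Sum>i<n. c i * d i)"
      unfolding len sum_distrib_left using t by (intro sum.cong) (auto simp: ys_def d_def abs_sgn)
    also have "\<dots> \<le> p d" by (rule c(2)) (simp add: d_def)
    also have "\<dots> \<le> nrm X (steps t (map e [0..<n]))"
      unfolding p_def
    proof (rule idealX[THEN conjunct2, OF measX[OF TX] stepsX[OF t]], rule AE_I2)
      show "\<bar>tensor (cut d) (chi t) x\<bar> \<le> \<bar>steps t (map e [0..<n]) x\<bar>" for x
        using e[of "copy_no x"] by (auto simp: tensor_def steps_def entries_def cut_def d_def abs_mult sgn_if intro!: mult_right_mono)
    qed
    finally show ?thesis by (simp add: len)
  qed
  have "koethe_enorm X (steps t ys) \<le> 1" by (rule koethe_steps_le_1[OF ys t key])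
  moreover have "nrm X (steps t xs) \<le> t * (\<Sum>i<n. xs ! i * ys ! i)"
  proof -
    have "cut (entries xs) = entries xs" by (auto simp: cut_def entries_def n_def)
    then have "nrm X (steps t xs) \<le> (\<Sum>i<n. c i * entries xs i)" using c(1) by (simp add: p_def steps_def)
    also have "\<dots> \<le> (\<Sum>i<n. t * (xs ! i * ys ! i))"
    proof (rule sum_mono)
      fix i assume i: "i \<in> {..<n}"
      then have "0 \<le> xs ! i" using xs by (simp add: n_def)
      then have "c i * xs ! i \<le> \<bar>c i\<bar> * xs ! i" by (intro mult_right_mono) auto
      then show "c i * entries xs i \<le> t * (xs ! i * ys ! i)" using i t by (simp add: entries_def ys_def n_def mult.commute)
    qed
    finally show ?thesis by (simp add: sum_distrib_left)
  qed
  ultimately show ?thesis using ys len by (intro exI[of _ ys]) (auto simp: n_def)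
qed

end

section \<open>The tensor power trick\<close>

text \<open>
  The sequence \<open>a k = log 2 (u (2 ^ k))\<close> is additive up to a constant \<open>K\<close>.  Computing \<open>a (k l)\<close> in two ways
  gives \<open>(a k - K) / k \<le> (a l + K) / l\<close> for all \<open>k\<close> and \<open>l\<close>, so any number \<open>\<alpha>\<close> separating the two families satisfies
  \<open>\<bar>a k - \<alpha> k\<bar> \<le> K\<close>.  Monotonicity interpolates between powers of two.
\<close>

lemma quasi_multiplicative_power:
  fixes u :: "nat \<Rightarrow> real"
  assumes pos: "\<And>n. 0 < n \<Longrightarrow> 0 < u n" and mono: "\<And>m n. 0 < m \<Longrightarrow> m \<le> n \<Longrightarrow> u m \<le> u n"
    and c: "0 < c" "\<And>m n. 0 < m \<Longrightarrow> 0 < n \<Longrightarrow> c * u m * u n \<le> u (m * n)"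
    and C: "0 < C" "\<And>m n. 0 < m \<Longrightarrow> 0 < n \<Longrightarrow> u (m * n) \<le> C * u m * u n"
  shows "\<exists>\<alpha> A B. 0 \<le> \<alpha> \<and> 0 < A \<and> 0 < B \<and> (\<forall>n>0. A * real n powr \<alpha> \<le> u n \<and> u n \<le> B * real n powr \<alpha>)"
proof -
  define a where "a k = log 2 (u (2 ^ k))" for k :: nat
  define K where "K = \<bar>log 2 c\<bar> + \<bar>log 2 C\<bar>"
  have up: "0 < u (2 ^ k)" for k by (rule pos) simp
  have nz: "u (2 ^ k) \<noteq> 0" for k using up[of k] by simp
  have a1: "a k + a l - K \<le> a (k + l)" "a (k + l) \<le> a k + a l + K" for k l
  proof -
    have "log 2 (c * u (2^k) * u (2^l)) \<le> a (k + l)"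
      unfolding a_def using c(2)[of "2^k" "2^l"] up[of k] up[of l] up[of "k + l"] c(1) by (subst log_le_cancel_iff) (auto simp: power_add)
    then show "a k + a l - K \<le> a (k + l)"
      using c(1) by (simp add: a_def K_def log_mult nz)
    have "a (k + l) \<le> log 2 (C * u (2^k) * u (2^l))"
      unfolding a_def using C(2)[of "2^k" "2^l"] up[of k] up[of l] up[of "k + l"] C(1) by (subst log_le_cancel_iff) (auto simp: power_add)
    then show "a (k + l) \<le> a k + a l + K"
      using C(1) by (simp add: a_def K_def log_mult nz)
  qed
  have mult: "real l * a k - real l * K \<le> a (l * k) - K" "a (l * k) + K \<le> real l * a k + real l * K" if "0 < l" for k l
    using that
  proof (induction l rule: nat_induct_non_zero)
    case (Suc l)
    {
      case 1 show ?case using a1[of k "l * k"] Suc by (simp add: algebra_simps)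
    next
      case 2 show ?case using a1[of k "l * k"] Suc by (simp add: algebra_simps)
    }
  qed auto
  have sep: "(a k - K) / real k \<le> (a l + K) / real l" if "0 < k" "0 < l" for k l
  proof -
    have "real l * a k - real l * K \<le> real k * a l + real k * K"
    proof -
      have "0 \<le> K" by (simp add: K_def)
      moreover have "a (l * k) = a (k * l)" by (simp only: mult.commute)
      ultimately show ?thesis
        using mult(1)[OF that(2), of k] mult(2)[OF that(1), of l] by linarith
    qed
    then show ?thesis using that by (simp add: field_simps)
  qed
  define \<alpha> where "\<alpha> = (SUP k\<in>{0<..}. (a k - K) / real k)"
  have bdd: "bdd_above ((\<lambda>k. (a k - K) / real k) ` {0<..})"
    using sep[of _ 1] by (intro bdd_aboveI[of _ "(a 1 + K) / real 1"]) auto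
  have lo: "(a k - K) / real k \<le> \<alpha>" if "0 < k" for k
    unfolding \<alpha>_def using that bdd by (intro cSUP_upper) auto
  have hi: "\<alpha> \<le> (a k + K) / real k" if "0 < k" for k
    unfolding \<alpha>_def using that sep by (intro cSUP_least) auto
  have ak: "\<alpha> * real k - K \<le> a k \<and> a k \<le> \<alpha> * real k + K" for k
  proof (cases "k = 0")
    case True then show ?thesis using a1[of 0 0] by simp
  next
    case False then show ?thesis using lo[of k] hi[of k] by (simp add: field_simps)
  qed
  have "0 \<le> \<alpha>"
  proof -
    have "(a 0 - K) / real (Suc k) \<le> \<alpha>" for k
    proof -
      have "a 0 \<le> a (Suc k)"
        unfolding a_def using up[of 0] up[of "Suc k"] mono[of "2^0" "2^Suc k"] one_le_power[of "2::nat" "Suc k"] by (subst log_le_cancel_iff) auto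
      then have "(a 0 - K) / real (Suc k) \<le> (a (Suc k) - K) / real (Suc k)" by (intro divide_right_mono) auto
      then show ?thesis using lo[of "Suc k"] by simp
    qed
    moreover have "(\<lambda>k. (a 0 - K) / real (Suc k)) \<longlonglongrightarrow> 0" by (intro LIMSEQ_Suc lim_const_over_n)
    ultimately show ?thesis by (intro LIMSEQ_le_const2) auto
  qed
  have u2: "2 powr (- K) * 2 powr (\<alpha> * real k) \<le> u (2^k) \<and> u (2^k) \<le> 2 powr K * 2 powr (\<alpha> * real k)" for k
  proof -
    have "u (2^k) = 2 powr a k" using up by (simp add: a_def)
    then show ?thesis using ak[of k] by (auto simp flip: powr_add)
  qed
  have "2 powr (- K - \<alpha>) * real n powr \<alpha> \<le> u n \<and> u n \<le> 2 powr (K + \<alpha>) * real n powr \<alpha>" if n: "0 < n" for n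
  proof -
    obtain k where k: "2 ^ k \<le> n" "n < 2 ^ (k + 1)" using ex_power_ivl1[of 2 n] n by auto
    have 1: "2 powr (\<alpha> * real k) \<le> real n powr \<alpha>"
    proof -
      have "2 powr (\<alpha> * real k) = (2 ^ k) powr \<alpha>" by (simp add: powr_powr mult.commute flip: powr_realpow)
      also have "\<dots> \<le> real n powr \<alpha>" using k(1) \<open>0 \<le> \<alpha>\<close> by (intro powr_mono2) (auto simp flip: of_nat_le_iff)
      finally show ?thesis .
    qed
    have 2: "real n powr \<alpha> \<le> 2 powr (\<alpha> * real k) * 2 powr \<alpha>"
    proof -
      have "real n powr \<alpha> \<le> (2 ^ (k + 1)) powr \<alpha>"
        using k(2) \<open>0 \<le> \<alpha>\<close> by (intro powr_mono2) (auto simp flip: of_nat_less_iff simp del: power_Suc)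
      also have "\<dots> = 2 powr (\<alpha> * real (k + 1))"
        using powr_realpow[of 2 "k + 1"] powr_powr[of 2 "real (k + 1)" \<alpha>] by (simp only: mult.commute[of \<alpha>])
      also have "\<dots> = 2 powr (\<alpha> * real k) * 2 powr \<alpha>" by (simp add: distrib_left powr_add)
      finally show ?thesis .
    qed
    have "u n \<le> u (2 ^ (k + 1))" using n k(2) by (intro mono) auto
    also have "\<dots> \<le> 2 powr K * 2 powr (\<alpha> * real (k + 1))" using u2 by blast
    also have "\<dots> = 2 powr (K + \<alpha>) * 2 powr (\<alpha> * real k)" by (simp add: distrib_left powr_add)
    also have "\<dots> \<le> 2 powr (K + \<alpha>) * real n powr \<alpha>" using 1 by (intro mult_left_mono) auto
    finally have hi: "u n \<le> 2 powr (K + \<alpha>) * real n powr \<alpha>" .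
    have "2 powr (- K - \<alpha>) * real n powr \<alpha> \<le> 2 powr (- K - \<alpha>) * (2 powr (\<alpha> * real k) * 2 powr \<alpha>)"
      using 2 by (intro mult_left_mono) auto
    also have "\<dots> = 2 powr (- K) * 2 powr (\<alpha> * real k)" by (simp flip: powr_add)
    also have "\<dots> \<le> u (2 ^ k)" using u2 by blast
    also have "\<dots> \<le> u n" using k(1) by (intro mono) auto
    finally show ?thesis using hi by simp
  qed
  then show ?thesis using \<open>0 \<le> \<alpha>\<close> by (intro exI[of _ \<alpha>] exI[of _ "2 powr (- K - \<alpha>)"] exI[of _ "2 powr (K + \<alpha>)"]) auto
qed

text \<open>
  This is how factors linear in \<open>k\<close> are removed by taking \<open>k\<close>-th roots.
\<close>

lemma exponential_beats_linear:
  fixes u v d e L :: real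
  assumes "0 < v" "0 < d" and le: "\<And>k::nat. u ^ k * d \<le> e * (real k * L + 1) * v ^ k"
  shows "u \<le> v"
proof (rule ccontr)
  assume "\<not> u \<le> v"
  then have uv: "v < u" by simp
  define r where "r = v / u"
  have r: "0 < r" "r < 1" using uv assms(1) by (auto simp: r_def)
  have "d \<le> e * (L * (real k * r ^ k) + r ^ k)" for k
  proof -
    have "u ^ k * d \<le> u ^ k * (e * (L * (real k * r ^ k) + r ^ k))"
    proof -
      have "u ^ k * r ^ k = v ^ k" using uv assms(1) by (simp add: r_def flip: power_mult_distrib)
      then have "e * (real k * L + 1) * v ^ k = u ^ k * (e * (L * (real k * r ^ k) + r ^ k))"
        by (simp add: algebra_simps)
      then show ?thesis using le[of k] by (simp only:)
    qed
    then show ?thesis using uv assms(1) by (subst (asm) mult_le_cancel_left_pos) auto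
  qed
  moreover have "(\<lambda>k. e * (L * (real k * r ^ k) + r ^ k)) \<longlonglongrightarrow> e * (L * 0 + 0)"
    using r by (intro tendsto_intros powser_times_n_limit_0 LIMSEQ_power_zero) auto
  ultimately have "d \<le> 0" using LIMSEQ_le_const[of "\<lambda>k. e * (L * (real k * r ^ k) + r ^ k)" 0 d] by auto
  then show False using assms(2) by simp
qed

definition power_sum :: "real \<Rightarrow> real list \<Rightarrow> real" where
  "power_sum p xs = (\<Sum>x\<leftarrow>xs. x powr p)"

lemma power_sum_nonneg: "0 \<le> power_sum p xs"
  unfolding power_sum_def by (intro sum_list_nonneg) auto

lemma power_sum_lprod:
  assumes "\<And>x. x \<in> set xs \<Longrightarrow> 0 \<le> x" "\<And>y. y \<in> set ys \<Longrightarrow> 0 \<le> y"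
  shows "power_sum p (lprod xs ys) = power_sum p xs * power_sum p ys"
  using assms(1)
proof (induction xs)
  case (Cons x xs)
  have "(\<Sum>y\<leftarrow>ys. (x * y) powr p) = (\<Sum>y\<leftarrow>ys. x powr p * y powr p)"
    using Cons.prems assms(2) by (intro arg_cong[where f=sum_list] map_cong) (auto simp: powr_mult)
  then have "power_sum p (map ((*) x) ys) = x powr p * power_sum p ys"
    by (simp add: power_sum_def comp_def sum_list_const_mult)
  then show ?case using Cons by (simp add: lprod_def power_sum_def distrib_right)
qed (simp add: power_sum_def lprod_def)

fun list_power :: "real list \<Rightarrow> nat \<Rightarrow> real list" where
  "list_power xs 0 = [1]"
| "list_power xs (Suc k) = lprod xs (list_power xs k)"

text \<open>
  Think of \<open>N xs\<close> as a lattice norm of a sequence with positive entries \<open>xs\<close>.  It is multiplicative up to the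
  constants \<open>c\<close> and \<open>C\<close>, and on constant sequences it is comparable to the norm of \<open>l\<^sub>p\<close> for \<open>p = 1/\<alpha>\<close>.
\<close>

locale tensor_power_norm =
  fixes N :: "real list \<Rightarrow> real" and c C A B \<alpha> :: real
  assumes const: "0 < c" "0 < C" "0 < A" "0 < B" "0 < \<alpha>" "\<alpha> \<le> 1"
    and lower: "\<And>xs ys. \<forall>x\<in>set xs. 0 < x \<Longrightarrow> \<forall>y\<in>set ys. 0 < y \<Longrightarrow> c * N xs * N ys \<le> N (lprod xs ys)"
    and upper: "\<And>xs ys. \<forall>x\<in>set xs. 0 < x \<Longrightarrow> \<forall>y\<in>set ys. 0 < y \<Longrightarrow> N (lprod xs ys) \<le> C * N xs * N ys"
    and nonneg: "\<And>xs. 0 \<le> N xs"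
    and fundamental: "\<And>n x. 0 < x \<Longrightarrow> A * x * real n powr \<alpha> \<le> N (replicate n x)"
      "\<And>n x. 0 < x \<Longrightarrow> N (replicate n x) \<le> B * x * real n powr \<alpha>"
    and sub: "\<And>xs P. \<forall>x\<in>set xs. 0 < x \<Longrightarrow> N (filter P xs) \<le> N xs"
    and split: "\<And>xs P. \<forall>x\<in>set xs. 0 < x \<Longrightarrow> N xs \<le> N (filter P xs) + N (filter (\<lambda>x. \<not> P x) xs)"
    and low_const: "\<And>xs b. 0 < b \<Longrightarrow> \<forall>x\<in>set xs. b \<le> x \<Longrightarrow> N (replicate (length xs) b) \<le> N xs"
    and high_const: "\<And>xs b. 0 < b \<Longrightarrow> \<forall>x\<in>set xs. 0 < x \<and> x \<le> b \<Longrightarrow> N xs \<le> N (replicate (length xs) b)"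
begin

lemma powr_alpha: "0 \<le> x \<Longrightarrow> (x powr (1 / \<alpha>)) powr \<alpha> = x" "0 \<le> x \<Longrightarrow> (x powr \<alpha>) powr (1 / \<alpha>) = x"
  using const by (simp_all add: powr_powr)

lemma replicate_alpha:
  assumes "0 < x" shows "x * real n powr \<alpha> = (real n * x powr (1 / \<alpha>)) powr \<alpha>"
  using assms const by (simp add: powr_mult powr_alpha)

text \<open>
  The entries fall into \<open>L\<close> dyadic groups.  Inside a group all entries agree up to a factor \<open>2\<close>, so the norm of
  the group is comparable to its \<open>l\<^sub>p\<close> norm by \<open>fundamental\<close>.  The triangle inequality costs the factor \<open>L\<close>.
\<close>

lemma upper_crude:
  assumes "0 < m" "\<forall>x\<in>set xs. m \<le> x \<and> x < m * 2 ^ L"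
  shows "N xs \<le> 2 * B * real L * power_sum (1 / \<alpha>) xs powr \<alpha>"
  using assms(2)
proof (induction L arbitrary: xs)
  case 0
  then have "xs = []" by (cases xs) auto
  then show ?case using fundamental(2)[of 1 0] by simp
next
  case (Suc L)
  let ?P = "\<lambda>x. x < m * 2 ^ L"
  have pos: "\<forall>x\<in>set xs. 0 < x" using Suc.prems assms(1) by auto
  have le: "power_sum (1 / \<alpha>) (filter Q xs) \<le> power_sum (1 / \<alpha>) xs" for Q
    unfolding power_sum_def by (induction xs) (auto intro: add_increasing)
  have "N (filter ?P xs) \<le> 2 * B * real L * power_sum (1 / \<alpha>) (filter ?P xs) powr \<alpha>"
    by (rule Suc.IH) (use Suc.prems in auto)
  also have "\<dots> \<le> 2 * B * real L * power_sum (1 / \<alpha>) xs powr \<alpha>"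
    using le const power_sum_nonneg by (intro mult_left_mono powr_mono2) auto
  finally have 1: "N (filter ?P xs) \<le> 2 * B * real L * power_sum (1 / \<alpha>) xs powr \<alpha>" .
  let ?ys = "filter (\<lambda>x. \<not> ?P x) xs"
  have "N ?ys \<le> N (replicate (length ?ys) (m * 2 ^ Suc L))"
    using Suc.prems pos assms(1) by (intro high_const) (auto simp: less_imp_le)
  also have "\<dots> \<le> B * (m * 2 ^ Suc L) * real (length ?ys) powr \<alpha>"
    using assms(1) by (intro fundamental(2)) simp
  also have "\<dots> = 2 * B * (m * 2 ^ L * real (length ?ys) powr \<alpha>)" by simp
  also have "m * 2 ^ L * real (length ?ys) powr \<alpha> = (real (length ?ys) * (m * 2 ^ L) powr (1 / \<alpha>)) powr \<alpha>"
    using assms(1) by (intro replicate_alpha) simp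
  also have "\<dots> \<le> power_sum (1 / \<alpha>) xs powr \<alpha>"
  proof (rule powr_mono2)
    have "real (length zs) * (m * 2 ^ L) powr (1 / \<alpha>) \<le> power_sum (1 / \<alpha>) zs" if "\<forall>z\<in>set zs. m * 2 ^ L \<le> z" for zs
      using that
    proof (induction zs)
      case (Cons z zs)
      have "(m * 2 ^ L) powr (1 / \<alpha>) \<le> z powr (1 / \<alpha>)" using Cons.prems assms(1) const by (intro powr_mono2) auto
      then show ?case using Cons by (simp add: power_sum_def distrib_right)
    qed (simp add: power_sum_def)
    from this[of ?ys] show "real (length ?ys) * (m * 2 ^ L) powr (1 / \<alpha>) \<le> power_sum (1 / \<alpha>) xs"
      using le[of "\<lambda>x. \<not> ?P x"] by auto
  qed (use const assms(1) in auto)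
  finally have 2: "N ?ys \<le> 2 * B * power_sum (1 / \<alpha>) xs powr \<alpha>" using const by simp
  show ?case using split[OF pos, of ?P] 1 2 by (simp add: algebra_simps)
qed

text \<open>
  The same grouping as in \<open>upper_crude\<close>, now using that every group has norm at most \<open>N xs\<close>.
\<close>

lemma lower_crude:
  assumes "0 < m" "\<forall>x\<in>set xs. m \<le> x \<and> x < m * 2 ^ L"
  shows "power_sum (1 / \<alpha>) xs \<le> real L * (2 * N xs / A) powr (1 / \<alpha>)"
proof -
  have "power_sum (1 / \<alpha>) ys \<le> real L * (2 * M / A) powr (1 / \<alpha>)"
    if "\<forall>x\<in>set ys. m \<le> x \<and> x < m * 2 ^ L" "N ys \<le> M" for ys M
    using that
  proof (induction L arbitrary: ys)
    case 0
    then have "ys = []" by (cases ys) auto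
    then show ?case by (simp add: power_sum_def)
  next
    case (Suc L)
    let ?P = "\<lambda>x. x < m * 2 ^ L"
    have pos: "\<forall>x\<in>set ys. 0 < x" using Suc.prems assms(1) by auto
    have first: "power_sum (1 / \<alpha>) (filter ?P ys) \<le> real L * (2 * M / A) powr (1 / \<alpha>)"
    proof (rule Suc.IH)
      show "N (filter ?P ys) \<le> M" using sub[OF pos, of ?P] Suc.prems(2) by simp
    qed (use Suc.prems in auto)
    let ?zs = "filter (\<lambda>x. \<not> ?P x) ys"
    have "power_sum (1 / \<alpha>) zs \<le> real (length zs) * (m * 2 ^ Suc L) powr (1 / \<alpha>)" if "\<forall>z\<in>set zs. 0 < z \<and> z < m * 2 ^ Suc L" for zs
      using that
    proof (induction zs)
      case (Cons z zs)
      have "z powr (1 / \<alpha>) \<le> (m * 2 ^ Suc L) powr (1 / \<alpha>)" using Cons.prems const by (intro powr_mono2) auto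
      then show ?case using Cons by (simp add: power_sum_def distrib_right)
    qed (simp add: power_sum_def)
    from this[of ?zs] have "power_sum (1 / \<alpha>) ?zs \<le> real (length ?zs) * (m * 2 ^ Suc L) powr (1 / \<alpha>)"
      using Suc.prems pos by auto
    also have "\<dots> = (m * 2 ^ Suc L * real (length ?zs) powr \<alpha>) powr (1 / \<alpha>)"
      using assms(1) by (subst replicate_alpha) (auto simp: powr_alpha)
    also have "\<dots> \<le> (2 * M / A) powr (1 / \<alpha>)"
    proof (rule powr_mono2)
      have "A * (m * 2 ^ L) * real (length ?zs) powr \<alpha> \<le> N (replicate (length ?zs) (m * 2 ^ L))"
        using assms(1) by (intro fundamental(1)) simp
      also have "\<dots> \<le> N ?zs" using assms(1) by (intro low_const) auto
      also have "\<dots> \<le> M" using sub[OF pos, of "\<lambda>x. \<not> ?P x"] Suc.prems(2) by simp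
      finally show "m * 2 ^ Suc L * real (length ?zs) powr \<alpha> \<le> 2 * M / A" using const by (simp add: field_simps)
    qed (use const assms(1) in auto)
    finally have "power_sum (1 / \<alpha>) ?zs \<le> (2 * M / A) powr (1 / \<alpha>)" .
    moreover note first
    moreover have "power_sum (1 / \<alpha>) ys = power_sum (1 / \<alpha>) (filter ?P ys) + power_sum (1 / \<alpha>) ?zs"
      unfolding power_sum_def by (induction ys) auto
    ultimately show ?case by (simp add: distrib_right)
  qed
  then show ?thesis using assms(2) by blast
qed

lemma list_power_values:
  assumes "0 < a" "\<forall>x\<in>set xs. a \<le> x \<and> x \<le> b"
  shows "\<forall>y\<in>set (list_power xs k). a ^ k \<le> y \<and> y \<le> b ^ k"
proof (induction k)
  case (Suc k)
  show ?case
  proof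
    fix y assume "y \<in> set (list_power xs (Suc k))"
    then obtain x z where y: "y = x * z" "x \<in> set xs" "z \<in> set (list_power xs k)" by (auto simp: lprod_def)
    have "a ^ k \<le> z" "z \<le> b ^ k" "a \<le> x" "x \<le> b" using y Suc assms by auto
    moreover have "0 < a ^ k" using assms by simp
    moreover have "0 \<le> z" using calculation by linarith
    ultimately show "a ^ Suc k \<le> y \<and> y \<le> b ^ Suc k"
      using assms(1) unfolding y power_Suc by (intro conjI mult_mono) auto
  qed
qed simp

text \<open>
  If the entries of \<open>xs\<close> spread over \<open>L\<close> dyadic groups, those of its \<open>k\<close>-th tensor power spread over at most
  \<open>k L + 1\<close> of them.  Both the norm and the power sum of the tensor power are, up to constants to the power
  \<open>k\<close>, the \<open>k\<close>-th powers of those of \<open>xs\<close>.  Hence the crude estimates hold between \<open>k\<close>-th powers with a loss that is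
  only linear in \<open>k\<close>.
\<close>

lemma equivalent_to_power_sum:
  assumes pos: "\<forall>x\<in>set xs. 0 < x" and ne: "xs \<noteq> []"
  shows "c * N xs \<le> power_sum (1 / \<alpha>) xs powr \<alpha>" "power_sum (1 / \<alpha>) xs powr \<alpha> \<le> C * N xs"
proof -
  define a where "a = Min (set xs)"
  define b where "b = Max (set xs)"
  have a: "0 < a" using pos ne by (simp add: a_def)
  have ab: "\<forall>x\<in>set xs. a \<le> x \<and> x \<le> b" using ne by (simp add: a_def b_def)
  obtain L :: nat where L: "b / a < 2 ^ L" using real_arch_pow[of 2 "b / a"] by auto
  define S where "S = power_sum (1 / \<alpha>) xs"
  have ab0: "a \<le> b" using ab ne by (cases xs) auto
  have lp: "\<forall>y\<in>set (list_power xs k). a ^ k \<le> y \<and> y < a ^ k * 2 ^ (k * L + 1)" for k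
  proof
    fix y assume "y \<in> set (list_power xs k)"
    then have y: "a ^ k \<le> y" "y \<le> b ^ k" using list_power_values[OF a ab] by auto
    have "b ^ k \<le> (a * 2 ^ L) ^ k" using L a ab0 by (intro power_mono) (auto simp: field_simps)
    also have "\<dots> = a ^ k * 2 ^ (k * L)" by (simp add: power_mult_distrib power_mult mult.commute flip: power_mult)
    also have "\<dots> < a ^ k * 2 ^ (k * L + 1)" using a by simp
    finally show "a ^ k \<le> y \<and> y < a ^ k * 2 ^ (k * L + 1)" using y by simp
  qed
  have lpos: "\<forall>y\<in>set (list_power xs k). 0 < y" for k
    using lp[of k] a by (meson less_le_trans zero_less_power)
  have ps: "power_sum (1 / \<alpha>) (list_power xs k) = S ^ k" for k
  proof (induction k)
    case (Suc k)
    then show ?case using pos lpos[of k] by (simp add: power_sum_lprod less_imp_le S_def)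
  qed (simp add: power_sum_def)
  have N1: "0 < N [1]" using fundamental(1)[of 1 1] const by simp
  have lowN: "(c * N xs) ^ k * N [1] \<le> N (list_power xs k)" for k
  proof (induction k)
    case (Suc k)
    have "(c * N xs) ^ Suc k * N [1] = (c * N xs) * ((c * N xs) ^ k * N [1])" by simp
    also have "\<dots> \<le> (c * N xs) * N (list_power xs k)" using Suc const nonneg by (intro mult_left_mono) auto
    also have "\<dots> \<le> N (list_power xs (Suc k))" using lower[OF pos lpos[of k]] by simp
    finally show ?case .
  qed simp
  have upN: "N (list_power xs k) \<le> (C * N xs) ^ k * N [1]" for k
  proof (induction k)
    case (Suc k)
    have "N (list_power xs (Suc k)) \<le> (C * N xs) * N (list_power xs k)" using upper[OF pos lpos[of k]] by simp
    also have "\<dots> \<le> (C * N xs) * ((C * N xs) ^ k * N [1])" using Suc const nonneg by (intro mult_left_mono) auto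
    finally show ?case by simp
  qed simp
  have S0: "0 < S"
  proof -
    obtain x where x: "x \<in> set xs" using ne by (cases xs) auto
    then have "0 < x powr (1 / \<alpha>)" using pos by auto
    also have "\<dots> \<le> S" unfolding S_def power_sum_def using x by (intro member_le_sum_list) auto
    finally show ?thesis .
  qed
  have Sk: "(S ^ k) powr \<alpha> = (S powr \<alpha>) ^ k" for k
    using S0 by (simp add: powr_powr mult.commute flip: powr_realpow)
  show "c * N xs \<le> power_sum (1 / \<alpha>) xs powr \<alpha>"
  proof (rule exponential_beats_linear[of _ "N [1]" _ "2 * B" "real L"])
    show "0 < power_sum (1 / \<alpha>) xs powr \<alpha>" using S0 by (simp add: S_def)
    fix k
    have "(c * N xs) ^ k * N [1] \<le> N (list_power xs k)" by (rule lowN)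
    also have "\<dots> \<le> 2 * B * real (k * L + 1) * power_sum (1 / \<alpha>) (list_power xs k) powr \<alpha>"
      using a lp by (intro upper_crude[of "a ^ k"]) auto
    also have "\<dots> = 2 * B * (real k * real L + 1) * (power_sum (1 / \<alpha>) xs powr \<alpha>) ^ k"
      unfolding ps Sk by (simp add: S_def algebra_simps)
    finally show "(c * N xs) ^ k * N [1] \<le> 2 * B * (real k * real L + 1) * (power_sum (1 / \<alpha>) xs powr \<alpha>) ^ k" .
  qed (rule N1)
  have Npos: "0 < N xs"
  proof -
    have "0 < A * a * real (length xs) powr \<alpha>" using const a ne by simp
    also have "\<dots> \<le> N (replicate (length xs) a)" by (rule fundamental(1)[OF a])
    also have "\<dots> \<le> N xs" using ab by (intro low_const a) auto
    finally show ?thesis .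
  qed
  show "power_sum (1 / \<alpha>) xs powr \<alpha> \<le> C * N xs"
  proof (rule exponential_beats_linear[of _ 1 _ "2 * N [1] / A" "real L"])
    show "0 < C * N xs" using Npos const by simp
    fix k
    let ?n = "real (k * L + 1)" and ?M = "N (list_power xs k)"
    have "(power_sum (1 / \<alpha>) xs powr \<alpha>) ^ k = power_sum (1 / \<alpha>) (list_power xs k) powr \<alpha>"
      unfolding ps Sk by (simp add: S_def)
    also have "\<dots> \<le> (?n * (2 * ?M / A) powr (1 / \<alpha>)) powr \<alpha>"
      using lower_crude[OF _ lp] a const power_sum_nonneg by (intro powr_mono2) auto
    also have "\<dots> = ?n powr \<alpha> * (2 * ?M / A)"
      using const nonneg[of "list_power xs k"] by (simp add: powr_mult powr_powr)
    also have "\<dots> \<le> ?n * (2 * ?M / A)"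
    proof (rule mult_right_mono)
      have "?n powr \<alpha> \<le> ?n powr 1" using const by (intro powr_mono) auto
      then show "?n powr \<alpha> \<le> ?n" by simp
    qed (use const nonneg in auto)
    also have "\<dots> \<le> ?n * (2 * ((C * N xs) ^ k * N [1]) / A)"
      using upN[of k] const by (intro mult_left_mono divide_right_mono) auto
    also have "\<dots> = 2 * N [1] / A * (real k * real L + 1) * (C * N xs) ^ k"
      by (simp add: algebra_simps)
    finally show "(power_sum (1 / \<alpha>) xs powr \<alpha>) ^ k * 1 \<le> 2 * N [1] / A * (real k * real L + 1) * (C * N xs) ^ k"
      by simp
  qed simp
qed

end

section \<open>Consequences of reflexivity\<close>

lemma dual_spaceI:
  assumes "\<And>f. f \<notin> elts W \<Longrightarrow> \<phi> f = 0"
    and "\<And>f g. f \<in> elts W \<Longrightarrow> g \<in> elts W \<Longrightarrow> \<phi> (\<lambda>t. f t + g t) = \<phi> f + \<phi> g"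
    and "\<And>f c. f \<in> elts W \<Longrightarrow> \<phi> (\<lambda>t. c * f t) = c * \<phi> f"
    and "\<And>f. f \<in> elts W \<Longrightarrow> \<bar>\<phi> f\<bar> \<le> C * nrm W f"
  shows "\<phi> \<in> elts (dual_space W)"
proof -
  have "\<exists>C. \<forall>f\<in>elts W. \<bar>\<phi> f\<bar> \<le> C * nrm W f" using assms(4) by blast
  then show ?thesis using assms(1-3) by (simp add: dual_space_def)
qed

lemma dual_spaceD:
  assumes "\<phi> \<in> elts (dual_space W)"
  shows "f \<notin> elts W \<Longrightarrow> \<phi> f = 0"
    and "f \<in> elts W \<Longrightarrow> g \<in> elts W \<Longrightarrow> \<phi> (\<lambda>t. f t + g t) = \<phi> f + \<phi> g"
    and "f \<in> elts W \<Longrightarrow> \<phi> (\<lambda>t. c * f t) = c * \<phi> f"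
    and "\<exists>C. \<forall>f\<in>elts W. \<bar>\<phi> f\<bar> \<le> C * nrm W f"
  using assms by (simp_all add: dual_space_def)

text \<open>
  By Tychonoff's theorem the bounded sequence of functionals has a pointwise cluster point.  The
  algebraic identities and the bound define closed conditions, so they pass to it, and so does every
  value that is eventually constant.
\<close>

lemma cluster_functional:
  fixes W :: "'a normed_lattice" and \<psi> :: "nat \<Rightarrow> ('a \<Rightarrow> real) \<Rightarrow> real"
  assumes \<psi>: "\<And>n. \<psi> n \<in> elts (dual_space W)"
    and bound: "\<And>n f. f \<in> elts W \<Longrightarrow> \<bar>\<psi> n f\<bar> \<le> B * nrm W f"
  shows "\<exists>\<phi>\<in>elts (dual_space W). \<forall>f r. (\<forall>\<^sub>F n in sequentially. \<psi> n f = r) \<longrightarrow> \<phi> f = r"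
proof -
  define S where "S f = (if f \<in> elts W then {- (B * nrm W f)..B * nrm W f} else {0})" for f
  have off: "\<psi> n f = 0" if "f \<notin> elts W" for n f using \<psi>[of n] that by (simp add: dual_space_def)
  have "compactin (product_topology (\<lambda>_. euclidean) UNIV) (PiE UNIV S)"
    unfolding compactin_PiE by (auto simp: S_def)
  then have comp: "compact (PiE UNIV S)" by (simp add: euclidean_product_topology)
  have "\<psi> n f \<in> S f" for n f
    using bound[of f n] off[of f n] by (auto simp: S_def abs_le_iff)
  then have "eventually (\<lambda>q. q \<in> PiE UNIV S) (filtermap \<psi> sequentially)"
    by (simp add: eventually_filtermap PiE_UNIV_domain Pi_def)
  moreover have "filtermap \<psi> sequentially \<noteq> bot" by (simp add: filtermap_bot_iff)
  ultimately obtain \<phi> where \<phi>: "inf (nhds \<phi>) (filtermap \<psi> sequentially) \<noteq> bot"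
    using comp[unfolded compact_filter] by blast
  have closed: "\<phi> \<in> Z" if "closed Z" "eventually (\<lambda>n. \<psi> n \<in> Z) sequentially" for Z
  proof (rule ccontr)
    assume "\<phi> \<notin> Z"
    then have "eventually (\<lambda>q. q \<in> - Z) (nhds \<phi>)" using that(1) by (intro eventually_nhds_in_open) auto
    moreover have "eventually (\<lambda>q. q \<in> Z) (filtermap \<psi> sequentially)" using that(2) by (simp add: eventually_filtermap)
    ultimately have "eventually (\<lambda>_. False) (inf (nhds \<phi>) (filtermap \<psi> sequentially))"
      unfolding eventually_inf by (intro exI[of _ "\<lambda>q. q \<in> - Z"] exI[of _ "\<lambda>q. q \<in> Z"]) auto
    then show False using \<phi> by (simp add: eventually_False)
  qed
  note cont = continuous_on_product_coordinates
  have limit: "\<phi> f = r" if "\<forall>\<^sub>F n in sequentially. \<psi> n f = r" for f r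
    using closed[of "{q. q f = r}"] that by (simp add: closed_Collect_eq)
  have "\<phi> (\<lambda>t. f t + g t) = \<phi> f + \<phi> g" if "f \<in> elts W" "g \<in> elts W" for f g
  proof -
    have "\<psi> n (\<lambda>t. f t + g t) = \<psi> n f + \<psi> n g" for n using \<psi>[of n] that by (simp add: dual_space_def)
    moreover have "closed {q. q (\<lambda>t. f t + g t) = q f + (q g :: real)}"
      by (intro closed_Collect_eq continuous_on_add cont)
    ultimately show ?thesis using closed[of "{q. q (\<lambda>t. f t + g t) = q f + q g}"] by simp
  qed
  moreover have "\<phi> (\<lambda>t. c * f t) = c * \<phi> f" if "f \<in> elts W" for f c
  proof -
    have "\<psi> n (\<lambda>t. c * f t) = c * \<psi> n f" for n using \<psi>[of n] that by (simp add: dual_space_def)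
    moreover have "closed {q. q (\<lambda>t. c * f t) = c * (q f :: real)}"
      by (intro closed_Collect_eq continuous_on_mult_left cont)
    ultimately show ?thesis using closed[of "{q. q (\<lambda>t. c * f t) = c * q f}"] by simp
  qed
  moreover have "\<bar>\<phi> f\<bar> \<le> B * nrm W f" if "f \<in> elts W" for f
  proof -
    have "closed {q. \<bar>q f :: real\<bar> \<le> B * nrm W f}"
      by (intro closed_Collect_le continuous_on_rabs cont continuous_on_const)
    then show ?thesis using closed[of "{q. \<bar>q f\<bar> \<le> B * nrm W f}"] bound[OF that] by simp
  qed
  moreover have "\<phi> f = 0" if "f \<notin> elts W" for f using limit[of f 0] off[OF that] by simp
  ultimately have "\<phi> \<in> elts (dual_space W)" by (intro dual_spaceI[where C=B])
  then show ?thesis using limit by blast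
qed

context rearrangement_invariant
begin

lemma dual_bound:
  assumes \<phi>: "\<phi> \<in> elts (dual_space X)" and f: "f \<in> elts X"
  shows "\<bar>\<phi> f\<bar> \<le> nrm (dual_space X) \<phi> * nrm X f"
proof -
  obtain C where C: "\<And>g. g \<in> elts X \<Longrightarrow> \<bar>\<phi> g\<bar> \<le> C * nrm X g"
    using dual_spaceD(4)[OF \<phi>] by blast
  have hom: "\<phi> (\<lambda>t. c * f t) = c * \<phi> f" for c using \<phi> f by (simp add: dual_space_def)
  show ?thesis
  proof (cases "nrm X f = 0")
    case True then show ?thesis using C[OF f] by simp
  next
    case False
    then have pos: "0 < nrm X f" using nonnegX[OF f] by simp
    let ?S = "{f\<in>elts X. nrm X f \<le> 1}"
    let ?g = "\<lambda>t. (1 / nrm X f) * f t"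
    have g: "?g \<in> ?S" using scaleX[OF f, of "1 / nrm X f"] nrmX_scale[OF f, of "1 / nrm X f"] pos by auto
    have "bdd_above ((\<lambda>f. \<bar>\<phi> f\<bar>) ` ?S)"
    proof (rule bdd_aboveI)
      fix z assume "z \<in> (\<lambda>f. \<bar>\<phi> f\<bar>) ` ?S"
      then obtain h where h: "h \<in> elts X" "nrm X h \<le> 1" "z = \<bar>\<phi> h\<bar>" by auto
      have "z \<le> C * nrm X h" using C[OF h(1)] h(3) by simp
      also have "\<dots> \<le> \<bar>C\<bar> * 1" using h nonnegX[OF h(1)] by (intro mult_mono) auto
      finally show "z \<le> \<bar>C\<bar>" by simp
    qed
    then have "\<bar>\<phi> ?g\<bar> \<le> (SUP f\<in>?S. \<bar>\<phi> f\<bar>)" by (intro cSUP_upper g)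
    then have "\<bar>\<phi> ?g\<bar> \<le> nrm (dual_space X) \<phi>" by (simp add: dual_space_def)
    then show ?thesis unfolding hom using pos by (simp add: abs_mult field_simps)
  qed
qed

text \<open>
  Apply \<open>cluster_functional\<close> to the evaluations at the points \<open>x n\<close>; the cluster point belongs to the bidual,
  so by reflexivity it is the evaluation at an element of the space.
\<close>

lemma reflexive_cluster_point:
  assumes refl: "reflexive X" and x: "\<And>n. x n \<in> elts X" "\<And>n. nrm X (x n) \<le> B"
  shows "\<exists>f\<in>elts X. \<forall>\<phi>\<in>elts (dual_space X). \<forall>r. (\<forall>\<^sub>F n in sequentially. \<phi> (x n) = r) \<longrightarrow> \<phi> f = r"
proof -
  define \<psi> where "\<psi> n \<phi> = (if \<phi> \<in> elts (dual_space X) then \<phi> (x n) else 0)" for n \<phi>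
  have B: "0 \<le> B" using x nonnegX order_trans by blast
  have bound: "\<bar>\<psi> n \<phi>\<bar> \<le> B * nrm (dual_space X) \<phi>" if \<phi>: "\<phi> \<in> elts (dual_space X)" for n \<phi>
  proof -
    have n0: "0 \<le> nrm (dual_space X) \<phi>"
      using dual_bound[OF \<phi> chiX[of 1]] nrm_chi_pos[of 1] by (smt (verit) mult_neg_pos)
    have "\<bar>\<psi> n \<phi>\<bar> \<le> nrm (dual_space X) \<phi> * nrm X (x n)" using dual_bound[OF \<phi> x(1)] \<phi> by (simp add: \<psi>_def)
    also have "\<dots> \<le> nrm (dual_space X) \<phi> * B" using x(2) n0 by (intro mult_left_mono)
    finally show ?thesis by (simp add: mult.commute)
  qed
  have add: "(\<lambda>f. \<phi> f + \<phi>' f) \<in> elts (dual_space X)" if "\<phi> \<in> elts (dual_space X)" "\<phi>' \<in> elts (dual_space X)" for \<phi> \<phi>'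
  proof -
    have "\<bar>\<phi> f + \<phi>' f\<bar> \<le> (nrm (dual_space X) \<phi> + nrm (dual_space X) \<phi>') * nrm X f" if "f \<in> elts X" for f
      using dual_bound[OF \<open>\<phi> \<in> _\<close> that] dual_bound[OF \<open>\<phi>' \<in> _\<close> that] by (simp add: distrib_right)
    then show ?thesis using dual_spaceD(1-3)[OF that(1)] dual_spaceD(1-3)[OF that(2)]
      by (intro dual_spaceI[where C="nrm (dual_space X) \<phi> + nrm (dual_space X) \<phi>'"]) (simp_all add: distrib_left)
  qed
  have scale: "(\<lambda>f. c * \<phi> f) \<in> elts (dual_space X)" if "\<phi> \<in> elts (dual_space X)" for \<phi> c
  proof -
    have "\<bar>c * \<phi> f\<bar> \<le> (\<bar>c\<bar> * nrm (dual_space X) \<phi>) * nrm X f" if "f \<in> elts X" for f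
      using mult_left_mono[OF dual_bound[OF \<open>\<phi> \<in> _\<close> that], of "\<bar>c\<bar>"] by (simp add: abs_mult mult.assoc)
    then show ?thesis using dual_spaceD(1-3)[OF that]
      by (intro dual_spaceI[where C="\<bar>c\<bar> * nrm (dual_space X) \<phi>"]) (simp_all add: distrib_left)
  qed
  have "\<psi> n \<in> elts (dual_space (dual_space X))" for n
  proof -
    show ?thesis by (rule dual_spaceI[where C=B]) (use add scale bound in \<open>auto simp: \<psi>_def\<close>)
  qed
  then have "\<exists>\<Phi>\<in>elts (dual_space (dual_space X)). \<forall>\<phi> r. (\<forall>\<^sub>F n in sequentially. \<psi> n \<phi> = r) \<longrightarrow> \<Phi> \<phi> = r"
    by (rule cluster_functional[where B=B]) (rule bound)
  then obtain \<Phi> where \<Phi>: "\<Phi> \<in> elts (dual_space (dual_space X))" "\<And>\<phi> r. (\<forall>\<^sub>F n in sequentially. \<psi> n \<phi> = r) \<Longrightarrow> \<Phi> \<phi> = r"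
    by blast
  obtain f where f: "f \<in> elts X" "\<And>\<phi>. \<phi> \<in> elts (dual_space X) \<Longrightarrow> \<Phi> \<phi> = \<phi> f"
    using refl \<Phi>(1) unfolding reflexive_def by blast
  have "\<phi> f = r" if "\<phi> \<in> elts (dual_space X)" "\<forall>\<^sub>F n in sequentially. \<phi> (x n) = r" for \<phi> r
    using \<Phi>(2)[of \<phi> r] f(2)[OF that(1)] that by (simp add: \<psi>_def)
  then show ?thesis using f(1) by blast
qed

lemma steps_single: "steps t [y] = tensor (unit 0) (\<lambda>x. y * chi t x)"
  by (auto simp: steps_def tensor_def entries_def unit_def fun_eq_iff)

lemma nrm_steps_single: "0 < t \<Longrightarrow> nrm X (steps t [1]) = nrm X (chi t)"
  using tensor_unitX(2)[OF chiX, of t 0] by (simp add: steps_single)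

lemma enorm_chi:
  assumes t: "0 < t"
  shows "koethe_enorm X (chi t) \<le> ennreal (t / nrm X (chi t))"
proof -
  obtain ys where ys: "\<forall>y\<in>set ys. 0 \<le> y" "length ys = 1" "koethe_enorm X (steps t ys) \<le> 1"
    "nrm X (steps t [1]) \<le> t * (\<Sum>i<1. [1] ! i * ys ! i)"
    using norming[of "[1]" t] t by auto
  then obtain y where y: "ys = [y]" by (auto simp: length_Suc_conv)
  have le: "nrm X (chi t) \<le> t * y" using ys(4) nrm_steps_single[OF t] by (simp add: y)
  have phi: "0 < nrm X (chi t)" by (rule nrm_chi_pos[OF t])
  have y0: "0 < y" using le phi t by (smt (verit) mult_nonneg_nonpos)
  have "koethe_enorm X (steps t ys) = ennreal y * koethe_enorm X (chi t)"
    using y0 enorm_tensor_unit[of "\<lambda>x. y * chi t x" 0] enorm_scale[of "chi t" y] by (simp add: y steps_single)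
  then have 1: "ennreal y * koethe_enorm X (chi t) \<le> 1" using ys(3) by simp
  have "koethe_enorm X (chi t) = ennreal (1 / y) * (ennreal y * koethe_enorm X (chi t))"
    using y0 by (simp add: mult.assoc[symmetric] ennreal_mult[symmetric])
  also have "\<dots> \<le> ennreal (1 / y) * 1" using 1 by (intro mult_left_mono) auto
  also have "\<dots> \<le> ennreal (t / nrm X (chi t))"
    using le y0 phi t by (subst mult_1_right, intro ennreal_leI) (simp add: field_simps)
  finally show ?thesis .
qed

lemma chiK: "0 < t \<Longrightarrow> chi t \<in> elts (koethe_dual X)"
  using enorm_chi[of t] by (auto simp: koethe_iff intro: le_less_trans)

lemma integral_unit_chi: "integrable \<mu> (tensor (unit k) (chi 1))" "(\<integral>x. tensor (unit k) (chi 1) x \<partial>\<mu>) = 1"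
proof -
  have nn: "0 \<le> tensor (unit k) (chi 1) x" for x by (simp add: tensor_def unit_def chi_def)
  have "(\<integral>\<^sup>+x. ennreal (tensor (unit k) (chi 1) x) \<partial>\<mu>) = (\<integral>\<^sup>+x. ennreal \<bar>1 * tensor (unit k) (chi 1) x\<bar> \<partial>\<mu>)"
    using nn by simp
  also have "\<dots> = (\<Sum>n. ennreal \<bar>unit k n\<bar> * (\<integral>\<^sup>+y. ennreal \<bar>1 * chi 1 y\<bar> \<partial>\<mu>))"
    by (rule nn_integral_tensor) measurable
  also have "(\<integral>\<^sup>+y. ennreal \<bar>1 * chi 1 y\<bar> \<partial>\<mu>) = 1"
  proof -
    have "(\<lambda>y. \<bar>1 * chi 1 y\<bar>) = (\<lambda>y. \<bar>chi 1 y * chi 1 y\<bar>)" by (auto simp: chi_def indicator_def)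
    then have "(\<integral>\<^sup>+y. ennreal \<bar>1 * chi 1 y\<bar> \<partial>\<mu>) = (\<integral>\<^sup>+y. ennreal \<bar>chi 1 y * chi 1 y\<bar> \<partial>\<mu>)" by metis
    then show ?thesis using nn_integral_chi[of 1] by simp
  qed
  also have "(\<Sum>n. ennreal \<bar>unit k n\<bar> * 1) = (\<Sum>n. if n = k then 1 else 0)"
    by (intro suminf_cong) (auto simp: unit_def)
  also have "\<dots> = 1" using sums_single[of k "\<lambda>_. 1::ennreal"] by (simp add: sums_iff)
  finally have 1: "(\<integral>\<^sup>+x. ennreal (tensor (unit k) (chi 1) x) \<partial>\<mu>) = 1" .
  have m: "tensor (unit k) (chi 1) \<in> borel_measurable \<mu>" by (intro measurable_tensor measurable_chi)
  show i: "integrable \<mu> (tensor (unit k) (chi 1))"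
    using 1 nn m by (intro integrableI_bounded) auto
  show "(\<integral>x. tensor (unit k) (chi 1) x \<partial>\<mu>) = 1"
    using 1 nn m by (subst integral_eq_nn_integral) auto
qed

lemma unit_chi_support:
  assumes "0 < x" "tensor (unit k) (chi 1) x \<noteq> 0"
  shows "real k < x" "x \<le> real (prod_encode (k, 0)) + 1"
proof -
  have k: "copy_no x = k" "0 < copy_pos x" "copy_pos x \<le> 1"
    using assms by (auto simp: tensor_def unit_def chi_def indicator_def split: if_splits)
  then have "x = real (prod_encode (k, 0)) + copy_pos x"
    using place_copy[OF assms(1)] place_add[of "copy_pos x" k 0] by simp
  moreover have "k \<le> prod_encode (k, 0)" by (rule le_prod_encode_1)
  ultimately show "real k < x" "x \<le> real (prod_encode (k, 0)) + 1" using k by linarith+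
qed

text \<open>
  Otherwise the indicators of \<open>(0, n]\<close> have a weak cluster point \<open>f\<close>, whose integral over the first cell of
  every copy is \<open>1\<close>.  The functionals \<open>pairing X (h k)\<close>, integration over the first cell of copy \<open>k\<close>, have
  a cluster point \<open>\<psi>\<close> with \<open>\<psi> f = 1\<close>.  But \<open>\<psi>\<close> vanishes on every function with bounded support, in
  particular on the indicators, and hence on \<open>f\<close>.
\<close>

lemma fundamental_function_unbounded:
  assumes refl: "reflexive X"
  shows "\<exists>n>0. B < nrm X (chi (real n))"
proof (rule ccontr)
  assume "\<not> ?thesis"
  then have B: "nrm X (chi (real (Suc n))) \<le> B" for n by (metis not_less zero_less_Suc)
  define h where "h k = tensor (unit k) (chi 1)" for k
  have hK: "h k \<in> elts (koethe_dual X)" "nrm (koethe_dual X) (h k) = nrm (koethe_dual X) (chi 1)" for k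
    using chiK[of 1] enorm_tensor_unit[of "chi 1" k] unfolding h_def by (auto simp: koethe_iff nrm_koethe)
  have pb: "\<bar>pairing X (h k) f\<bar> \<le> nrm (koethe_dual X) (chi 1) * nrm X f" if "f \<in> elts X" for k f
    using pairing_bound[OF that hK(1), of k] by (simp add: hK(2) mult.commute)
  obtain \<psi> where \<psi>: "\<psi> \<in> elts (dual_space X)" "\<And>f r. (\<forall>\<^sub>F k in sequentially. pairing X (h k) f = r) \<Longrightarrow> \<psi> f = r"
    using cluster_functional[of "\<lambda>k. pairing X (h k)" X, OF pairing_in_dual[OF hK(1)] pb] by blast
  obtain f where f: "f \<in> elts X" "\<And>\<phi> r. \<phi> \<in> elts (dual_space X) \<Longrightarrow>
      (\<forall>\<^sub>F n in sequentially. \<phi> (chi (real (Suc n))) = r) \<Longrightarrow> \<phi> f = r"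
    using reflexive_cluster_point[OF refl, of "\<lambda>n. chi (real (Suc n))" B] chiX B by auto
  have "pairing X (h k) f = 1" for k
  proof (rule f(2)[OF pairing_in_dual[OF hK(1)]])
    have "pairing X (h k) (chi (real (Suc n))) = 1" if n: "prod_encode (k, 0) \<le> n" for n
    proof -
      have "pairing X (h k) (chi (real (Suc n))) = (\<integral>x. chi (real (Suc n)) x * h k x \<partial>\<mu>)"
        using chiX by (simp add: pairing_def)
      also have "\<dots> = (\<integral>x. h k x \<partial>\<mu>)"
      proof (rule Bochner_Integration.integral_cong[OF HOL.refl])
        fix x assume "x \<in> space \<mu>"
        then show "chi (real (Suc n)) x * h k x = h k x"
          using unit_chi_support(2)[of x k] n by (cases "h k x = 0") (auto simp: h_def chi_def)
      qed
      finally show ?thesis using integral_unit_chi(2)[of k] by (simp add: h_def)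
    qed
    then show "\<forall>\<^sub>F n in sequentially. pairing X (h k) (chi (real (Suc n))) = 1"
      by (rule eventually_sequentiallyI)
  qed
  then have "\<psi> f = 1" by (intro \<psi>(2)) simp
  moreover have "\<psi> (chi (real (Suc n))) = 0" for n
  proof (rule \<psi>(2))
    have "pairing X (h k) (chi (real (Suc n))) = 0" if k: "Suc n \<le> k" for k
    proof -
      have "pairing X (h k) (chi (real (Suc n))) = (\<integral>x. chi (real (Suc n)) x * h k x \<partial>\<mu>)"
        using chiX by (simp add: pairing_def)
      also have "\<dots> = (\<integral>x. 0 \<partial>\<mu>)"
      proof (rule Bochner_Integration.integral_cong[OF HOL.refl])
        fix x assume "x \<in> space \<mu>"
        then show "chi (real (Suc n)) x * h k x = 0"
          using unit_chi_support(1)[of x k] k by (cases "h k x = 0") (auto simp: h_def chi_def)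
      qed
      finally show ?thesis by simp
    qed
    then show "\<forall>\<^sub>F k in sequentially. pairing X (h k) (chi (real (Suc n))) = 0"
      by (rule eventually_sequentiallyI)
  qed
  then have "\<psi> f = 0" by (intro f(2)[OF \<psi>(1)]) simp
  ultimately show False by simp
qed

text \<open>
  Otherwise \<open>enorm_chi\<close> bounds the integrals over all of \<open>(0, n]\<close> uniformly, so integration over the whole half-line is
  a bounded functional.  The unit functions \<open>e n\<close> on the first cells of the copies have a weak
  cluster point \<open>f\<close> with integral \<open>1\<close>, whereas the integral of \<open>f\<close> over any finite number of copies is \<open>0\<close>.
\<close>

lemma dual_fundamental_function_unbounded:
  assumes refl: "reflexive X"
  shows "\<exists>n>0. B < real n / nrm X (chi (real n))"
proof (rule ccontr)
  assume "\<not> ?thesis"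
  then have B: "real (Suc n) / nrm X (chi (real (Suc n))) \<le> B" for n by (metis not_less zero_less_Suc)
  have one: "(\<lambda>_. 1) \<in> elts (koethe_dual X)"
  proof -
    have "koethe_enorm X (\<lambda>_. 1) \<le> ennreal B"
      unfolding koethe_enorm_def
    proof (rule SUP_least)
      fix f assume f: "f \<in> {g \<in> elts X. nrm X g \<le> 1}"
      then have fX: "f \<in> elts X" by simp
      have "(\<integral>\<^sup>+x. ennreal \<bar>f x\<bar> \<partial>\<mu>) \<le> ennreal B"
      proof (rule nn_integral_le_by_simple[OF measX[OF fX], where H="\<lambda>_ s. s"])
        fix u n assume u: "simple_function \<mu> u" "\<And>x. 0 \<le> u x" "\<And>x. u x \<le> \<bar>f x\<bar>" "\<And>x. real n < x \<Longrightarrow> u x = 0"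
        have uX: "u \<in> elts X \<and> nrm X u \<le> nrm X f"
          using u by (intro idealX borel_measurable_simple_function fX AE_I2) simp_all
        have "(\<integral>\<^sup>+x. ennreal (u x) \<partial>\<mu>) = (\<integral>\<^sup>+x. ennreal \<bar>chi (real (Suc n)) x * u x\<bar> \<partial>\<mu>)"
          using u(2,4) by (intro nn_integral_cong) (auto simp: chi_def indicator_def)
        also have "\<dots> \<le> koethe_enorm X (chi (real (Suc n)))"
          unfolding koethe_enorm_def using f uX by (intro SUP_upper) auto
        also have "\<dots> \<le> ennreal B" using order_trans[OF enorm_chi ennreal_leI[OF B]] by simp
        finally show "(\<integral>\<^sup>+x. ennreal (u x) \<partial>\<mu>) \<le> ennreal B" .
      qed auto
      then show "(\<integral>\<^sup>+x. ennreal \<bar>1 * f x\<bar> \<partial>\<mu>) \<le> ennreal B" by simp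
    qed
    then show ?thesis by (auto simp: koethe_iff intro: le_less_trans)
  qed
  define g where "g m x = (if copy_no x < m then 1 else 0 :: real)" for m x
  have gm: "g m \<in> borel_measurable \<mu>" for m
  proof -
    have [measurable]: "Measurable.pred \<mu> (\<lambda>x. copy_no x < m)"
      by (rule measurable_compose[OF measurable_copy_no]) simp
    show ?thesis unfolding g_def[abs_def] by measurable
  qed
  have gK: "g m \<in> elts (koethe_dual X)" for m
    by (rule K.ideal[THEN conjunct1, OF gm one]) (simp add: g_def)
  define e where "e n = tensor (unit n) (chi 1)" for n
  have e: "e n \<in> elts X" "nrm X (e n) \<le> nrm X (chi 1)" for n
    using tensor_unitX[OF chiX[of 1], of n] by (auto simp: e_def)
  obtain f where f: "f \<in> elts X" "\<And>\<phi> r. \<phi> \<in> elts (dual_space X) \<Longrightarrow>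
      (\<forall>\<^sub>F n in sequentially. \<phi> (e n) = r) \<Longrightarrow> \<phi> f = r"
    using reflexive_cluster_point[OF refl, of e "nrm X (chi 1)", OF e] by blast
  have "pairing X (\<lambda>_. 1) f = 1"
    using integral_unit_chi(2) e by (intro f(2) pairing_in_dual one) (simp add: pairing_def e_def)
  then have int1: "(\<integral>x. f x \<partial>\<mu>) = 1" using f(1) by (simp add: pairing_def)
  have intf: "integrable \<mu> f" using integrable_pair(1)[OF f(1) one] by simp
  have "pairing X (g m) f = 0" for m
  proof (rule f(2)[OF pairing_in_dual[OF gK]])
    have "pairing X (g m) (e n) = 0" if "m \<le> n" for n
    proof -
      have "(\<lambda>x. e n x * g m x) = (\<lambda>x. 0)" using that by (auto simp: e_def g_def tensor_def unit_def fun_eq_iff)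
      then show ?thesis by (simp only: pairing_def) simp
    qed
    then show "\<forall>\<^sub>F n in sequentially. pairing X (g m) (e n) = 0" by (rule eventually_sequentiallyI)
  qed
  then have zero: "(\<integral>x. f x * g m x \<partial>\<mu>) = 0" for m using f(1) by (simp add: pairing_def)
  have "(\<lambda>m. \<integral>x. f x * g m x \<partial>\<mu>) \<longlonglongrightarrow> (\<integral>x. f x \<partial>\<mu>)"
  proof (rule integral_dominated_convergence[where w="\<lambda>x. \<bar>f x\<bar>"])
    show "AE x in \<mu>. (\<lambda>m. f x * g m x) \<longlonglongrightarrow> f x"
    proof (rule AE_I2)
      fix x
      show "(\<lambda>m. f x * g m x) \<longlonglongrightarrow> f x"
        by (rule tendsto_eventually, rule eventually_sequentiallyI[of "Suc (copy_no x)"]) (simp add: g_def)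
    qed
    show "(\<lambda>x. f x * g m x) \<in> borel_measurable \<mu>" for m using measX[OF f(1)] gm by (intro borel_measurable_times)
  qed (use intf measX[OF f(1)] in \<open>auto simp: g_def\<close>)
  then have "(\<lambda>m. 0) \<longlonglongrightarrow> (1::real)" by (simp only: zero int1)
  then show False by (simp add: LIMSEQ_const_iff)
qed

end

section \<open>Identification of the space\<close>

lemma lprod_replicate: "lprod (replicate m 1) (replicate n 1) = replicate (m * n) 1"
proof (induction m)
  case (Suc m)
  then have "concat (map (\<lambda>x. map ((*) x) (replicate n 1)) (replicate m 1)) = replicate (m * n) (1::real)"
    by (simp only: lprod_def)
  then show ?case by (simp add: lprod_def replicate_add map_replicate)
qed (simp add: lprod_def)

lemma exists_list_with_counts:
  assumes V: "finite (V :: real set)"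
  shows "\<exists>xs. set xs \<subseteq> V \<and> (\<forall>v\<in>V. count_list xs v = m v) \<and> (\<forall>p. power_sum p xs = (\<Sum>v\<in>V. real (m v) * v powr p))"
  using V
proof (induction V)
  case (insert w V)
  then obtain xs where xs: "set xs \<subseteq> V" "\<forall>v\<in>V. count_list xs v = m v" "\<forall>p. power_sum p xs = (\<Sum>v\<in>V. real (m v) * v powr p)" by blast
  have "count_list xs w = 0" using xs(1) insert(2) by (intro count_notin) auto
  then show ?case
    using xs insert(1,2) by (intro exI[of _ "replicate (m w) w @ xs"])
      (auto simp: count_list_replicate power_sum_def sum_list_replicate)
qed (auto simp: power_sum_def)

context rearrangement_invariant
begin

lemma steps_pointwise_mono:
  assumes t: "0 < t" and le: "\<And>n. \<bar>entries xs n\<bar> \<le> \<bar>entries ys n\<bar>"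
  shows "nrm X (steps t xs) \<le> nrm X (steps t ys)"
proof (rule idealX[THEN conjunct2, OF measurable_steps stepsX[OF t]], rule AE_I2)
  show "\<bar>steps t xs x\<bar> \<le> \<bar>steps t ys x\<bar>" for x
    using le[of "copy_no x"] by (simp add: steps_def tensor_def abs_mult mult_right_mono)
qed

text \<open>
  The upper bound is \<open>uniform_copiesX\<close>.  For the lower bound, choose norming step functions for both factors;
  their tensor product is bounded in the Koethe dual by \<open>uniform_copiesK\<close>, and it pairs with the
  tensor product of the factors to the product of the two norms.
\<close>

lemma steps_tensor_bounds:
  assumes DH: "disjointly_homogeneous X" "disjointly_homogeneous (dual_space X)"
  shows "\<exists>c C. 0 < c \<and> 0 < C \<and> (\<forall>xs ys t. (\<forall>x\<in>set xs. 0 \<le> x) \<longrightarrow> (\<forall>y\<in>set ys. 0 \<le> y) \<longrightarrow> 0 < t \<longrightarrow>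
    c * nrm X (steps 1 xs) * nrm X (steps t ys) \<le> nrm X (steps t (lprod xs ys)) \<and>
    nrm X (steps t (lprod xs ys)) \<le> C * nrm X (steps 1 xs) * nrm X (steps t ys))"
proof -
  obtain C where C: "0 < C" "\<And>f a. f \<in> elts X \<Longrightarrow> finite {n. a n \<noteq> 0} \<Longrightarrow>
      nrm X (tensor a f) \<le> C * nrm X (tensor a (chi 1)) * nrm X f"
    using uniform_copiesX[OF DH(1)] by blast
  obtain D where D: "0 < D" "\<And>f a. f \<in> elts (koethe_dual X) \<Longrightarrow> finite {n. a n \<noteq> 0} \<Longrightarrow>
      nrm (koethe_dual X) (tensor a f) \<le> D * nrm (koethe_dual X) (tensor a (chi 1)) * nrm (koethe_dual X) f"
    using uniform_copiesK[OF DH(2) chiK[of 1]] by auto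
  have "(1 / D) * nrm X (steps 1 xs) * nrm X (steps t ys) \<le> nrm X (steps t (lprod xs ys)) \<and>
      nrm X (steps t (lprod xs ys)) \<le> C * nrm X (steps 1 xs) * nrm X (steps t ys)"
    if xs: "\<forall>x\<in>set xs. 0 \<le> x" and ys: "\<forall>y\<in>set ys. 0 \<le> y" and t: "0 < t" for xs ys t
  proof
    have eq: "nrm X (tensor (entries xs) (steps t ys)) = nrm X (steps t (lprod xs ys))"
      using xs ys t by (intro nrm_tensor_steps) auto
    show "nrm X (steps t (lprod xs ys)) \<le> C * nrm X (steps 1 xs) * nrm X (steps t ys)"
      using C(2)[OF stepsX[OF t], of "entries xs" ys] by (simp add: eq steps_def[of 1])
    obtain xs' where xs': "\<forall>x\<in>set xs'. 0 \<le> x" "length xs' = length xs" "koethe_enorm X (steps 1 xs') \<le> 1"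
      "nrm X (steps 1 xs) \<le> 1 * (\<Sum>i<length xs. xs ! i * xs' ! i)" using norming[of xs 1] xs by auto
    obtain ys' where ys': "\<forall>y\<in>set ys'. 0 \<le> y" "length ys' = length ys" "koethe_enorm X (steps t ys') \<le> 1"
      "nrm X (steps t ys) \<le> t * (\<Sum>i<length ys. ys ! i * ys' ! i)" using norming[of ys t] ys t by auto
    have K: "steps s zs \<in> elts (koethe_dual X) \<and> nrm (koethe_dual X) (steps s zs) \<le> 1"
      if "koethe_enorm X (steps s zs) \<le> 1" for s zs
    proof
      show k: "steps s zs \<in> elts (koethe_dual X)" using that by (auto simp: koethe_iff intro: le_less_trans)
      show "nrm (koethe_dual X) (steps s zs) \<le> 1" using that unfolding enorm_eq[OF k] by (simp add: ennreal_le_1)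
    qed
    let ?F = "tensor (entries xs) (steps t ys)" and ?G = "tensor (entries xs') (steps t ys')"
    have F: "?F \<in> elts X" by (intro tensor_closedX stepsX t) simp
    have G: "?G \<in> elts (koethe_dual X)" using K[OF ys'(3)] by (intro K.tensor_closed) auto
    have nG: "nrm (koethe_dual X) ?G \<le> D"
    proof -
      have "nrm (koethe_dual X) ?G \<le> D * nrm (koethe_dual X) (tensor (entries xs') (chi 1)) * nrm (koethe_dual X) (steps t ys')"
        using K[OF ys'(3)] by (intro D(2)) auto
      also have "\<dots> \<le> D * 1 * 1"
        using K[OF ys'(3)] K[OF xs'(3)] D(1) K.nrm_nonneg
        by (intro mult_mono mult_nonneg_nonneg) (auto simp: steps_def[of 1])
      finally show ?thesis by simp
    qed
    define P where "P = (\<Sum>i<length xs. xs ! i * xs' ! i)"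
    define Q where "Q = (\<Sum>i<length ys. ys ! i * ys' ! i)"
    have P0: "0 \<le> P" unfolding P_def using xs xs'(1,2) by (intro sum_nonneg mult_nonneg_nonneg) auto
    have Q0: "0 \<le> Q" unfolding Q_def using ys ys'(1,2) by (intro sum_nonneg mult_nonneg_nonneg) auto
    have "(\<integral>\<^sup>+x. ennreal \<bar>?G x * ?F x\<bar> \<partial>\<mu>) = ennreal (P * (Q * t))"
    proof -
      have s: "(\<Sum>n. ennreal \<bar>entries bs n * entries as n\<bar>) = ennreal (\<Sum>i<length as. as ! i * bs ! i)"
        if "\<forall>x\<in>set as. 0 \<le> x" "\<forall>x\<in>set bs. 0 \<le> x" "length bs = length as" for as bs
      proof -
        have "(\<Sum>n. ennreal \<bar>entries bs n * entries as n\<bar>) = (\<Sum>n. ennreal \<bar>entries as n * entries bs n\<bar>)"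
          by (intro suminf_cong) (simp add: mult.commute)
        also have "\<dots> = ennreal (\<Sum>i<length as. as ! i * bs ! i)"
          by (rule suminf_entries_prod) (use that in auto)
        finally show ?thesis .
      qed
      have "(\<integral>\<^sup>+x. ennreal \<bar>?G x * ?F x\<bar> \<partial>\<mu>) = ennreal P * (\<integral>\<^sup>+y. ennreal \<bar>steps t ys' y * steps t ys y\<bar> \<partial>\<mu>)"
        unfolding P_def s[OF xs xs'(1,2), symmetric] by (rule nn_integral_tensor_tensor) measurable
      also have "(\<integral>\<^sup>+y. ennreal \<bar>steps t ys' y * steps t ys y\<bar> \<partial>\<mu>) = ennreal Q * (\<integral>\<^sup>+y. ennreal \<bar>chi t y * chi t y\<bar> \<partial>\<mu>)"
        unfolding Q_def s[OF ys ys'(1,2), symmetric] steps_def by (rule nn_integral_tensor_tensor) measurable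
      also have "(\<integral>\<^sup>+y. ennreal \<bar>chi t y * chi t y\<bar> \<partial>\<mu>) = ennreal t" using t by (intro nn_integral_chi) simp
      finally show ?thesis using P0 Q0 t by (simp add: ennreal_mult)
    qed
    moreover have "(\<integral>\<^sup>+x. ennreal \<bar>?G x * ?F x\<bar> \<partial>\<mu>) \<le> ennreal (nrm X ?F) * koethe_enorm X ?G"
      by (rule hoelder[OF F]) (rule K.elts_measurable[OF G])
    ultimately have "ennreal (P * (Q * t)) \<le> ennreal (nrm X ?F * nrm (koethe_dual X) ?G)"
      using nonnegX[OF F] K.nrm_nonneg[OF G] by (simp add: enorm_eq[OF G] ennreal_mult)
    then have "P * (Q * t) \<le> nrm X ?F * nrm (koethe_dual X) ?G"
      using nonnegX[OF F] K.nrm_nonneg[OF G] by (subst (asm) ennreal_le_iff) auto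
    also have "\<dots> \<le> nrm X ?F * D" using nG nonnegX[OF F] by (intro mult_left_mono)
    finally have le: "P * (Q * t) \<le> nrm X ?F * D" .
    have "nrm X (steps 1 xs) * nrm X (steps t ys) \<le> P * (Q * t)"
      using xs'(4) ys'(4) P0 nonnegX[OF stepsX[OF t]] by (intro mult_mono) (auto simp: P_def Q_def mult.commute)
    then have "nrm X (steps 1 xs) * nrm X (steps t ys) \<le> nrm X (steps t (lprod xs ys)) * D"
      using le by (simp add: eq)
    then show "(1 / D) * nrm X (steps 1 xs) * nrm X (steps t ys) \<le> nrm X (steps t (lprod xs ys))"
      using D(1) by (simp add: field_simps)
  qed
  then show ?thesis using C(1) D(1) by (intro exI[of _ "1 / D"] exI[of _ C]) auto
qed

lemma steps_scale:
  assumes t: "0 < t" and x: "0 \<le> x"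
  shows "nrm X (steps t (replicate n x)) = x * nrm X (steps t (replicate n 1))"
proof -
  have "steps t (replicate n x) = (\<lambda>s. x * steps t (replicate n 1) s)"
    by (auto simp: steps_def tensor_def entries_def fun_eq_iff)
  then show ?thesis using nrmX_scale[OF stepsX[OF t], of x] x by simp
qed

lemma steps_replicate:
  assumes t: "0 < t" and n: "0 < n"
  shows "nrm X (steps t (replicate n 1)) = nrm X (chi (real n * t))"
proof -
  have "nrm X (steps t (replicate n 1)) = nrm X (steps (real n * t) [1])"
  proof (rule antisym)
    show "nrm X (steps t (replicate n 1)) \<le> nrm X (steps (real n * t) [1])"
      using t n by (intro steps_mono) (auto simp: count_list_replicate)
    show "nrm X (steps (real n * t) [1]) \<le> nrm X (steps t (replicate n 1))"
      using t n by (intro steps_mono) (auto simp: count_list_replicate)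
  qed
  then show ?thesis using t n by (simp add: nrm_steps_single)
qed

lemma steps_filter_le:
  assumes "\<forall>x\<in>set xs. 0 < x"
  shows "nrm X (steps 1 (filter P xs)) \<le> nrm X (steps 1 xs)"
proof (rule steps_mono)
  have "count_list (filter P xs) v \<le> count_list xs v" for v by (induction xs) auto
  then show "real (count_list (filter P xs) v) * 1 \<le> real (count_list xs v) * 1" for v by simp
qed (use assms in \<open>auto simp: less_imp_le\<close>)

text \<open>
  Replacing the discarded entries by \<open>0\<close>, instead of removing them, writes the step function as a sum.
\<close>

lemma steps_filter_split:
  assumes pos: "\<forall>x\<in>set xs. 0 < x"
  shows "nrm X (steps 1 xs) \<le> nrm X (steps 1 (filter P xs)) + nrm X (steps 1 (filter (\<lambda>x. \<not> P x) xs))"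
proof -
  let ?m = "\<lambda>Q. map (\<lambda>x. if Q x then x else 0) xs"
  have "steps 1 xs = (\<lambda>s. steps 1 (?m P) s + steps 1 (?m (\<lambda>x. \<not> P x)) s)"
    by (auto simp: steps_def tensor_def entries_def fun_eq_iff)
  then have "nrm X (steps 1 xs) \<le> nrm X (steps 1 (?m P)) + nrm X (steps 1 (?m (\<lambda>x. \<not> P x)))"
    using triangleX[OF stepsX stepsX, of 1 1 "?m P" "?m (\<lambda>x. \<not> P x)"] by simp
  moreover have "nrm X (steps 1 (?m Q)) \<le> nrm X (steps 1 (filter Q xs))" for Q
  proof (rule steps_mono)
    fix v :: real assume v: "0 < v"
    have "count_list (?m Q) v = count_list (filter Q xs) v" using v by (induction xs) auto
    then show "real (count_list (?m Q) v) * 1 \<le> real (count_list (filter Q xs) v) * 1" by simp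
  qed (use pos in \<open>auto simp: less_imp_le\<close>)
  ultimately show ?thesis by (meson add_mono order_trans)
qed

text \<open>
  For steps of measure one this is the tensor power trick, with the exponent of the fundamental
  function.  For steps of measure \<open>1/K\<close>, view the step function as a tensor product with the indicator of
  \<open>(0, 1/K]\<close>, whose norm is found by writing \<open>(0, 1]\<close> as \<open>K\<close> such intervals.
\<close>

lemma steps_norm_equivalent:
  assumes DH: "disjointly_homogeneous X" "disjointly_homogeneous (dual_space X)" and refl: "reflexive X"
  shows "\<exists>\<alpha> D E. 0 < \<alpha> \<and> \<alpha> < 1 \<and> 0 < D \<and> 0 < E \<and> (\<forall>xs K. (\<forall>x\<in>set xs. 0 < x) \<longrightarrow> 0 < K \<longrightarrow>
    D * (power_sum (1 / \<alpha>) xs / real K) powr \<alpha> \<le> nrm X (steps (1 / real K) xs) \<and>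
    nrm X (steps (1 / real K) xs) \<le> E * (power_sum (1 / \<alpha>) xs / real K) powr \<alpha>)"
proof -
  obtain c C where cC: "0 < c" "0 < C" and bounds: "\<And>xs ys t. \<forall>x\<in>set xs. 0 \<le> x \<Longrightarrow> \<forall>y\<in>set ys. 0 \<le> y \<Longrightarrow> 0 < t \<Longrightarrow>
    c * nrm X (steps 1 xs) * nrm X (steps t ys) \<le> nrm X (steps t (lprod xs ys)) \<and>
    nrm X (steps t (lprod xs ys)) \<le> C * nrm X (steps 1 xs) * nrm X (steps t ys)"
    using steps_tensor_bounds[OF DH] by blast
  define u where "u n = nrm X (chi (real n))" for n
  have uN: "nrm X (steps 1 (replicate n 1)) = u n" if "0 < n" for n
    using steps_replicate[of 1 n] that by (simp add: u_def)
  have upos: "0 < u n" if "0 < n" for n using nrm_chi_pos that by (simp add: u_def)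
  have umono: "u m \<le> u n" if "0 < m" "m \<le> n" for m n
    unfolding u_def using that
    by (intro idealX[THEN conjunct2, OF measurable_chi chiX] AE_I2) (auto simp: chi_def indicator_def)
  have umult: "c * u m * u n \<le> u (m * n)" "u (m * n) \<le> C * u m * u n" if "0 < m" "0 < n" for m n
    using bounds[of "replicate m 1" "replicate n 1" 1] that by (auto simp: uN lprod_replicate)
  obtain \<alpha> A B where \<alpha>0: "0 \<le> \<alpha>" and AB: "0 < A" "0 < B"
    and fund: "\<And>n. 0 < n \<Longrightarrow> A * real n powr \<alpha> \<le> u n" "\<And>n. 0 < n \<Longrightarrow> u n \<le> B * real n powr \<alpha>"
    using quasi_multiplicative_power[of u c C, OF upos umono cC(1) umult(1) cC(2) umult(2)] by metis
  have "\<alpha> \<noteq> 0"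
  proof
    assume "\<alpha> = 0"
    obtain n where n: "0 < n" "B < u n" using fundamental_function_unbounded[OF refl, of B] by (auto simp: u_def)
    then show False using fund(2)[OF n(1)] \<open>\<alpha> = 0\<close> by simp
  qed
  then have \<alpha>: "0 < \<alpha>" using \<alpha>0 by simp
  have \<alpha>1: "\<alpha> < 1"
  proof (rule ccontr)
    assume "\<not> \<alpha> < 1"
    obtain n where n: "0 < n" "1 / A < real n / u n" using dual_fundamental_function_unbounded[OF refl, of "1 / A"] by (auto simp: u_def)
    have "real n powr 1 \<le> real n powr \<alpha>" using n(1) \<open>\<not> \<alpha> < 1\<close> by (intro powr_mono) auto
    then have "A * real n \<le> A * real n powr \<alpha>" using AB n(1) by (intro mult_left_mono) auto
    then have "A * real n \<le> u n" using fund(1)[OF n(1)] by linarith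
    then show False using n upos[OF n(1)] AB by (simp add: field_simps)
  qed
  have rep: "A * x * real n powr \<alpha> \<le> nrm X (steps 1 (replicate n x)) \<and> nrm X (steps 1 (replicate n x)) \<le> B * x * real n powr \<alpha>"
    if x: "0 < x" for n x
  proof (cases "n = 0")
    case True
    have "steps 1 [] = (\<lambda>_. 0)" by (auto simp: steps_def tensor_def entries_def)
    then show ?thesis using True nrmX_0_iff[OF zeroX] by simp
  next
    case False
    then show ?thesis
      using mult_left_mono[OF fund(1)[of n], of x] mult_left_mono[OF fund(2)[of n], of x] x
      by (simp add: steps_scale[of 1 x] uN mult_ac)
  qed
  have pw: "nrm X (steps 1 xs) \<le> nrm X (steps 1 ys)" if "length xs = length ys" "\<And>i. i < length xs \<Longrightarrow> \<bar>xs ! i\<bar> \<le> \<bar>ys ! i\<bar>" for xs ys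
    using that by (intro steps_pointwise_mono) (auto simp: entries_def)
  interpret T: tensor_power_norm "\<lambda>xs. nrm X (steps 1 xs)" c C A B \<alpha>
  proof
    show "nrm X (steps 1 (replicate (length xs) b)) \<le> nrm X (steps 1 xs)" if "0 < b" "\<forall>x\<in>set xs. b \<le> x" for xs b
      using that by (intro pw) (auto intro: order_trans[OF _ abs_ge_self])
    show "nrm X (steps 1 xs) \<le> nrm X (steps 1 (replicate (length xs) b))" if "0 < b" "\<forall>x\<in>set xs. 0 < x \<and> x \<le> b" for xs b
      using that by (intro pw) (auto simp: less_imp_le)
  qed (use cC AB \<alpha> \<alpha>1 bounds rep nonnegX[OF stepsX] steps_filter_le steps_filter_split in \<open>auto simp: less_imp_le\<close>)
  have eqv: "c * nrm X (steps 1 xs) \<le> power_sum (1 / \<alpha>) xs powr \<alpha> \<and> power_sum (1 / \<alpha>) xs powr \<alpha> \<le> C * nrm X (steps 1 xs)"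
    if "\<forall>x\<in>set xs. 0 < x" for xs
  proof (cases "xs = []")
    case True
    have "steps 1 [] = (\<lambda>_. 0)" by (auto simp: steps_def tensor_def entries_def)
    then show ?thesis using True nrmX_0_iff[OF zeroX] by (simp add: power_sum_def)
  next
    case False then show ?thesis using T.equivalent_to_power_sum[OF that False] by simp
  qed
  have level: "c * nrm X (steps 1 xs) * nrm X (chi (1 / real K)) \<le> nrm X (steps (1 / real K) xs) \<and>
      nrm X (steps (1 / real K) xs) \<le> C * nrm X (steps 1 xs) * nrm X (chi (1 / real K))"
    if "\<forall>x\<in>set xs. 0 < x" "0 < K" for xs K
  proof -
    have "lprod xs [1] = xs" by (induction xs) (auto simp: lprod_def)
    then show ?thesis using bounds[of xs "[1]" "1 / real K"] that by (auto simp: less_imp_le nrm_steps_single)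
  qed
  have unit: "c * (A * real K powr \<alpha>) * nrm X (chi (1 / real K)) \<le> u 1 \<and> u 1 \<le> C * (B * real K powr \<alpha>) * nrm X (chi (1 / real K))"
    if K: "0 < K" for K
  proof -
    have "nrm X (steps (1 / real K) (replicate K 1)) = u 1" using steps_replicate[of "1 / real K" K] K by (simp add: u_def)
    then have "c * u K * nrm X (chi (1 / real K)) \<le> u 1 \<and> u 1 \<le> C * u K * nrm X (chi (1 / real K))"
      using level[of "replicate K 1" K] K by (simp add: uN)
    moreover have "c * (A * real K powr \<alpha>) * nrm X (chi (1 / real K)) \<le> c * u K * nrm X (chi (1 / real K))"
      using fund(1)[OF K] cC nrm_chi_pos[of "1 / real K"] K by (intro mult_right_mono mult_left_mono) auto
    moreover have "C * u K * nrm X (chi (1 / real K)) \<le> C * (B * real K powr \<alpha>) * nrm X (chi (1 / real K))"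
      using fund(2)[OF K] cC nrm_chi_pos[of "1 / real K"] K by (intro mult_right_mono mult_left_mono) auto
    ultimately show ?thesis by linarith
  qed
  define D where "D = c / C * (u 1 / (C * B))"
  define E where "E = C / c * (u 1 / (c * A))"
  have "D * (power_sum (1 / \<alpha>) xs / real K) powr \<alpha> \<le> nrm X (steps (1 / real K) xs) \<and>
      nrm X (steps (1 / real K) xs) \<le> E * (power_sum (1 / \<alpha>) xs / real K) powr \<alpha>"
    if xs: "\<forall>x\<in>set xs. 0 < x" and K: "0 < K" for xs K
  proof -
    define S where "S = power_sum (1 / \<alpha>) xs powr \<alpha>"
    define k where "k = real K powr \<alpha>"
    define \<phi> where "\<phi> = nrm X (chi (1 / real K))"
    define M where "M = nrm X (steps 1 xs)"
    have k: "0 < k" using K by (simp add: k_def)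
    have \<phi>: "0 < \<phi>" using K by (simp add: \<phi>_def nrm_chi_pos)
    have M: "0 \<le> M" by (simp add: M_def nonnegX[OF stepsX])
    have Sk: "(power_sum (1 / \<alpha>) xs / real K) powr \<alpha> = S / k"
      using power_sum_nonneg by (simp add: S_def k_def powr_divide)
    have S0: "0 \<le> S" by (simp add: S_def)
    have 1: "c * M \<le> S" "S \<le> C * M" using eqv[OF xs] by (auto simp: S_def M_def)
    have 2: "c * (A * k) * \<phi> \<le> u 1" "u 1 \<le> C * (B * k) * \<phi>" using unit[OF K] by (auto simp: k_def \<phi>_def)
    have 3: "c * M * \<phi> \<le> nrm X (steps (1 / real K) xs)" "nrm X (steps (1 / real K) xs) \<le> C * M * \<phi>"
      using level[OF xs K] by (auto simp: M_def \<phi>_def)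
    have "D * (S / k) = (c / C) * S * (u 1 / (C * B * k))" by (simp add: D_def mult_ac)
    also have "\<dots> \<le> (c / C) * (C * M) * \<phi>"
    proof (intro mult_mono mult_left_mono)
      show "u 1 / (C * B * k) \<le> \<phi>" using 2(2) cC AB k by (simp add: field_simps)
    qed (use 1 cC AB k M S0 upos[of 1] in auto)
    also have "\<dots> = c * M * \<phi>" using cC by simp
    also have "\<dots> \<le> nrm X (steps (1 / real K) xs)" by (rule 3)
    finally have lo: "D * (S / k) \<le> nrm X (steps (1 / real K) xs)" .
    have "nrm X (steps (1 / real K) xs) \<le> C * M * \<phi>" by (rule 3)
    also have "\<dots> \<le> C * (S / c) * (u 1 / (c * A * k))"
    proof (intro mult_mono mult_left_mono)
      show "M \<le> S / c" using 1(1) cC by (simp add: field_simps)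
      show "\<phi> \<le> u 1 / (c * A * k)" using 2(1) cC AB k by (simp add: field_simps)
    qed (use cC S0 M \<phi> in auto)
    also have "\<dots> = E * (S / k)" by (simp add: E_def mult_ac)
    finally show ?thesis using lo unfolding Sk by simp
  qed
  moreover have "0 < D" "0 < E" using cC AB upos[of 1] by (auto simp: D_def E_def)
  ultimately show ?thesis using \<alpha> \<alpha>1 by (intro exI[of _ \<alpha>] exI[of _ D] exI[of _ E]) auto
qed

text \<open>
  Approximate the level sets of \<open>u\<close> by multiples of \<open>1/K\<close>, from above for one inequality and from below for
  the other.  The resulting step functions dominate \<open>u\<close>, respectively are dominated by \<open>u\<close>, level by level,
  and the error in the \<open>p\<close>-th power of the \<open>L\<^sub>p\<close> norm is at most \<open>c/K\<close>.
\<close>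

lemma simple_norm_equivalent:
  fixes M :: real
  assumes \<alpha>: "0 < \<alpha>" and DE: "0 < D" "0 < E"
    and equiv: "\<And>xs K. \<forall>x\<in>set xs. 0 < x \<Longrightarrow> 0 < K \<Longrightarrow>
      D * (power_sum p xs / real K) powr \<alpha> \<le> nrm X (steps (1 / real K) xs) \<and>
      nrm X (steps (1 / real K) xs) \<le> E * (power_sum p xs / real K) powr \<alpha>"
    and u: "simple_function \<mu> u" "\<And>x. 0 \<le> u x" "\<And>x. M < x \<Longrightarrow> u x = 0"
  shows "\<exists>I\<ge>0. (\<integral>\<^sup>+x. ennreal (u x powr p) \<partial>\<mu>) = ennreal I \<and> u \<in> elts X \<and>
    D * I powr \<alpha> \<le> nrm X u \<and> nrm X u \<le> E * I powr \<alpha>"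
proof -
  have um[measurable]: "u \<in> borel_measurable \<mu>" by (rule borel_measurable_simple_function[OF u(1)])
  define V where "V = {v\<in>u ` space \<mu>. 0 < v}"
  have V: "finite V" using simple_functionD(1)[OF u(1)] by (simp add: V_def)
  have Vpos: "0 < v" if "v \<in> V" for v using that by (simp add: V_def)
  have uV: "u x = 0 \<or> u x \<in> V" if "0 < x" for x using u(2)[of x] that by (auto simp: V_def)
  define B where "B v = {x\<in>space \<mu>. u x = v}" for v
  have B[measurable]: "B v \<in> sets \<mu>" for v unfolding B_def by measurable
  define \<beta> where "\<beta> v = measure \<mu> (B v)" for v
  have \<beta>0: "0 \<le> \<beta> v" for v by (simp add: \<beta>_def)
  have eB: "emeasure \<mu> (B v) = ennreal (\<beta> v)" if "v \<in> V" for v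
  proof -
    have "B v \<subseteq> {0<..M}" using Vpos[OF that] u(3) by (force simp: B_def not_less)
    then have "emeasure \<mu> (B v) \<le> emeasure \<mu> {0<..M}" by (intro emeasure_mono sets_Ioc_mu)
    also have "\<dots> \<le> emeasure \<mu> {0<..max M 0}" by (intro emeasure_mono sets_Ioc_mu) auto
    also have "\<dots> = ennreal (max M 0)" by (rule emeasure_Ioc_mu) simp
    finally show ?thesis unfolding \<beta>_def by (intro emeasure_eq_ennreal_measure) (auto simp: top_unique)
  qed
  define I where "I = (\<Sum>v\<in>V. v powr p * \<beta> v)"
  define c where "c = (\<Sum>v\<in>V. v powr p)"
  have I0: "0 \<le> I" unfolding I_def using \<beta>0 by (intro sum_nonneg mult_nonneg_nonneg) auto
  have c0: "0 \<le> c" unfolding c_def by (intro sum_nonneg) auto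
  have int: "(\<integral>\<^sup>+x. ennreal (u x powr p) \<partial>\<mu>) = ennreal I"
  proof -
    have "(\<integral>\<^sup>+x. ennreal (u x powr p) \<partial>\<mu>) = (\<integral>\<^sup>+x. (\<Sum>v\<in>V. ennreal (v powr p) * indicator (B v) x) \<partial>\<mu>)"
    proof (rule nn_integral_cong)
      fix x assume x: "x \<in> space \<mu>"
      have "(\<Sum>v\<in>V. ennreal (v powr p) * indicator (B v) x) = (\<Sum>v\<in>V. if v = u x then ennreal (v powr p) else 0)"
        using x by (intro sum.cong) (auto simp: B_def indicator_def)
      also have "\<dots> = ennreal (u x powr p)" using V uV[of x] x Vpos by (auto simp: sum.delta)
      finally show "ennreal (u x powr p) = (\<Sum>v\<in>V. ennreal (v powr p) * indicator (B v) x)" ..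
    qed
    also have "\<dots> = (\<Sum>v\<in>V. ennreal (v powr p) * emeasure \<mu> (B v))"
      by (simp add: nn_integral_sum nn_integral_cmult_indicator)
    also have "\<dots> = (\<Sum>v\<in>V. ennreal (v powr p * \<beta> v))" by (intro sum.cong) (auto simp: eB ennreal_mult \<beta>0)
    also have "\<dots> = ennreal I" unfolding I_def using \<beta>0 by (intro sum_ennreal) auto
    finally show ?thesis .
  qed
  have outer: "u \<in> elts X \<and> nrm X u \<le> E * (I + c / real K) powr \<alpha>" if K: "0 < K" for K
  proof -
    define m where "m v = nat \<lceil>\<beta> v * real K\<rceil>" for v
    have m: "\<beta> v * real K \<le> real (m v)" "real (m v) \<le> \<beta> v * real K + 1" for v
    proof -
      have "0 \<le> \<beta> v * real K" using \<beta>0 by simp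
      then have "real (m v) = \<lceil>\<beta> v * real K\<rceil>" by (simp add: m_def)
      then show "\<beta> v * real K \<le> real (m v)" "real (m v) \<le> \<beta> v * real K + 1" by linarith+
    qed
    obtain xs where xs: "set xs \<subseteq> V" "\<forall>v\<in>V. count_list xs v = m v" "\<forall>p. power_sum p xs = (\<Sum>v\<in>V. real (m v) * v powr p)"
      using exists_list_with_counts[OF V, of m] by blast
    have tK: "0 < 1 / real K" using K by simp
    have "u \<in> elts X \<and> nrm X u \<le> nrm X (steps (1 / real K) xs)"
    proof (rule level_domination[OF um stepsX[OF tK] V Vpos uV])
      fix v assume v: "v \<in> V"
      have "emeasure \<mu> {x\<in>space \<mu>. u x = v} = ennreal (\<beta> v)" using eB[OF v] by (simp only: B_def)
      also have "\<dots> \<le> ennreal (real (count_list xs v) * (1 / real K))"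
        using m(1)[of v] xs(2) v K by (intro ennreal_leI) (simp add: field_simps)
      also have "\<dots> = emeasure \<mu> {x\<in>space \<mu>. steps (1 / real K) xs x = v}"
        using Vpos[OF v] by (intro emeasure_level_steps[symmetric]) auto
      finally show "emeasure \<mu> {x\<in>space \<mu>. u x = v} \<le> emeasure \<mu> {x\<in>space \<mu>. steps (1 / real K) xs x = v}" .
    qed auto
    moreover have "nrm X (steps (1 / real K) xs) \<le> E * (power_sum p xs / real K) powr \<alpha>"
      using equiv[of xs K] xs(1) Vpos K by blast
    moreover have "E * (power_sum p xs / real K) powr \<alpha> \<le> E * (I + c / real K) powr \<alpha>"
    proof (intro mult_left_mono powr_mono2)
      have "power_sum p xs \<le> (\<Sum>v\<in>V. (\<beta> v * real K + 1) * v powr p)"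
        using xs(3) m(2) by (auto intro!: sum_mono mult_right_mono)
      also have "\<dots> = real K * I + c" by (simp add: I_def c_def sum_distrib_left sum.distrib algebra_simps)
      finally show "power_sum p xs / real K \<le> I + c / real K" using K by (simp add: field_simps)
    qed (use DE \<alpha> K power_sum_nonneg in auto)
    ultimately show ?thesis by auto
  qed
  have uX: "u \<in> elts X" using outer[of 1] by simp
  have inner: "D * (max 0 (I - c / real K)) powr \<alpha> \<le> nrm X u" if K: "0 < K" for K
  proof -
    define m where "m v = nat \<lfloor>\<beta> v * real K\<rfloor>" for v
    have m: "real (m v) \<le> \<beta> v * real K" "\<beta> v * real K - 1 \<le> real (m v)" for v
    proof -
      have "0 \<le> \<beta> v * real K" using \<beta>0 by simp
      then have "real (m v) = \<lfloor>\<beta> v * real K\<rfloor>" by (simp add: m_def)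
      then show "real (m v) \<le> \<beta> v * real K" "\<beta> v * real K - 1 \<le> real (m v)" by linarith+
    qed
    obtain xs where xs: "set xs \<subseteq> V" "\<forall>v\<in>V. count_list xs v = m v" "\<forall>p. power_sum p xs = (\<Sum>v\<in>V. real (m v) * v powr p)"
      using exists_list_with_counts[OF V, of m] by blast
    have tK: "0 < 1 / real K" using K by simp
    have "D * (max 0 (I - c / real K)) powr \<alpha> \<le> D * (power_sum p xs / real K) powr \<alpha>"
    proof (intro mult_left_mono powr_mono2)
      have "real K * I - c = (\<Sum>v\<in>V. (\<beta> v * real K - 1) * v powr p)"
        by (simp add: I_def c_def sum_distrib_left sum_subtractf algebra_simps)
      also have "\<dots> \<le> power_sum p xs" using xs(3) m(2) by (auto intro!: sum_mono mult_right_mono)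
      finally have "(real K * I - c) / real K \<le> power_sum p xs / real K" by (intro divide_right_mono) auto
      then have "I - c / real K \<le> power_sum p xs / real K" using K by (simp add: diff_divide_distrib)
      then show "max 0 (I - c / real K) \<le> power_sum p xs / real K" using power_sum_nonneg by simp
    qed (use DE \<alpha> in auto)
    also have "\<dots> \<le> nrm X (steps (1 / real K) xs)" using equiv[of xs K] xs(1) Vpos K by blast
    also have "\<dots> \<le> nrm X u"
    proof (rule steps_dominated[OF _ tK uX])
      show "0 \<le> x" if "x \<in> set xs" for x using that xs(1) Vpos by (auto simp: less_imp_le)
      fix v assume "v \<in> set xs"
      then have v: "v \<in> V" using xs(1) by auto
      have "ennreal (real (count_list xs v) * (1 / real K)) \<le> ennreal (\<beta> v)"
        using m(1)[of v] xs(2) v K by (intro ennreal_leI) (simp add: field_simps)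
      also have "\<dots> = emeasure \<mu> {x\<in>space \<mu>. u x = v}" using eB[OF v] by (simp only: B_def)
      finally show "ennreal (real (count_list xs v) * (1 / real K)) \<le> emeasure \<mu> {x\<in>space \<mu>. u x = v}" .
    qed
    finally show ?thesis .
  qed
  have lim: "(\<lambda>k. c / real (Suc k)) \<longlonglongrightarrow> 0" by (intro LIMSEQ_Suc lim_const_over_n)
  have "(\<lambda>k. E * (I + c / real (Suc k)) powr \<alpha>) \<longlonglongrightarrow> E * (I + 0) powr \<alpha>"
    using I0 c0 \<alpha> by (intro tendsto_mult tendsto_const tendsto_powr' tendsto_add lim) auto
  then have up: "nrm X u \<le> E * I powr \<alpha>"
    using LIMSEQ_le_const[of "\<lambda>k. E * (I + c / real (Suc k)) powr \<alpha>" _ "nrm X u"] outer[of "Suc _"]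
    by (simp del: of_nat_Suc)
  have "(\<lambda>k. D * (max 0 (I - c / real (Suc k))) powr \<alpha>) \<longlonglongrightarrow> D * (max 0 (I - 0)) powr \<alpha>"
    using \<alpha> by (intro tendsto_mult tendsto_const tendsto_powr' tendsto_max tendsto_diff lim) auto
  then have lo: "D * I powr \<alpha> \<le> nrm X u"
    using LIMSEQ_le_const2[of "\<lambda>k. D * (max 0 (I - c / real (Suc k))) powr \<alpha>" _ "nrm X u"] inner[of "Suc _"] I0
    by (simp del: of_nat_Suc)
  show ?thesis using I0 int uX lo up by blast
qed

text \<open>
  If \<open>f\<close> is in \<open>X\<close>, monotone convergence along simple functions below \<open>\<bar>f\<bar>\<close> bounds its \<open>L\<^sub>p\<close> norm.  If \<open>f\<close> is in
  \<open>L\<^sub>p\<close>, such simple functions form an increasing sequence which is Cauchy in \<open>L\<^sub>p\<close> and hence in \<open>X\<close>, and by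
  \<open>monotone_limit\<close> its limit in \<open>X\<close> dominates \<open>\<bar>f\<bar>\<close>.
\<close>

lemma same_space_Lp:
  assumes \<alpha>: "0 < \<alpha>" "\<alpha> < 1" and DE: "0 < D" "0 < E"
    and equiv: "\<And>xs K. \<forall>x\<in>set xs. 0 < x \<Longrightarrow> 0 < K \<Longrightarrow>
      D * (power_sum (1 / \<alpha>) xs / real K) powr \<alpha> \<le> nrm X (steps (1 / real K) xs) \<and>
      nrm X (steps (1 / real K) xs) \<le> E * (power_sum (1 / \<alpha>) xs / real K) powr \<alpha>"
  shows "same_space X (Lp_space (1 / \<alpha>))"
proof -
  let ?p = "1 / \<alpha>"
  have p: "0 < ?p" using \<alpha> by simp
  have simple: "\<exists>I\<ge>0. (\<integral>\<^sup>+x. ennreal (u x powr ?p) \<partial>\<mu>) = ennreal I \<and> u \<in> elts X \<and>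
      D * I powr \<alpha> \<le> nrm X u \<and> nrm X u \<le> E * I powr \<alpha>"
    if "simple_function \<mu> u" "\<And>x. 0 \<le> u x" "\<And>x. M < x \<Longrightarrow> u x = 0" for u and M :: real
    using \<alpha>(1) DE equiv that by (rule simple_norm_equivalent)
  have fwd: "integrable \<mu> (\<lambda>t. \<bar>f t\<bar> powr ?p) \<and> D * (\<integral>t. \<bar>f t\<bar> powr ?p \<partial>\<mu>) powr \<alpha> \<le> nrm X f" if f: "f \<in> elts X" for f
  proof -
    have fm[measurable]: "f \<in> borel_measurable \<mu>" by (rule measX[OF f])
    define R where "R = (nrm X f / D) powr ?p"
    have le: "(\<integral>\<^sup>+x. ennreal (\<bar>f x\<bar> powr ?p) \<partial>\<mu>) \<le> ennreal R"
    proof (rule nn_integral_le_by_simple[OF fm, where H="\<lambda>_ s. s powr ?p"])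
      fix u n assume u: "simple_function \<mu> u" "\<And>x. 0 \<le> u x" "\<And>x. u x \<le> \<bar>f x\<bar>" "\<And>x. real n < x \<Longrightarrow> u x = 0"
      have u_le: "nrm X u \<le> nrm X f"
        using u by (intro idealX[THEN conjunct2] borel_measurable_simple_function f AE_I2) simp_all
      obtain I where I: "0 \<le> I" "(\<integral>\<^sup>+x. ennreal (u x powr ?p) \<partial>\<mu>) = ennreal I" "D * I powr \<alpha> \<le> nrm X u"
        using simple[OF u(1,2,4)] by auto
      have "I powr \<alpha> \<le> nrm X f / D" using I(3) u_le DE by (simp add: field_simps)
      then have "(I powr \<alpha>) powr ?p \<le> R" unfolding R_def using p by (intro powr_mono2) auto
      then have "I \<le> R" using I(1) \<alpha> by (simp add: powr_powr)
      then show "(\<integral>\<^sup>+x. ennreal (u x powr ?p) \<partial>\<mu>) \<le> ennreal R" unfolding I(2) by (rule ennreal_leI)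
    qed (use p in \<open>auto intro!: powr_mono2 tendsto_powr'\<close>)
    then have int: "integrable \<mu> (\<lambda>t. \<bar>f t\<bar> powr ?p)" by (intro integrableI_bounded) (auto intro: le_less_trans)
    have "ennreal (\<integral>t. \<bar>f t\<bar> powr ?p \<partial>\<mu>) \<le> ennreal R" using le int by (subst nn_integral_eq_integral[symmetric]) auto
    then have "(\<integral>t. \<bar>f t\<bar> powr ?p \<partial>\<mu>) \<le> R" by (subst (asm) ennreal_le_iff) (auto simp: R_def)
    then have "(\<integral>t. \<bar>f t\<bar> powr ?p \<partial>\<mu>) powr \<alpha> \<le> R powr \<alpha>" using \<alpha> by (intro powr_mono2) auto
    also have "\<dots> = nrm X f / D" using nonnegX[OF f] DE \<alpha> by (simp add: R_def powr_powr)
    finally show ?thesis using int DE by (simp add: field_simps)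
  qed
  have bwd: "f \<in> elts X \<and> nrm X f \<le> E * (\<integral>t. \<bar>f t\<bar> powr ?p \<partial>\<mu>) powr \<alpha>"
    if fm: "f \<in> borel_measurable \<mu>" and int: "integrable \<mu> (\<lambda>t. \<bar>f t\<bar> powr ?p)" for f
  proof -
    note [measurable] = fm
    from simple_approximation[OF fm] obtain u where
      u: "(\<forall>n. simple_function \<mu> (u n)) \<and> (\<forall>n t. 0 \<le> u n t \<and> u n t \<le> \<bar>f t\<bar>) \<and>
      (\<forall>m n t. m \<le> n \<longrightarrow> u m t \<le> u n t) \<and> (\<forall>t>0. (\<lambda>n. u n t) \<longlonglongrightarrow> \<bar>f t\<bar>) \<and> (\<forall>n t. real n < t \<longrightarrow> u n t = 0)"
      by (elim exE)
    have um[measurable]: "u n \<in> borel_measurable \<mu>" for n using u by (intro borel_measurable_simple_function) simp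
    have est: "v \<in> elts X \<and> nrm X v \<le> E * (\<integral>t. g t \<partial>\<mu>) powr \<alpha>"
      if v: "simple_function \<mu> v" "\<And>x. 0 \<le> v x" "\<And>x. real N < x \<Longrightarrow> v x = 0"
        and g: "integrable \<mu> g" "\<And>x. v x powr ?p \<le> g x" for v g N
    proof -
      obtain I where I: "0 \<le> I" "(\<integral>\<^sup>+x. ennreal (v x powr ?p) \<partial>\<mu>) = ennreal I" "v \<in> elts X" "nrm X v \<le> E * I powr \<alpha>"
        using simple[OF v] by auto
      have g0: "0 \<le> g x" for x using g(2)[of x] by (meson order_trans powr_ge_zero)
      have "ennreal I \<le> (\<integral>\<^sup>+x. ennreal (g x) \<partial>\<mu>)" unfolding I(2)[symmetric] using g(2) by (intro nn_integral_mono ennreal_leI)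
      also have "\<dots> = ennreal (\<integral>x. g x \<partial>\<mu>)" using g(1) g0 by (intro nn_integral_eq_integral) auto
      finally have "I \<le> (\<integral>x. g x \<partial>\<mu>)" using g0 by (subst (asm) ennreal_le_iff) (auto intro!: integral_nonneg_AE)
      then have "E * I powr \<alpha> \<le> E * (\<integral>x. g x \<partial>\<mu>) powr \<alpha>" using I(1) \<alpha> DE by (intro mult_left_mono powr_mono2) auto
      then show ?thesis using I by simp
    qed
    define J where "J n = (\<integral>t. (\<bar>f t\<bar> - u n t) powr ?p \<partial>\<mu>)" for n
    have dle: "(\<bar>f t\<bar> - u n t) powr ?p \<le> \<bar>f t\<bar> powr ?p" for n t using u p by (intro powr_mono2) auto
    have dint: "integrable \<mu> (\<lambda>t. (\<bar>f t\<bar> - u n t) powr ?p)" for n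
      by (rule Bochner_Integration.integrable_bound[OF int]) (use dle in auto)
    have "J \<longlonglongrightarrow> (\<integral>t. 0 \<partial>\<mu>)"
      unfolding J_def
    proof (rule integral_dominated_convergence[where w="\<lambda>t. \<bar>f t\<bar> powr ?p"])
      show "AE t in \<mu>. (\<lambda>n. (\<bar>f t\<bar> - u n t) powr ?p) \<longlonglongrightarrow> 0"
      proof (rule AE_I2)
        fix t assume "t \<in> space \<mu>"
        then have "(\<lambda>n. \<bar>f t\<bar> - u n t) \<longlonglongrightarrow> \<bar>f t\<bar> - \<bar>f t\<bar>" using u by (intro tendsto_intros) auto
        then have "(\<lambda>n. (\<bar>f t\<bar> - u n t) powr ?p) \<longlonglongrightarrow> (\<bar>f t\<bar> - \<bar>f t\<bar>) powr ?p"
          using u p by (intro tendsto_powr' tendsto_const) auto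
        then show "(\<lambda>n. (\<bar>f t\<bar> - u n t) powr ?p) \<longlonglongrightarrow> 0" by simp
      qed
    qed (use int dle in auto)
    then have J: "J \<longlonglongrightarrow> 0" by simp
    have J0: "0 \<le> J n" for n by (simp add: J_def)
    have un: "u n \<in> elts X \<and> nrm X (u n) \<le> E * (\<integral>t. \<bar>f t\<bar> powr ?p \<partial>\<mu>) powr \<alpha>" for n
      using u p by (intro est[of "u n" n] int) (auto intro!: powr_mono2)
    have diff: "nrm X (\<lambda>t. u j t - u i t) \<le> E * J i powr \<alpha>" if "i \<le> j" for i j
      unfolding J_def
    proof (rule est[THEN conjunct2, of _ j])
      show "simple_function \<mu> (\<lambda>t. u j t - u i t)" using u by (intro simple_function_diff) auto
      show "0 \<le> u j t - u i t" for t using u that by simp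
      show "u j t - u i t = 0" if "real j < t" for t using u that \<open>i \<le> j\<close> by simp
      show "(u j t - u i t) powr ?p \<le> (\<bar>f t\<bar> - u i t) powr ?p" for t
        using u that p by (intro powr_mono2) auto
    qed (rule dint)
    have "(\<lambda>i. E * J i powr \<alpha>) \<longlonglongrightarrow> E * 0 powr \<alpha>"
      using J0 \<alpha> by (intro tendsto_mult tendsto_const tendsto_powr' J) auto
    then have EJ: "(\<lambda>i. E * J i powr \<alpha>) \<longlonglongrightarrow> 0" by simp
    have "\<exists>h\<in>elts X. (\<forall>n. AE t in \<mu>. u n t \<le> h t) \<and> nrm X h \<le> E * (\<integral>t. \<bar>f t\<bar> powr ?p \<partial>\<mu>) powr \<alpha>"
    proof (rule monotone_limit)
      fix \<epsilon> :: real assume "0 < \<epsilon>"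
      then obtain K where K: "\<And>i. K \<le> i \<Longrightarrow> E * J i powr \<alpha> < \<epsilon>"
        using order_tendstoD(2)[OF EJ] by (auto simp: eventually_sequentially)
      then show "\<exists>K. \<forall>i\<ge>K. \<forall>j\<ge>i. nrm X (\<lambda>t. u j t - u i t) < \<epsilon>" using diff le_less_trans by blast
    qed (use un u in auto)
    then obtain h where h: "h \<in> elts X" "\<And>n. AE t in \<mu>. u n t \<le> h t" "nrm X h \<le> E * (\<integral>t. \<bar>f t\<bar> powr ?p \<partial>\<mu>) powr \<alpha>"
      by blast
    have "AE t in \<mu>. \<forall>n. u n t \<le> h t" using h(2) by (simp add: AE_all_countable)
    then have "AE t in \<mu>. \<bar>f t\<bar> \<le> \<bar>h t\<bar>"
      using AE_space
    proof eventually_elim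
      case (elim t)
      have "\<bar>f t\<bar> \<le> h t" using elim u by (intro LIMSEQ_le_const2[of "\<lambda>n. u n t"]) auto
      then show ?case by simp
    qed
    then show ?thesis using idealX[OF fm h(1)] h(3) by auto
  qed
  have elts: "elts X = elts (Lp_space ?p)"
  proof (rule set_eqI)
    fix f
    show "f \<in> elts X \<longleftrightarrow> f \<in> elts (Lp_space ?p)"
    proof
      assume "f \<in> elts X"
      then show "f \<in> elts (Lp_space ?p)"
        unfolding Lp_space_def using conjunct1[OF fwd] measX by simp
    next
      assume "f \<in> elts (Lp_space ?p)"
      then have "f \<in> borel_measurable \<mu>" "integrable \<mu> (\<lambda>t. \<bar>f t\<bar> powr ?p)"
        unfolding Lp_space_def by simp_all
      then show "f \<in> elts X" by (rule conjunct1[OF bwd])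
    qed
  qed
  have nL: "nrm (Lp_space ?p) f = (\<integral>t. \<bar>f t\<bar> powr ?p \<partial>\<mu>) powr \<alpha>" for f by (simp add: Lp_space_def)
  have "1 / E * nrm X f \<le> nrm (Lp_space ?p) f \<and> nrm (Lp_space ?p) f \<le> 1 / D * nrm X f" if f: "f \<in> elts X" for f
  proof -
    have "D * nrm (Lp_space ?p) f \<le> nrm X f" "nrm X f \<le> E * nrm (Lp_space ?p) f"
      unfolding nL by (rule conjunct2[OF fwd[OF f]], rule conjunct2[OF bwd[OF measX[OF f] conjunct1[OF fwd[OF f]]]])
    then show ?thesis using DE by (simp add: field_simps)
  qed
  then show ?thesis unfolding same_space_def using elts DE
    by (intro conjI exI[of _ "1 / E"] exI[of _ "1 / D"]) auto
qed

end

theorem corollary5: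
  fixes X :: "real normed_lattice"
  assumes "ri_space X"
    and "reflexive X"
    and "\<And>p::real. 1 < p \<Longrightarrow> \<not> same_space X (Lp_space p)"
  shows "\<not> disjointly_homogeneous X \<or> \<not> disjointly_homogeneous (dual_space X)"
proof (rule ccontr)
  assume "\<not> ?thesis"
  then have DH: "disjointly_homogeneous X" "disjointly_homogeneous (dual_space X)" by auto
  interpret rearrangement_invariant X
    using assms(1) unfolding ri_space_def by unfold_locales blast+
  obtain \<alpha> D E where \<alpha>: "0 < \<alpha>" "\<alpha> < 1" and DE: "0 < D" "0 < E"
    and equiv: "\<And>xs K. \<forall>x\<in>set xs. 0 < x \<Longrightarrow> 0 < K \<Longrightarrow>
      D * (power_sum (1 / \<alpha>) xs / real K) powr \<alpha> \<le> nrm X (steps (1 / real K) xs) \<and>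
      nrm X (steps (1 / real K) xs) \<le> E * (power_sum (1 / \<alpha>) xs / real K) powr \<alpha>"
    using steps_norm_equivalent[OF DH assms(2)] by blast
  have "same_space X (Lp_space (1 / \<alpha>))" by (rule same_space_Lp[OF \<alpha> DE equiv])
  moreover have "1 < 1 / \<alpha>" using \<alpha> by simp
  ultimately show False using assms(3) by blast
qed

end
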